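(* Let $\{X^k\}$ be the sequence generated by the GIMSPG algorithm (described in the context), let $d^k=d^{X^k}$ be the index vectors used by the algorithm, and let $\mathcal N^s=\{k\in\mathbb N:\mu_{k+1}\neq\mu_k\}$. Then: (i) along $k\in\mathcal N^s$, the vector $d^k$ changes only a finite number of times; (ii) for any two accumulation points $\bar X$ and $X^*$ of $\{X^k: k\in\mathcal N^s\}$ one has $\mathcal A^c(\sigma(\bar X))=\mathcal A^c(\sigma(X^* ))$; moreover, if $\{X^{k_i}\}$ is a subsequence of $\{X^k:k\in\mathcal N^s\}$ with $\lim_{i\to+\infty}X^{k_i}=\bar X$, then there exists $J\in\mathbb N$ such that for every $i\ge J$ $$\big\Vert \sigma(X^{k_i})_{\mathcal A^c(\sigma(\bar X))}-\sigma(\bar X)_{\mathcal A^c(\sigma(\bar X))}\big\Vert=0 .$$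
   Context: Notation. $m\ge n$; $\mathbb R^{m\times n}$ carries the inner product $\langle X,Y\rangle=\mathrm{tr}(X^TY)$ and the Frobenius norm $\Vert\cdot\Vert$. $\sigma(X)=(\sigma_1(X),\dots,\sigma_n(X))^T$ is the vector of singular values, $\sigma_1(X)\ge\dots\ge\sigma_n(X)\ge0$. $\mathcal A(\sigma(X))=\{i\in\{1,\dots,n\}:\sigma_i(X)\ne0\}$ and $\mathcal A^c(\sigma(X))$ is its complement in $\{1,\dots,n\}$; $x_{S}$ denotes the subvector of $x$ indexed by $S$. $\mathbb N=\{0,1,2,\dots\}$, $\mathbb D^n=\{1,2\}^n$. $\partial f$ is the Clarke subdifferential. Problem. $f:\mathbb R^{m\times n}\to[0,\infty)$ is convex (not necessarily smooth), $\lambda>0$, $v>0$, $\phi(t)=\min\{1,t/v\}$ for $t\ge0$, $\Phi(X)=\sum_{i=1}^n\phi(\sigma_i(X))$, and the problem is $\min_{X}\mathcal F(X):=f(X)+\lambda\Phi(X)$. Put $\theta_1(t)=0$, $\theta_2(t)=t/v-1$, so $\phi(t)=t/v-\max\{\theta_1(t),\theta_2(t)\}$. For $d\in\mathbb D^n$, $\Phi^d(X)=\sum_{i=1}^n\big(\sigma_i(X)/v-\theta_{d_i}(\sigma_i(X))\big)$. For $X\in\mathbb R^{m\times n}$, $d^X\in\mathbb D^n$ is given by $d^X_i=1$ if $\sigma_i(X)<v$ and $d^X_i=2$ if $\sigma_i(X)\ge v$. Standing assumptions. $f$ is Lipschitz continuous on $\mathbb R^{m\times n}$ with constant $L_f$;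 $0<v<\lambda/L_f$; $\mathcal F$ (or $f(X)+\lambda\,\mathrm{rank}(X)$) is level bounded on $\mathbb R^{m\times n}$. Smoothing function. $\tilde f:\mathbb R^{m\times n}\times[0,\bar\mu]\to\mathbb R$, $\bar\mu>0$, is a smoothing function of $f$: $\tilde f(\cdot,\mu)$ is continuously differentiable for each $\mu>0$ and (i) $\lim_{Z\to X,\mu\downarrow0}\tilde f(Z,\mu)=f(X)$ for all $X$; (ii) $\tilde f(\cdot,\mu)$ is convex for each $\mu>0$; (iii) all limits of $\nabla_Z\tilde f(Z,\mu)$ as $Z\to X$, $\mu\downarrow0$ lie in $\partial f(X)$, for all $X$; (iv) there is $\kappa>0$ with $|\tilde f(X,\mu_2)-\tilde f(X,\mu_1)|\le\kappa|\mu_1-\mu_2|$ for all $X$ and $\mu_1,\mu_2\in[0,\bar\mu]$, in particular $|\tilde f(X,\mu)-f(X)|\le\kappa\mu$ for $0<\mu\le\bar\mu$; (v) there is $\tilde L>0$ such that for every $\mu\in(0,\bar\mu]$, $\nabla_X\tilde f(\cdot,\mu)$ is Lipschitz with constant $\tilde L\mu^{-1}$. Put $\widetilde{\mathcal F}(X,\mu)=\tilde f(X,\mu)+\lambda\Phi(X)$. GIMSPG algorithm. Input: $X^{-1}=X^0\in\mathbb R^{m\times n}$, $\mu_{-1}=\mu_0\in(0,\bar\mu]$, $\sigma\in(0,1)$ (a scalar, not to be confused with singular values), a constant $\alpha>0$, and parameters $\alpha_k,\beta_k,h_k$ satisfying the parameter constraints below. For $k=0,1,2,\dots$ (infinitely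 many iterations): Step 1: $d^k=d^{X^k}$. Step 2: $Y^k=X^k+\alpha_k(X^k-X^{k-1})$, $Z^k=X^k+\beta_k(X^k-X^{k-1})$, and $X^{k+1}\in\arg\min_{X\in\mathbb R^{m\times n}}Q_{d^k}(X,Y^k,Z^k,\mu_k)$, where $$Q_{d^k}(X,Y^k,Z^k,\mu_k)=\langle X-Y^k,\nabla\tilde f(Z^k,\mu_k)\rangle+\tfrac12h_k\mu_k^{-1}\Vert X-Y^k\Vert^2+\lambda\Phi^{d^k}(X).$$ Step 3: with $\delta_k=\tfrac{h_k\alpha_k}{2}$ and $$H_{\delta_{k+1}}(X^{k+1},X^k,\mu_{k+1},\mu_k)=\widetilde{\mathcal F}(X^{k+1},\mu_k)+\kappa\mu_k+\delta_{k+1}\mu_{k+1}^{-1}\Vert X^{k+1}-X^k\Vert^2,$$ if $H_{\delta_{k+1}}(X^{k+1},X^k,\mu_{k+1},\mu_k)-H_{\delta_k}(X^k,X^{k-1},\mu_k,\mu_{k-1})\le-\alpha\mu_k^2$ (tested with $\mu_{k+1}=\mu_k$), set $\mu_{k+1}=\mu_k$; otherwise set $\mu_{k+1}=\mu_0/(k+1)^\sigma$. Parameter constraints. For a fixed small $\varepsilon\in(0,1)$: $\{\alpha_k\}$ is nonincreasing with $\alpha_k\in[0,\frac{1-2^\sigma\varepsilon}{1+2^\sigma})$, $\beta_k\in[0,1]$, $\{h_k\}$ is a nonincreasing positive sequence, and $$h_0^{-1}\le h_k^{-1}\le\min\Big\{\frac{1-\alpha_k-(\alpha_k+\varepsilon)\frac{\mu_k}{\mu_{k+1}}}{(1-\beta_k)\tilde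 L},\ \frac{\alpha_k}{\beta_k\tilde L}\Big\},$$ where a bound with zero denominator is read in multiplied-out form, i.e. $(1-\beta_k)\tilde Lh_k^{-1}\le1-\alpha_k-(\alpha_k+\varepsilon)\mu_k/\mu_{k+1}$ and $\beta_k\tilde Lh_k^{-1}\le\alpha_k$. *)

theory Defs
  imports "HOL-Analysis.Analysis" "HOL-Computational_Algebra.Polynomial"
    "HOL-Library.Extended_Real" "HOL-Library.FuncSet"
begin

(* A real m x n matrix is an element of real^'n^'m.  On this type the library's norm is the
   Frobenius norm and the library's inner product is tr (X^T Y). *)

subsection \<open>Singular values\<close>

definition charpoly :: "real^'n^'n \<Rightarrow> real poly" where
  "charpoly A = det (\<chi> i j. (if i = j then [:0, 1:] else 0) - [:A $ i $ j:])"

(* Square roots of the eigenvalues of X^T X, with algebraic multiplicity, in decreasing order.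
   The list has length CARD('n) since X^T X is symmetric and its eigenvalues are all real. *)
definition sing_vals :: "real^'n^'m \<Rightarrow> real list" where
  "sing_vals X =
     rev (sorted_list_of_multiset (image_mset sqrt (proots (charpoly (transpose X ** X)))))"

(* The indices run from 1 to CARD('n). *)
definition sing_val :: "real^'n^'m \<Rightarrow> nat \<Rightarrow> real" where
  "sing_val X i = sing_vals X ! (i - 1)"

definition sv_support :: "real^'n^'m \<Rightarrow> nat set" where
  "sv_support X = {i \<in> {1..CARD('n)}. sing_val X i \<noteq> 0}"

definition sv_cosupport :: "real^'n^'m \<Rightarrow> nat set" where
  "sv_cosupport X = {1..CARD('n)} - sv_support X"

subsection \<open>Clarke subdifferential and gradient\<close>

definition clarke_dir_deriv :: "('a::euclidean_space \<Rightarrow> real) \<Rightarrow> 'a \<Rightarrow> 'a \<Rightarrow> ereal" where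
  "clarke_dir_deriv f x w =
     Limsup (nhds x \<times>\<^sub>F at_right 0) (\<lambda>(y, t). ereal ((f (y + t *\<^sub>R w) - f y) / t))"

definition clarke_subdiff :: "('a::euclidean_space \<Rightarrow> real) \<Rightarrow> 'a \<Rightarrow> 'a set" where
  "clarke_subdiff f x = {g. \<forall>w. ereal (inner g w) \<le> clarke_dir_deriv f x w}"

definition grad :: "('a::euclidean_space \<Rightarrow> real) \<Rightarrow> 'a \<Rightarrow> 'a" where
  "grad f x = (THE g. GDERIV f x :> g)"

definition level_bounded :: "('a::euclidean_space \<Rightarrow> real) \<Rightarrow> bool" where
  "level_bounded f \<longleftrightarrow> (\<forall>c. bounded {x. f x \<le> c})"

subsection \<open>Relaxation of the rank\<close>

definition phi :: "real \<Rightarrow> real \<Rightarrow> real" where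
  "phi v t = min 1 (t / v)"

definition Phi :: "real \<Rightarrow> real^'n^'m \<Rightarrow> real" where
  "Phi v X = (\<Sum>i = 1..CARD('n). phi v (sing_val X i))"

definition theta :: "real \<Rightarrow> nat \<Rightarrow> real \<Rightarrow> real" where
  "theta v j t = (if j = 1 then 0 else t / v - 1)"

definition Phi_d :: "real \<Rightarrow> (nat \<Rightarrow> nat) \<Rightarrow> real^'n^'m \<Rightarrow> real" where
  "Phi_d v d X = (\<Sum>i = 1..CARD('n). sing_val X i / v - theta v (d i) (sing_val X i))"

(* An element of {1..CARD('n)} \<rightarrow>\<^sub>E {1, 2}: two such functions are equal iff they agree as vectors. *)
definition d_of :: "real \<Rightarrow> real^'n^'m \<Rightarrow> nat \<Rightarrow> nat" where
  "d_of v X = (\<lambda>i\<in>{1..CARD('n)}. if sing_val X i < v then 1 else 2)"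

definition objective :: "(real^'n^'m \<Rightarrow> real) \<Rightarrow> real \<Rightarrow> real \<Rightarrow> real^'n^'m \<Rightarrow> real" where
  "objective f lam v X = f X + lam * Phi v X"

subsection \<open>Smoothing functions\<close>

(* Only the values ft X \<mu> with \<mu> in {0..mubar} matter. *)
definition smoothing_function ::
  "(real^'n^'m \<Rightarrow> real) \<Rightarrow> (real^'n^'m \<Rightarrow> real \<Rightarrow> real) \<Rightarrow> real \<Rightarrow> real \<Rightarrow> real \<Rightarrow> bool" where
  "smoothing_function f ft mubar \<kappa> Lt \<longleftrightarrow>
     0 < mubar \<and> 0 < \<kappa> \<and> 0 < Lt \<and>
     (\<forall>\<mu>\<in>{0<..mubar}. (\<forall>X. (\<lambda>Z. ft Z \<mu>) differentiable (at X)) \<and>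
                      continuous_on UNIV (grad (\<lambda>Z. ft Z \<mu>))) \<and>
     (\<forall>X. ((\<lambda>(Z, \<mu>). ft Z \<mu>) \<longlongrightarrow> f X) (nhds X \<times>\<^sub>F at_right 0)) \<and>
     (\<forall>\<mu>\<in>{0<..mubar}. convex_on UNIV (\<lambda>Z. ft Z \<mu>)) \<and>
     (\<forall>X Z \<mu> G. Z \<longlonglongrightarrow> X \<and> range \<mu> \<subseteq> {0<..mubar} \<and> \<mu> \<longlonglongrightarrow> 0 \<and>
                 (\<lambda>j. grad (\<lambda>W. ft W (\<mu> j)) (Z j)) \<longlonglongrightarrow> G
                 \<longrightarrow> G \<in> clarke_subdiff f X) \<and>
     (\<forall>X. \<forall>\<mu>1\<in>{0..mubar}. \<forall>\<mu>2\<in>{0..mubar}. \<bar>ft X \<mu>2 - ft X \<mu>1\<bar> \<le> \<kappa> * \<bar>\<mu>1 - \<mu>2\<bar>) \<and>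
     (\<forall>\<mu>\<in>{0<..mubar}. (Lt / \<mu>)-lipschitz_on UNIV (grad (\<lambda>Z. ft Z \<mu>)))"

definition smoothed_objective ::
  "(real^'n^'m \<Rightarrow> real \<Rightarrow> real) \<Rightarrow> real \<Rightarrow> real \<Rightarrow> real^'n^'m \<Rightarrow> real \<Rightarrow> real" where
  "smoothed_objective ft lam v X \<mu> = ft X \<mu> + lam * Phi v X"

subsection \<open>The algorithm\<close>

definition Q_fun ::
  "(real^'n^'m \<Rightarrow> real \<Rightarrow> real) \<Rightarrow> real \<Rightarrow> real \<Rightarrow> real \<Rightarrow> (nat \<Rightarrow> nat) \<Rightarrow>
   real^'n^'m \<Rightarrow> real^'n^'m \<Rightarrow> real^'n^'m \<Rightarrow> real \<Rightarrow> real" where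
  "Q_fun ft lam v h d X Y Z \<mu> =
     inner (X - Y) (grad (\<lambda>W. ft W \<mu>) Z) + 1/2 * h * inverse \<mu> * (norm (X - Y))\<^sup>2
     + lam * Phi_d v d X"

definition H_fun ::
  "(real^'n^'m \<Rightarrow> real \<Rightarrow> real) \<Rightarrow> real \<Rightarrow> real \<Rightarrow> real \<Rightarrow> real \<Rightarrow>
   real^'n^'m \<Rightarrow> real^'n^'m \<Rightarrow> real \<Rightarrow> real \<Rightarrow> real" where
  "H_fun ft lam v \<kappa> \<delta> X X' \<mu> \<mu>' =
     smoothed_objective ft lam v X \<mu>' + \<kappa> * \<mu>' + \<delta> * inverse \<mu> * (norm (X - X'))\<^sup>2"

(* The last two lines are the two bounds on 1 / h k multiplied out by their denominators. *)
definition parameter_constraints ::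
  "real \<Rightarrow> real \<Rightarrow> real \<Rightarrow> (nat \<Rightarrow> real) \<Rightarrow> (nat \<Rightarrow> real) \<Rightarrow> (nat \<Rightarrow> real) \<Rightarrow> (nat \<Rightarrow> real) \<Rightarrow> bool" where
  "parameter_constraints \<epsilon> \<sigma> Lt \<alpha> \<beta> h \<mu> \<longleftrightarrow>
     0 < \<epsilon> \<and> \<epsilon> < 1 \<and>
     decseq \<alpha> \<and> (\<forall>k. 0 \<le> \<alpha> k \<and> \<alpha> k < (1 - 2 powr \<sigma> * \<epsilon>) / (1 + 2 powr \<sigma>)) \<and>
     (\<forall>k. 0 \<le> \<beta> k \<and> \<beta> k \<le> 1) \<and>
     decseq h \<and> (\<forall>k. 0 < h k) \<and>
     (\<forall>k. inverse (h 0) \<le> inverse (h k) \<and>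
          (1 - \<beta> k) * Lt * inverse (h k) \<le> 1 - \<alpha> k - (\<alpha> k + \<epsilon>) * (\<mu> k / \<mu> (Suc k)) \<and>
          \<beta> k * Lt * inverse (h k) \<le> \<alpha> k)"

(* Natural subtraction truncates, so X (k - 1) and \<mu> (k - 1) at k = 0 are X 0 and \<mu> 0; this is
   the initialisation of the sequences at index -1 by their values at index 0. *)
definition GIMSPG ::
  "(real^'n^'m \<Rightarrow> real \<Rightarrow> real) \<Rightarrow> real \<Rightarrow> real \<Rightarrow> real \<Rightarrow> real \<Rightarrow> real \<Rightarrow> real \<Rightarrow>
   (nat \<Rightarrow> real) \<Rightarrow> (nat \<Rightarrow> real) \<Rightarrow> (nat \<Rightarrow> real) \<Rightarrow>
   (nat \<Rightarrow> real^'n^'m) \<Rightarrow> (nat \<Rightarrow> real) \<Rightarrow> bool" where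
  "GIMSPG ft lam v mubar \<kappa> \<sigma> a \<alpha> \<beta> h X \<mu> \<longleftrightarrow>
     0 < \<mu> 0 \<and> \<mu> 0 \<le> mubar \<and> 0 < \<sigma> \<and> \<sigma> < 1 \<and> 0 < a \<and>
     (\<forall>k. let Y = X k + \<alpha> k *\<^sub>R (X k - X (k - 1));
              Z = X k + \<beta> k *\<^sub>R (X k - X (k - 1));
              \<delta> = (\<lambda>j. h j * \<alpha> j / 2)
          in is_arg_min (\<lambda>W. Q_fun ft lam v (h k) (d_of v (X k)) W Y Z (\<mu> k)) (\<lambda>_. True) (X (Suc k)) \<and>
             \<mu> (Suc k) =
               (if H_fun ft lam v \<kappa> (\<delta> (Suc k)) (X (Suc k)) (X k) (\<mu> k) (\<mu> k)
                   - H_fun ft lam v \<kappa> (\<delta> k) (X k) (X (k - 1)) (\<mu> k) (\<mu> (k - 1))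
                   \<le> - a * (\<mu> k)\<^sup>2
                then \<mu> k else \<mu> 0 / (real (k + 1) powr \<sigma>)))"

definition mu_change_indices :: "(nat \<Rightarrow> real) \<Rightarrow> nat set" where
  "mu_change_indices \<mu> = {k. \<mu> (Suc k) \<noteq> \<mu> k}"

subsection \<open>Behaviour of a sequence along an index set\<close>

(* k is counted when the sequence takes different values at k and at the next element of N. *)
definition changes_finitely_often_along :: "nat set \<Rightarrow> (nat \<Rightarrow> 'b) \<Rightarrow> bool" where
  "changes_finitely_often_along N d \<longleftrightarrow>
     finite {k \<in> N. \<exists>l\<in>N. k < l \<and> (\<forall>j\<in>N. \<not> (k < j \<and> j < l)) \<and> d l \<noteq> d k}"

definition accumulation_point_along ::
  "nat set \<Rightarrow> (nat \<Rightarrow> 'a::topological_space) \<Rightarrow> 'a \<Rightarrow> bool" where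
  "accumulation_point_along N X x \<longleftrightarrow>
     (\<exists>r. strict_mono r \<and> range r \<subseteq> N \<and> (\<lambda>i. X (r i)) \<longlonglongrightarrow> x)"

end

theory Submission
  imports Defs
begin

text \<open>
  Why the theorem holds.  Write \<open>\<Delta>\<^sub>k = X\<^sup>k - X\<^sup>k\<^sup>-\<^sup>1\<close> and \<open>c = \<lambda>/v - L\<^sub>f > 0\<close>.  A convex function that stays within
  a bounded distance of an \<open>L\<^sub>f\<close>-Lipschitz function has gradients of norm at most \<open>L\<^sub>f\<close>, so in every
  step the shrinkage \<open>\<lambda>/v\<close> that acts on the singular values with \<open>d\<^sub>i = 1\<close> beats the gradient by \<open>c\<close>.
  The merit function \<open>H\<close> decreases by a multiple of \<open>\<parallel>\<Delta>\<^sub>k\<^sub>+\<^sub>1\<parallel>\<^sup>2/\<mu>\<^sub>k\<^sub>+\<^sub>1\<close>, which is therefore summable; and at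
  an index \<open>k\<close> where the smoothing parameter changes, the failed test forces both \<open>\<parallel>\<Delta>\<^sub>k\<^sub>+\<^sub>1\<parallel>\<close> and the
  inertial term \<open>\<alpha>\<^sub>k\<parallel>\<Delta>\<^sub>k\<parallel>\<close> down to \<open>O(\<mu>\<^sub>k\<^sup>3\<^sup>/\<^sup>2)\<close> (\<open>small_steps_at_change\<close>).

  At such an index the step is too short for a singular value with \<open>d\<^sub>i = 1\<close> to survive
  (\<open>surviving_sing_val\<close>).  Hence, for large \<open>k\<close>, the singular values of \<open>X\<^sup>k\<close> are either at least
  \<open>v\<close> or tiny, and \<open>d\<^sup>k\<close> is determined by the number of large ones.

  This number settles down because of a second Lyapunov function.  Choose a smooth nondecreasing ramp
  that rises from \<open>0\<close> to a constant between \<open>v/4\<close> and \<open>3v/4\<close>, and sum it over the singular values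
  (\<open>soft_count\<close>).  Its gradient lives on singular values below \<open>v\<close>, which the shrinkage pushes down;
  so it can only grow through inertia, which is damped by \<open>\<alpha>\<^sub>k \<le> \<alpha>\<^sub>0 < 1\<close>, and through second-order
  terms, which are summable.  It converges (\<open>soft_count_convergent\<close>), and at the change indices it
  equals a constant times the number of large singular values.  That number is therefore eventually a
  constant \<open>r\<close>, which is (i), and the convergence also keeps \<open>\<sigma>\<^sub>r(X\<^sup>k) \<ge> v/4\<close> for all large \<open>k\<close>,
  between the change indices as well.

  It remains to see that the tiny singular values are exactly zero at the change indices.  They vanish
  one step later.  From then on the rank cannot rise above \<open>r\<close>: the matrices of rank at most \<open>r\<close> are
  curved only to second order where \<open>\<sigma>\<^sub>r\<close> is bounded below, so the extrapolation of two iterates of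
  rank at most \<open>r\<close> leaves this set by \<open>O(\<parallel>\<Delta>\<^sub>k\<parallel>\<^sup>2) = o(\<mu>\<^sub>k)\<close> (\<open>low_rank_second_order\<close>), while the shrinkage
  is of order \<open>\<mu>\<^sub>k\<close> (\<open>eventually_low_rank\<close>).  Since singular values are 1-Lipschitz, (ii) follows by
  passing to the limit.
\<close>

section \<open>Self-adjoint maps\<close>

text \<open>A maximiser of the Rayleigh quotient on the unit sphere of the invariant subspace is an
  eigenvector, by the first-order condition at the maximum.\<close>

lemma self_adjoint_eigenvector:
  fixes A :: "'a::euclidean_space \<Rightarrow> 'a"
  assumes lin: "linear A" and sym: "\<And>x y. A x \<bullet> y = x \<bullet> A y"
    and W: "subspace W" and inv: "\<And>x. x \<in> W \<Longrightarrow> A x \<in> W" and ne: "w \<in> W" "w \<noteq> 0"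
  obtains x c where "x \<in> W" "norm x = 1" "A x = c *\<^sub>R x"
proof -
  let ?S = "W \<inter> sphere 0 1"
  have "compact ?S"
    using W closed_subspace by (intro closed_Int_compact) auto
  moreover have "w /\<^sub>R norm w \<in> ?S"
    using ne W by (auto simp: subspace_scale)
  moreover have cont: "continuous_on ?S (\<lambda>x. x \<bullet> A x)"
    using lin by (intro continuous_intros linear_continuous_on) (simp add: linear_conv_bounded_linear)
  ultimately obtain x where x: "x \<in> ?S" and max: "\<And>y. y \<in> ?S \<Longrightarrow> y \<bullet> A y \<le> x \<bullet> A x"
    using continuous_attains_sup[of ?S "\<lambda>x. x \<bullet> A x"] by blast
  define c where "c = x \<bullet> A x"
  have xx: "x \<bullet> x = 1" using x by (simp add: norm_eq_1)
  have quad: "y \<bullet> A y \<le> c * (y \<bullet> y)" if "y \<in> W" for y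
  proof (cases "y = 0")
    case False
    have "y /\<^sub>R norm y \<in> ?S" using False that W by (auto simp: subspace_scale)
    from max[OF this] have "(y \<bullet> A y) / (norm y)\<^sup>2 \<le> c"
      by (simp add: linear_scale[OF lin] c_def power2_eq_square divide_inverse mult_ac)
    then show ?thesis using False
      by (simp add: divide_le_eq power2_norm_eq_inner)
  qed (simp add: linear_0[OF lin])
  have stat: "z \<bullet> (A x - c *\<^sub>R x) = 0" if z: "z \<in> W" for z
  proof -
    define b where "b = z \<bullet> (A x - c *\<^sub>R x)"
    define q where "q = c * (z \<bullet> z) - z \<bullet> A z"
    have key: "2 * t * b \<le> t\<^sup>2 * q" for t :: real
    proof -
      have "x + t *\<^sub>R z \<in> W" using x z W by (auto simp: subspace_add subspace_scale)
      from quad[OF this] show ?thesis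
        using sym[of x z] xx
        by (simp add: b_def q_def linear_add[OF lin] linear_scale[OF lin] algebra_simps
            inner_simps power2_eq_square c_def[symmetric] inner_commute)
    qed
    have q: "q \<ge> 0" using quad[OF z] by (simp add: q_def)
    have "2 * b\<^sup>2 * (1 + q) \<le> b\<^sup>2 * q"
    proof -
      have "b = (1 + q) * (b / (1 + q))" using q by (simp add: field_simps)
      then obtain t where t: "b = (1 + q) * t" by blast
      have "(1 + q)\<^sup>2 * (2 * t * b) \<le> (1 + q)\<^sup>2 * (t\<^sup>2 * q)"
        by (intro mult_left_mono key) auto
      then show ?thesis by (simp add: t power2_eq_square algebra_simps)
    qed
    then have "b\<^sup>2 * (2 + q) \<le> 0" by (simp add: algebra_simps)
    then have "b\<^sup>2 \<le> 0" using q by (simp add: mult_le_0_iff)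
    then show ?thesis by (simp add: b_def)
  qed
  have "A x - c *\<^sub>R x \<in> W"
    using x W inv by (auto simp: subspace_diff subspace_scale)
  from stat[OF this] have "A x = c *\<^sub>R x" by simp
  then show ?thesis using that x by auto
qed

lemma self_adjoint_orthonormal_eigenbasis:
  fixes A :: "'a::euclidean_space \<Rightarrow> 'a"
  assumes lin: "linear A" and sym: "\<And>x y. A x \<bullet> y = x \<bullet> A y"
  obtains B where "finite B" "card B = DIM('a)" "pairwise orthogonal B" "\<And>b. b \<in> B \<Longrightarrow> norm b = 1"
    "\<And>b. b \<in> B \<Longrightarrow> \<exists>c. A b = c *\<^sub>R b"
proof -
  have "k \<le> DIM('a) \<Longrightarrow> \<exists>B. finite B \<and> card B = k \<and> pairwise orthogonal B \<and>
      (\<forall>b\<in>B. norm b = 1 \<and> (\<exists>c. A b = c *\<^sub>R b))" for k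
  proof (induction k)
    case 0
    then show ?case by (intro exI[of _ "{}"]) auto
  next
    case (Suc k)
    then obtain B where B: "finite B" "card B = k" "pairwise orthogonal B"
      "\<forall>b\<in>B. norm b = 1 \<and> (\<exists>c. A b = c *\<^sub>R b)" by auto
    define W where "W = {y. \<forall>b\<in>B. orthogonal b y}"
    have sub: "subspace W" unfolding W_def by (rule subspace_orthogonal_to_vectors)
    have "dim B < DIM('a)"
      using dim_le_card'[OF B(1)] B(2) Suc.prems by linarith
    then obtain w where "w \<noteq> 0" "\<And>y. y \<in> span B \<Longrightarrow> orthogonal w y"
      using orthogonal_to_subspace_exists[of B] by auto
    then have w: "w \<in> W" "w \<noteq> 0"
      by (auto simp: W_def orthogonal_commute span_base)
    have inv: "A y \<in> W" if "y \<in> W" for y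
      unfolding W_def
    proof safe
      fix b assume b: "b \<in> B"
      then obtain c where "A b = c *\<^sub>R b" using B(4) by auto
      then show "orthogonal b (A y)"
        using that b sym[of b y] by (simp add: W_def orthogonal_def)
    qed
    obtain x c where x: "x \<in> W" "norm x = 1" "A x = c *\<^sub>R x"
      using self_adjoint_eigenvector[OF lin sym sub inv w] by metis
    have "x \<notin> B" using x by (auto simp: W_def orthogonal_def norm_eq_1)
    then show ?case using B x
      by (intro exI[of _ "insert x B"])
        (auto simp: pairwise_insert W_def orthogonal_commute)
  qed
  from this[of "DIM('a)"] show ?thesis using that by auto
qed

section \<open>Singular value decomposition\<close>

definition outer :: "real^'m \<Rightarrow> real^'n \<Rightarrow> real^'n^'m" where
  "outer u w = (\<chi> i j. u $ i * w $ j)"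

lemma outer_mult_vector: "outer u w *v x = (w \<bullet> x) *\<^sub>R u"
  by (simp add: vec_eq_iff outer_def matrix_vector_mult_def inner_vec_def sum_distrib_left mult_ac)

lemma inner_outer: "outer u w \<bullet> M = u \<bullet> (M *v w)"
  by (simp add: outer_def inner_vec_def matrix_vector_mult_def sum_distrib_left mult_ac)

lemma norm_outer: "norm (outer u w) = norm u * norm w"
proof -
  have "(norm (outer u w))\<^sup>2 = (norm u * norm w)\<^sup>2"
    by (simp add: power2_norm_eq_inner inner_outer outer_mult_vector power_mult_distrib)
  then show ?thesis by simp
qed

lemma norm_matrix_vector_le: "norm (M *v w) \<le> norm M * norm (w :: real^'n)"
proof -
  have "(norm (M *v w))\<^sup>2 = outer (M *v w) w \<bullet> M"
    by (simp add: inner_outer power2_norm_eq_inner)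
  also have "\<dots> \<le> norm (M *v w) * norm w * norm M"
    using norm_cauchy_schwarz[of "outer (M *v w) w" M] by (simp add: norm_outer)
  finally have "norm (M *v w) * norm (M *v w) \<le> norm (M *v w) * (norm M * norm w)"
    by (simp add: power2_eq_square mult_ac)
  then show ?thesis
    by (cases "M *v w = 0") auto
qed

definition dyad_sum :: "(nat \<Rightarrow> real^'m) \<Rightarrow> (nat \<Rightarrow> real^'n) \<Rightarrow> (nat \<Rightarrow> real) \<Rightarrow> real^'n^'m" where
  "dyad_sum U V e = (\<Sum>i = 1..CARD('n). e i *\<^sub>R outer (U i) (V i))"

definition orthonormal_frame :: "(nat \<Rightarrow> real^'n) \<Rightarrow> bool" where
  "orthonormal_frame V \<longleftrightarrow>
     (\<forall>i\<in>{1..CARD('n)}. \<forall>j\<in>{1..CARD('n)}. V i \<bullet> V j = (if i = j then 1 else 0))"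

text \<open>The left vectors are required to be orthonormal only where the singular value is nonzero, and are zero
  elsewhere: this form exists for every shape of \<open>X\<close>, wide or tall.
  Accordingly, the lemmas on \<open>dyad_sum U V e\<close> ask that \<open>e\<close> vanish where \<open>s\<close> does.\<close>

definition svd ::
  "real^'n^'m \<Rightarrow> (nat \<Rightarrow> real^'m) \<Rightarrow> (nat \<Rightarrow> real^'n) \<Rightarrow> (nat \<Rightarrow> real) \<Rightarrow> bool" where
  "svd X U V s \<longleftrightarrow> orthonormal_frame V \<and>
     (\<forall>i\<in>{1..CARD('n)}. \<forall>j\<in>{1..CARD('n)}. U i \<bullet> U j = (if i = j \<and> s i \<noteq> 0 then 1 else 0)) \<and>
     antimono_on {1..CARD('n)} s \<and> (\<forall>i\<in>{1..CARD('n)}. 0 \<le> s i) \<and> X = dyad_sum U V s"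

lemma sum_matrix_vector_mult: "(\<Sum>i\<in>S. M i) *v x = (\<Sum>i\<in>S. M i *v (x :: real^'n))"
  by (induction S rule: infinite_finite_induct) (auto simp: matrix_vector_mult_add_rdistrib)

lemma dyad_sum_mult_vector: "dyad_sum U V e *v x = (\<Sum>i = 1..CARD('n). (e i * (V i \<bullet> x)) *\<^sub>R U i)"
  for V :: "nat \<Rightarrow> real^'n"
  by (simp add: dyad_sum_def sum_matrix_vector_mult outer_mult_vector scaleR_matrix_vector_assoc[symmetric])

lemma inner_dyad_sum: "dyad_sum U V e \<bullet> M = (\<Sum>i = 1..CARD('n). e i * (U i \<bullet> (M *v V i)))"
  for V :: "nat \<Rightarrow> real^'n"
  by (simp add: dyad_sum_def inner_sum_left inner_outer)

lemma dyad_sum_diff: "dyad_sum U V e - dyad_sum U V e' = dyad_sum U V (\<lambda>i. e i - e' i)"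
  and dyad_sum_add: "dyad_sum U V e + dyad_sum U V e' = dyad_sum U V (\<lambda>i. e i + e' i)"
  and dyad_sum_scale: "c *\<^sub>R dyad_sum U V e = dyad_sum U V (\<lambda>i. c * e i)"
  by (simp_all add: dyad_sum_def sum_subtractf sum.distrib scaleR_left_diff_distrib
      scaleR_left_distrib scaleR_sum_right)

lemma dyad_sum_mult_right_vector:
  assumes "svd X U V s" "i \<in> {1..CARD('n)}"
  shows "dyad_sum U V e *v (V i :: real^'n) = e i *\<^sub>R U i"
proof -
  have "dyad_sum U V e *v V i = (\<Sum>j = 1..CARD('n). (if j = i then e j *\<^sub>R U j else 0))"
    unfolding dyad_sum_mult_vector using assms by (intro sum.cong) (auto simp: svd_def orthonormal_frame_def)
  then show ?thesis using assms by simp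
qed

lemma inner_dyad_sums:
  assumes sv: "svd X U V s" and z: "\<And>i. i \<in> {1..CARD('n)} \<Longrightarrow> s i = 0 \<Longrightarrow> e i = 0"
  shows "dyad_sum U (V :: nat \<Rightarrow> real^'n) e \<bullet> dyad_sum U V e' = (\<Sum>i = 1..CARD('n). e i * e' i)"
  unfolding inner_dyad_sum
proof (intro sum.cong refl)
  fix i assume i: "i \<in> {1..CARD('n)}"
  have "U i \<bullet> U i = (if s i \<noteq> 0 then 1 else 0)"
    using sv i unfolding svd_def by simp
  then show "e i * (U i \<bullet> (dyad_sum U V e' *v V i)) = e i * e' i"
    unfolding dyad_sum_mult_right_vector[OF sv i] using z[OF i] by auto
qed

lemma dim_span_orthonormal_frame:
  fixes V :: "nat \<Rightarrow> real^'n"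
  assumes V: "orthonormal_frame V" and S: "S \<subseteq> {1..CARD('n)}"
  shows "dim (span (V ` S)) = card S"
proof -
  have inj: "inj_on V S"
  proof (rule inj_onI)
    fix i j assume "i \<in> S" "j \<in> S" "V i = V j"
    moreover have "V i \<bullet> V i = 1"
      using \<open>i \<in> S\<close> S V unfolding orthonormal_frame_def by auto
    moreover have "V i \<bullet> V j = (if i = j then 1 else 0)"
      using \<open>i \<in> S\<close> \<open>j \<in> S\<close> S V unfolding orthonormal_frame_def by blast
    ultimately show "i = j" by (auto split: if_splits)
  qed
  have "V i \<bullet> V j = 0" if "i \<in> S" "j \<in> S" "V i \<noteq> V j" for i j
    using that V S unfolding orthonormal_frame_def by (metis subsetD)
  then have "pairwise orthogonal (V ` S)"
    by (auto simp: pairwise_def orthogonal_def)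
  moreover have "0 \<notin> V ` S"
  proof
    assume "0 \<in> V ` S"
    then obtain i where i: "i \<in> S" "V i = 0" by auto
    have "V i \<bullet> V i = 1"
      using i(1) S V unfolding orthonormal_frame_def by auto
    then show False using i by simp
  qed
  ultimately have "independent (V ` S)" by (rule pairwise_orthogonal_independent)
  then show ?thesis
    using dim_span_eq_card_independent card_image[OF inj] by metis
qed

lemma orthonormal_frame_span:
  fixes V :: "nat \<Rightarrow> real^'n"
  assumes "orthonormal_frame V"
  shows "span (V ` {1..CARD('n)}) = UNIV"
  using dim_span_orthonormal_frame[OF assms subset_refl] dim_eq_full[of "V ` {1..CARD('n)}"]
  by (simp add: dim_span)

lemma matrix_eq_on_frame:
  fixes A B :: "real^'n^'m"
  assumes "orthonormal_frame V" "\<And>i. i \<in> {1..CARD('n)} \<Longrightarrow> A *v V i = B *v V i"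
  shows "A = B"
proof -
  have "A *v x = B *v x" for x
  proof (rule linear_eq_on_span[of "(*v) A" "(*v) B"])
    show "linear ((*v) A)" "linear ((*v) B)" by auto
    show "x \<in> span (V ` {1..CARD('n)})" using orthonormal_frame_span[OF assms(1)] by simp
  qed (use assms(2) in auto)
  then show ?thesis by (simp add: matrix_eq)
qed

lemma span_frame_comb:
  fixes V :: "nat \<Rightarrow> real^'n"
  assumes "z \<in> span (V ` S)" "finite S"
  obtains c where "z = (\<Sum>i\<in>S. c i *\<^sub>R V i)"
proof -
  have "\<exists>c. z = (\<Sum>i\<in>S. c i *\<^sub>R V i)"
    using assms(1)
  proof (induction rule: span_induct_alt)
    case base
    then show ?case by (intro exI[of _ "\<lambda>_. 0"]) simp
  next
    case (step a x y)
    then obtain j c where j: "j \<in> S" "x = V j" and y: "y = (\<Sum>i\<in>S. c i *\<^sub>R V i)" by auto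
    have "(\<Sum>i\<in>S. (if i = j then a else 0) *\<^sub>R V i) = a *\<^sub>R V j"
      using j assms(2) by (simp add: if_distrib[of "\<lambda>t. t *\<^sub>R _"] cong: if_cong)
    then show ?case using j y
      by (intro exI[of _ "\<lambda>i. (if i = j then a else 0) + c i"])
        (simp add: scaleR_left_distrib sum.distrib)
  qed
  then show ?thesis using that by blast
qed

lemma subspaces_common_vector:
  fixes S T :: "(real^'n) set"
  assumes "subspace S" "subspace T" "dim S + dim T > CARD('n)"
  obtains z where "z \<in> S" "z \<in> T" "z \<noteq> 0"
proof -
  have "dim {x + y |x y. x \<in> S \<and> y \<in> T} + dim (S \<inter> T) = dim S + dim T"
    by (rule dim_sums_Int[OF assms(1,2)])
  moreover have "dim {x + y |x y. x \<in> S \<and> y \<in> T} \<le> CARD('n)"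
    using dim_subset_UNIV[of "{x + y |x y. x \<in> S \<and> y \<in> T}"] by simp
  ultimately have "dim (S \<inter> T) \<noteq> 0" using assms(3) by linarith
  then have "\<not> S \<inter> T \<subseteq> {0}" by (simp add: dim_eq_0)
  then show ?thesis using that by auto
qed

lemma const_poly_sum: "[:\<Sum>i\<in>S. f i:] = (\<Sum>i\<in>S. [:f i:])"
proof (induction S rule: infinite_finite_induct)
  case (insert x F)
  have "[:f x + y:] = [:f x:] + [:y:]" for y by simp
  then show ?case using insert by (metis sum.insert)
qed auto

text \<open>Over the polynomial ring, the orthogonal matrix \<open>P\<close> of the frame conjugates \<open>x I - A\<close> to a diagonal
  matrix; the determinant of \<open>P\<close> is invertible, so it cancels.\<close>

lemma proots_charpoly_frame:
  fixes A :: "real^'n^'n"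
  assumes V: "orthonormal_frame V"
    and eig: "\<And>i. i \<in> {1..CARD('n)} \<Longrightarrow> A *v V i = l i *\<^sub>R V i"
  shows "proots (charpoly A) = image_mset l (mset_set {1..CARD('n)})"
proof -
  obtain b :: "'n \<Rightarrow> nat" where b: "bij_betw b UNIV {1..CARD('n)}"
    using finite_same_card_bij[of "UNIV :: 'n set" "{1..CARD('n)}"] by auto
  have bI: "b i \<in> {1..CARD('n)}" for i using b by (auto simp: bij_betw_def)
  have binj: "b i = b j \<longleftrightarrow> i = j" for i j using b by (auto simp: bij_betw_def inj_on_def)
  define P :: "real^'n^'n" where "P = (\<chi> i j. V (b j) $ i)"
  define D :: "real^'n^'n" where "D = (\<chi> i j. if i = j then l (b j) else 0)"
  define C :: "real^'n^'n \<Rightarrow> real poly^'n^'n" where "C = (\<lambda>M. \<chi> i j. [:M $ i $ j:])"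
  define x :: "real poly^'n^'n" where "x = (\<chi> i j. if i = j then [:0, 1:] else 0)"
  have C_mult: "C (M ** N) = C M ** C N" for M N
    by (simp add: C_def matrix_matrix_mult_def vec_eq_iff const_poly_sum mult.commute)
  have x_comm: "x ** M = M ** x" for M
    by (simp add: x_def matrix_matrix_mult_def vec_eq_iff if_distrib[of "\<lambda>t. t * _"]
        if_distrib[of "\<lambda>t. _ * t"] mult.commute cong: if_cong)
  have C1: "C (mat 1) = mat 1"
    by (auto simp: C_def mat_def vec_eq_iff one_pCons)
  have PP: "transpose P ** P = mat 1"
  proof -
    have "(transpose P ** P) $ i $ j = (mat 1 :: real^'n^'n) $ i $ j" for i j
    proof -
      have "(transpose P ** P) $ i $ j = V (b i) \<bullet> V (b j)"
        by (simp add: matrix_matrix_mult_def transpose_def P_def inner_vec_def)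
      then show ?thesis using V bI[of i] bI[of j] binj[of i j]
        by (auto simp: mat_def orthonormal_frame_def)
    qed
    then show ?thesis by (simp add: vec_eq_iff)
  qed
  have AP: "A ** P = P ** D"
  proof -
    have "(A ** P) $ i $ j = (P ** D) $ i $ j" for i j
    proof -
      have "(A ** P) $ i $ j = (A *v V (b j)) $ i"
        by (simp add: matrix_matrix_mult_def matrix_vector_mult_def P_def)
      also have "\<dots> = (P ** D) $ i $ j"
        by (simp add: eig[OF bI] matrix_matrix_mult_def P_def D_def if_distrib[of "\<lambda>t. _ * t"]
            cong: if_cong)
      finally show ?thesis .
    qed
    then show ?thesis by (simp add: vec_eq_iff)
  qed
  have cp: "charpoly M = det (x - C M)" for M
    unfolding charpoly_def x_def C_def by (rule arg_cong[of _ _ det]) (simp add: vec_eq_iff)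
  have sub1: "(x - M) ** N = x ** N - M ** N" for M N :: "real poly^'n^'n"
    by (simp add: matrix_matrix_mult_def vec_eq_iff left_diff_distrib sum_subtractf)
  have sub2: "N ** (x - M) = N ** x - N ** M" for M N :: "real poly^'n^'n"
    by (simp add: matrix_matrix_mult_def vec_eq_iff right_diff_distrib sum_subtractf)
  have "(x - C A) ** C P = C P ** (x - C D)"
    by (simp add: sub1 sub2 x_comm AP flip: C_mult)
  then have "det (x - C A) * det (C P) = det (C P) * det (x - C D)"
    by (metis det_mul)
  moreover have "det (C P) \<noteq> 0"
  proof
    assume "det (C P) = 0"
    moreover have "C (transpose P) ** C P = mat 1" by (simp add: PP C1 flip: C_mult)
    then have "det (C (transpose P)) * det (C P) = 1" by (metis det_mul det_I)
    ultimately show False by simp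
  qed
  ultimately have "charpoly A = det (x - C D)" by (simp add: cp)
  also have "\<dots> = (\<Prod>i\<in>UNIV. (x - C D) $ i $ i)"
    by (rule det_diagonal) (simp add: x_def C_def D_def)
  also have "\<dots> = (\<Prod>i\<in>UNIV. [:- l (b i), 1:])"
    by (simp add: x_def C_def D_def)
  also have "\<dots> = (\<Prod>i\<in>{1..CARD('n)}. [:- l i, 1:])"
    by (rule prod.reindex_bij_betw[OF b, of "\<lambda>i. [:- l i, 1:]"])
  finally have "proots (charpoly A) = (\<Sum>i\<in>{1..CARD('n)}. {#l i#})"
    by (simp add: proots_prod)
  also have "\<dots> = image_mset l (mset_set {1..CARD('n)})"
  proof -
    have "(\<Sum>i\<in>F. {#l i#}) = image_mset l (mset_set F)" if "finite F" for F
      using that by induction auto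
    then show ?thesis by simp
  qed
  finally show ?thesis .
qed

text \<open>This ties the singular values, which are defined as sorted roots of a characteristic polynomial, to
  any nonincreasing enumeration of the spectrum of the Gram matrix.\<close>

lemma sing_val_eqI:
  fixes X :: "real^'n^'m"
  assumes V: "orthonormal_frame V"
    and eig: "\<And>i. i \<in> {1..CARD('n)} \<Longrightarrow> transpose X *v (X *v V i) = (s i)\<^sup>2 *\<^sub>R V i"
    and anti: "antimono_on {1..CARD('n)} s" and pos: "\<And>i. i \<in> {1..CARD('n)} \<Longrightarrow> 0 \<le> s i"
    and i: "i \<in> {1..CARD('n)}"
  shows "sing_val X i = s i"
proof -
  have "proots (charpoly (transpose X ** X)) = image_mset (\<lambda>i. (s i)\<^sup>2) (mset_set {1..CARD('n)})"
    by (rule proots_charpoly_frame[OF V]) (metis eig matrix_vector_mul_assoc)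
  then have "image_mset sqrt (proots (charpoly (transpose X ** X))) =
      image_mset s (mset_set {1..CARD('n)})"
    using pos by (auto simp: image_mset.compositionality o_def intro!: image_mset_cong)
  also have "\<dots> = mset (map s [1..<Suc CARD('n)])"
    unfolding mset_map mset_upt atLeastLessThanSuc_atLeastAtMost ..
  also have "\<dots> = mset (rev (map s [1..<Suc CARD('n)]))" by (simp del: upt_Suc)
  finally have *: "sing_vals X = rev (sort (rev (map s [1..<Suc CARD('n)])))"
    unfolding sing_vals_def by (simp del: upt_Suc mset_rev mset_map)
  have "sorted (rev (map s [1..<Suc CARD('n)]))"
  proof -
    have "sorted_wrt (\<lambda>i j. s i \<ge> s j) [1..<Suc CARD('n)]"
      by (rule sorted_wrt_mono_rel[OF _ sorted_wrt_upt])
        (auto intro: monotone_onD[OF anti])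
    then show ?thesis by (simp add: sorted_wrt_rev sorted_wrt_map del: upt_Suc)
  qed
  then have "sing_vals X = map s [1..<Suc CARD('n)]"
    unfolding * by (simp add: sorted_sort_id del: upt_Suc)
  then show ?thesis using i
    unfolding sing_val_def by (auto simp: nth_map nth_upt simp del: upt_Suc)
qed

lemma inner_transpose_vec: "x \<bullet> (transpose M *v y) = (M *v x) \<bullet> (y :: real^'m)"
  unfolding transpose_matrix_vector by (metis dot_lmul_matrix inner_commute)

lemma dyad_sum_gram_right_vector:
  assumes sv: "svd X U V s" and z: "\<And>i. i \<in> {1..CARD('n)} \<Longrightarrow> s i = 0 \<Longrightarrow> e i = 0"
    and i: "i \<in> {1..CARD('n)}"
  shows "transpose (dyad_sum U V e) *v (dyad_sum U V e *v V i) = (e i)\<^sup>2 *\<^sub>R (V i :: real^'n)"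
proof -
  let ?M = "dyad_sum U V e"
  have V: "orthonormal_frame V" using sv by (simp add: svd_def)
  have inner: "x \<bullet> (transpose ?M *v y) = (?M *v x) \<bullet> y" for x y
    by (rule inner_transpose_vec)
  define D where "D = transpose ?M *v (?M *v V i) - (e i)\<^sup>2 *\<^sub>R V i"
  have "V j \<bullet> (transpose ?M *v (?M *v V i)) = V j \<bullet> ((e i)\<^sup>2 *\<^sub>R V i)" if j: "j \<in> {1..CARD('n)}" for j
  proof -
    have "U j \<bullet> U i = (if j = i \<and> s j \<noteq> 0 then 1 else 0)"
      using sv i j unfolding svd_def by blast
    moreover have "V j \<bullet> V i = (if j = i then 1 else 0)"
      using V i j unfolding orthonormal_frame_def by blast
    ultimately show ?thesis
      unfolding inner using z[OF i]
      by (auto simp: dyad_sum_mult_right_vector[OF sv i] dyad_sum_mult_right_vector[OF sv j] power2_eq_square)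
  qed
  then have "V j \<bullet> D = 0" if "j \<in> {1..CARD('n)}" for j
    unfolding D_def inner_diff_right using that by (metis diff_self)
  then have "orthogonal D y" if "y \<in> V ` {1..CARD('n)}" for y
    using that by (metis imageE inner_commute orthogonal_def)
  then have "orthogonal D D"
    using orthonormal_frame_span[OF V] by (intro orthogonal_to_span[of D "V ` {1..CARD('n)}"]) auto
  then show ?thesis by (simp add: orthogonal_self D_def del: transpose_matrix_vector)
qed

lemma sing_val_dyad_sum:
  fixes V :: "nat \<Rightarrow> real^'n"
  assumes sv: "svd X U V s" and z: "\<And>i. i \<in> {1..CARD('n)} \<Longrightarrow> s i = 0 \<Longrightarrow> e i = 0"
    and anti: "antimono_on {1..CARD('n)} e" and pos: "\<And>i. i \<in> {1..CARD('n)} \<Longrightarrow> 0 \<le> e i"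
    and i: "i \<in> {1..CARD('n)}"
  shows "sing_val (dyad_sum U V e) i = e i"
proof (rule sing_val_eqI[OF _ _ anti pos i])
  show "orthonormal_frame V" using sv by (simp add: svd_def)
  show "transpose (dyad_sum U V e) *v (dyad_sum U V e *v V i) = (e i)\<^sup>2 *\<^sub>R V i"
    if "i \<in> {1..CARD('n)}" for i
    by (rule dyad_sum_gram_right_vector[OF sv z that])
qed

text \<open>The right vectors are an orthonormal eigenbasis of \<open>X\<^sup>T X\<close>, listed by decreasing \<open>\<parallel>X b\<parallel>\<close>; the left
  vectors are their normalised images.  Where \<open>\<parallel>X b\<parallel> = 0\<close>, division by zero makes the left vector zero, as
  the decomposition demands.\<close>

lemma svd_exists_some:
  fixes X :: "real^'n^'m"
  obtains U V s where "svd X U V s"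
proof -
  define A where "A = (\<lambda>x. transpose X *v (X *v x))"
  have inner: "x \<bullet> A y = (X *v x) \<bullet> (X *v y)" for x y
    unfolding A_def by (rule inner_transpose_vec)
  have lin: "linear A" unfolding A_def
    by (simp add: matrix_vector_mul_assoc)
  have sym: "A x \<bullet> y = x \<bullet> A y" for x y
    using inner[of x y] inner[of y x] by (metis inner_commute)
  obtain B where B: "finite B" "card B = DIM(real^'n)" "pairwise orthogonal B" "\<And>b. b \<in> B \<Longrightarrow> norm b = 1"
    "\<And>b. b \<in> B \<Longrightarrow> \<exists>c. A b = c *\<^sub>R b"
    using self_adjoint_orthonormal_eigenbasis[OF lin sym] by metis
  obtain ys where ys: "set ys = B" "distinct ys"
    using finite_distinct_list[OF B(1)] by blast
  define xs where "xs = sort_key (\<lambda>b. - norm (X *v b)) ys"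
  have xs: "set xs = B" "distinct xs" "length xs = CARD('n)"
    using ys B(2) distinct_card[OF ys(2)] by (auto simp: xs_def)
  define V where "V = (\<lambda>i. xs ! (i - 1))"
  define s where "s = (\<lambda>i. norm (X *v V i))"
  define U where "U = (\<lambda>i. (1 / s i) *\<^sub>R (X *v V i))"
  have VB: "V i \<in> B" if "i \<in> {1..CARD('n)}" for i
    using that xs nth_mem[of "i - 1" xs] by (auto simp: V_def)
  have Vinj: "V i = V j \<longleftrightarrow> i = j" if "i \<in> {1..CARD('n)}" "j \<in> {1..CARD('n)}" for i j
    using that xs by (auto simp: V_def nth_eq_iff_index_eq)
  have V: "orthonormal_frame V"
    unfolding orthonormal_frame_def
  proof (intro ballI)
    fix i j assume ij: "i \<in> {1..CARD('n)}" "j \<in> {1..CARD('n)}"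
    show "V i \<bullet> V j = (if i = j then 1 else 0)"
      using B(3) B(4)[OF VB[OF ij(1)]] VB[OF ij(1)] VB[OF ij(2)] Vinj[OF ij]
      by (auto simp: pairwise_def orthogonal_def norm_eq_1)
  qed
  have UU: "U i \<bullet> U j = (if i = j \<and> s i \<noteq> 0 then 1 else 0)"
    if ij: "i \<in> {1..CARD('n)}" "j \<in> {1..CARD('n)}" for i j
  proof (cases "i = j")
    case True
    then show ?thesis
      by (simp add: U_def s_def dot_square_norm power2_eq_square)
  next
    case False
    obtain c where "A (V j) = c *\<^sub>R V j" using B(5)[OF VB[OF ij(2)]] by blast
    then have "(X *v V i) \<bullet> (X *v V j) = 0"
      using V ij False by (simp add: inner[symmetric] orthonormal_frame_def)
    then show ?thesis using False by (simp add: U_def)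
  qed
  have "X = dyad_sum U V s"
  proof (rule matrix_eq_on_frame[OF V])
    fix i assume i: "i \<in> {1..CARD('n)}"
    have "dyad_sum U V s *v V i = (\<Sum>j = 1..CARD('n). (if j = i then s j *\<^sub>R U j else 0))"
      unfolding dyad_sum_mult_vector using V i by (intro sum.cong) (auto simp: orthonormal_frame_def)
    also have "\<dots> = s i *\<^sub>R U i" using i by simp
    finally show "X *v V i = dyad_sum U V s *v V i"
      by (simp add: U_def s_def)
  qed
  moreover have "antimono_on {1..CARD('n)} s"
  proof (rule monotone_onI)
    fix i j assume ij: "i \<in> {1..CARD('n)}" "j \<in> {1..CARD('n)}" "i \<le> j"
    have "sorted (map (\<lambda>b. - norm (X *v b)) xs)" by (simp add: xs_def)
    from sorted_nth_mono[OF this, of "i - 1" "j - 1"] ij xs(3)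
    show "s i \<ge> s j" by (auto simp: s_def V_def)
  qed
  ultimately have "svd X U V s"
    using V UU by (simp add: svd_def s_def)
  then show ?thesis by (rule that)
qed

lemma svd_cong:
  assumes "svd X U V s" "\<And>i. i \<in> {1..CARD('n)} \<Longrightarrow> s i = t i"
  shows "svd X U (V :: nat \<Rightarrow> real^'n) t"
proof -
  have "antimono_on {1..CARD('n)} s = antimono_on {1..CARD('n)} t"
    using assms(2) by (simp add: monotone_on_def)
  moreover have "dyad_sum U V s = dyad_sum U V t"
    unfolding dyad_sum_def using assms(2) by (intro sum.cong) auto
  ultimately show ?thesis using assms unfolding svd_def by simp
qed

lemma svd_exists:
  fixes X :: "real^'n^'m"
  obtains U V where "svd X U V (sing_val X)"
proof -
  obtain U V s where sv: "svd X U V s" by (rule svd_exists_some)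
  have "s i = sing_val X i" if "i \<in> {1..CARD('n)}" for i
    using sing_val_dyad_sum[OF sv, of s i] that sv unfolding svd_def by auto
  from svd_cong[OF sv this] show ?thesis by (rule that)
qed

lemma sing_val_nonneg: "i \<in> {1..CARD('n)} \<Longrightarrow> 0 \<le> sing_val (X :: real^'n^'m) i"
  using svd_exists[of X] unfolding svd_def by metis

lemma sing_val_antimono:
  "1 \<le> i \<Longrightarrow> i \<le> j \<Longrightarrow> j \<le> CARD('n) \<Longrightarrow> sing_val (X :: real^'n^'m) j \<le> sing_val X i"
  using svd_exists[of X] unfolding svd_def monotone_on_def
  by (metis atLeastAtMost_iff order_trans)

lemma norm_sum_orthonormal_frame:
  fixes V :: "nat \<Rightarrow> real^'n"
  assumes V: "orthonormal_frame V" and S: "S \<subseteq> {1..CARD('n)}"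
  shows "(norm (\<Sum>i\<in>S. c i *\<^sub>R V i))\<^sup>2 = (\<Sum>i\<in>S. (c i)\<^sup>2)"
proof -
  have fin: "finite S" using S finite_subset by blast
  have "(norm (\<Sum>i\<in>S. c i *\<^sub>R V i))\<^sup>2 = (\<Sum>i\<in>S. (norm (c i *\<^sub>R V i))\<^sup>2)"
    using V S fin by (intro norm_sum_Pythagorean)
      (auto simp: pairwise_def orthogonal_def orthonormal_frame_def subset_eq)
  also have "\<dots> = (\<Sum>i\<in>S. (c i)\<^sup>2)"
  proof (intro sum.cong refl)
    fix i assume "i \<in> S"
    then have "V i \<bullet> V i = 1" using V S by (auto simp: orthonormal_frame_def)
    then have "norm (V i) = 1" by (simp add: norm_eq_1)
    then show "(norm (c i *\<^sub>R V i))\<^sup>2 = (c i)\<^sup>2" by simp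
  qed
  finally show ?thesis .
qed

lemma svd_apply_frame_sum:
  fixes V :: "nat \<Rightarrow> real^'n"
  assumes sv: "svd X U V s" and S: "S \<subseteq> {1..CARD('n)}"
  shows "X *v (\<Sum>i\<in>S. c i *\<^sub>R V i) = (\<Sum>i\<in>S. (c i * s i) *\<^sub>R U i)"
    and "(norm (X *v (\<Sum>i\<in>S. c i *\<^sub>R V i)))\<^sup>2 = (\<Sum>i\<in>S. (s i)\<^sup>2 * (c i)\<^sup>2)"
proof -
  have fin: "finite S" using S finite_subset by blast
  have X: "X = dyad_sum U V s" using sv by (simp add: svd_def)
  have XV: "X *v V i = s i *\<^sub>R U i" if "i \<in> S" for i
    using dyad_sum_mult_right_vector[OF sv, of i s] that S by (simp add: X[symmetric] subset_eq)
  have "X *v (\<Sum>i\<in>S. c i *\<^sub>R V i) = (\<Sum>i\<in>S. c i *\<^sub>R (X *v V i))"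
    by (simp add: linear_sum[of "(*v) X", OF matrix_vector_mul_linear] matrix_vector_mult_scaleR)
  then show *: "X *v (\<Sum>i\<in>S. c i *\<^sub>R V i) = (\<Sum>i\<in>S. (c i * s i) *\<^sub>R U i)"
    using XV by simp
  have "(norm (\<Sum>i\<in>S. (c i * s i) *\<^sub>R U i))\<^sup>2 = (\<Sum>i\<in>S. (norm ((c i * s i) *\<^sub>R U i))\<^sup>2)"
    using sv S fin by (intro norm_sum_Pythagorean)
      (auto simp: pairwise_def orthogonal_def svd_def subset_eq)
  also have "\<dots> = (\<Sum>i\<in>S. (s i)\<^sup>2 * (c i)\<^sup>2)"
  proof (intro sum.cong refl)
    fix i assume "i \<in> S"
    then have "i \<in> {1..CARD('n)}" using S by blast
    then have "U i \<bullet> U i = (if s i \<noteq> 0 then 1 else 0)" using sv unfolding svd_def by simp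
    moreover have "(norm ((c i * s i) *\<^sub>R U i))\<^sup>2 = (s i)\<^sup>2 * (c i)\<^sup>2 * (U i \<bullet> U i)"
      unfolding norm_scaleR power_mult_distrib power2_norm_eq_inner by (simp add: power_mult_distrib mult_ac)
    ultimately show "(norm ((c i * s i) *\<^sub>R U i))\<^sup>2 = (s i)\<^sup>2 * (c i)\<^sup>2"
      by simp
  qed
  finally show "(norm (X *v (\<Sum>i\<in>S. c i *\<^sub>R V i)))\<^sup>2 = (\<Sum>i\<in>S. (s i)\<^sup>2 * (c i)\<^sup>2)"
    unfolding * .
qed

lemma svd_head_norm_ge:
  fixes V :: "nat \<Rightarrow> real^'n"
  assumes sv: "svd X U V s" and S: "S \<subseteq> {1..CARD('n)}" and z: "z \<in> span (V ` S)"
    and a: "0 \<le> a" "\<And>i. i \<in> S \<Longrightarrow> a \<le> s i"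
  shows "a * norm z \<le> norm (X *v z)"
proof -
  obtain c where c: "z = (\<Sum>i\<in>S. c i *\<^sub>R V i)"
    using span_frame_comb[OF z] S finite_subset by blast
  have V: "orthonormal_frame V" using sv by (simp add: svd_def)
  have "(a * norm z)\<^sup>2 = (\<Sum>i\<in>S. a\<^sup>2 * (c i)\<^sup>2)"
    unfolding power_mult_distrib c norm_sum_orthonormal_frame[OF V S] sum_distrib_left ..
  also have "\<dots> \<le> (\<Sum>i\<in>S. (s i)\<^sup>2 * (c i)\<^sup>2)"
    using a by (intro sum_mono mult_right_mono power_mono) auto
  also have "\<dots> = (norm (X *v z))\<^sup>2" using svd_apply_frame_sum(2)[OF sv S, of c] c by simp
  finally show ?thesis by (rule power2_le_imp_le) simp
qed

lemma svd_tail_norm_le: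
  fixes V :: "nat \<Rightarrow> real^'n"
  assumes sv: "svd X U V s" and S: "S \<subseteq> {1..CARD('n)}" and z: "z \<in> span (V ` S)"
    and a: "0 \<le> a" "\<And>i. i \<in> S \<Longrightarrow> s i \<le> a"
  shows "norm (X *v z) \<le> a * norm z"
proof -
  obtain c where c: "z = (\<Sum>i\<in>S. c i *\<^sub>R V i)"
    using span_frame_comb[OF z] S finite_subset by blast
  have V: "orthonormal_frame V" using sv by (simp add: svd_def)
  have s0: "0 \<le> s i" if "i \<in> S" for i using sv S that unfolding svd_def by blast
  have "(norm (X *v z))\<^sup>2 = (\<Sum>i\<in>S. (s i)\<^sup>2 * (c i)\<^sup>2)" using svd_apply_frame_sum(2)[OF sv S, of c] c by simp
  also have "\<dots> \<le> (\<Sum>i\<in>S. a\<^sup>2 * (c i)\<^sup>2)"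
    using a s0 by (intro sum_mono mult_right_mono power_mono) auto
  also have "\<dots> = (a * norm z)\<^sup>2"
    unfolding power_mult_distrib c norm_sum_orthonormal_frame[OF V S] sum_distrib_left ..
  finally show ?thesis by (rule power2_le_imp_le) (simp add: a(1))
qed

text \<open>Weyl's inequality.  The span of the first \<open>i\<close> right vectors of \<open>X\<close> and the span of the right vectors
  of \<open>Y\<close> from \<open>i\<close> on meet for dimension reasons; on a common vector, compare \<open>X z\<close> with \<open>Y z\<close>.\<close>

lemma sing_val_le_add_norm:
  fixes X Y :: "real^'n^'m"
  assumes i: "i \<in> {1..CARD('n)}"
  shows "sing_val X i \<le> sing_val Y i + norm (X - Y)"
proof -
  obtain U V where sv: "svd X U V (sing_val X)" by (rule svd_exists)
  obtain U' V' where sv': "svd Y U' V' (sing_val Y)" by (rule svd_exists)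
  have V: "orthonormal_frame V" "orthonormal_frame V'" using sv sv' by (auto simp: svd_def)
  obtain z where z: "z \<in> span (V ` {1..i})" "z \<in> span (V' ` {i..CARD('n)})" "z \<noteq> 0"
    using subspaces_common_vector[of "span (V ` {1..i})" "span (V' ` {i..CARD('n)})"]
      dim_span_orthonormal_frame[OF V(1), of "{1..i}"] dim_span_orthonormal_frame[OF V(2), of "{i..CARD('n)}"] i
    by auto
  have "sing_val X i * norm z \<le> norm (X *v z)"
    using i by (intro svd_head_norm_ge[OF sv _ z(1)]) (auto intro: sing_val_antimono sing_val_nonneg)
  also have "X *v z = Y *v z + (X - Y) *v z"
    by (simp add: matrix_vector_mult_diff_rdistrib)
  also have "norm (Y *v z + (X - Y) *v z) \<le> norm (Y *v z) + norm ((X - Y) *v z)"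
    by (rule norm_triangle_ineq)
  also have "norm (Y *v z) \<le> sing_val Y i * norm z"
    using i by (intro svd_tail_norm_le[OF sv' _ z(2)]) (auto intro: sing_val_antimono sing_val_nonneg)
  also have "norm ((X - Y) *v z) \<le> norm (X - Y) * norm z"
    by (rule norm_matrix_vector_le)
  finally have "sing_val X i * norm z \<le> (sing_val Y i + norm (X - Y)) * norm z"
    by (simp add: distrib_right)
  then show ?thesis using z(3) by simp
qed

lemma sing_val_lipschitz:
  fixes X Y :: "real^'n^'m"
  assumes i: "i \<in> {1..CARD('n)}"
  shows "\<bar>sing_val X i - sing_val Y i\<bar> \<le> norm (X - Y)"
  using sing_val_le_add_norm[OF i, of X Y] sing_val_le_add_norm[OF i, of Y X]
  by (simp add: norm_minus_commute abs_le_iff)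

text \<open>The second-order flatness of the set of matrices of rank at most \<open>r\<close>.  The kernel of \<open>Y\<close> has codimension
  at most \<open>r\<close>, so it contains a vector \<open>z = c V\<^sub>p + y\<close> with \<open>y\<close> in the span of the top \<open>r\<close> right vectors of \<open>X\<close>.
  As \<open>X z = -(Y - X) z\<close> and \<open>X\<close> is bounded below by \<open>a\<close> on the top part, \<open>y\<close> has size \<open>O(\<parallel>Y - X\<parallel>)\<close>; since
  \<open>U\<^sub>p\<close> is orthogonal to \<open>X y\<close>, the entry \<open>U\<^sub>p \<bullet> Y V\<^sub>p\<close> only sees \<open>(Y - X) y\<close>, which is of second order.\<close>

lemma low_rank_second_order:
  fixes X Y :: "real^'n^'m"
  assumes sv: "svd X U V s" and a: "0 < a" "\<And>i. i \<in> {1..r} \<Longrightarrow> a \<le> s i"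
    and rank: "\<And>i. i \<in> {r<..CARD('n)} \<Longrightarrow> sing_val Y i = 0"
    and close: "norm (Y - X) \<le> a / 2" and p: "r < p" "p \<le> CARD('n)" "s p \<noteq> 0"
  shows "\<bar>U p \<bullet> (Y *v V p)\<bar> \<le> 2 / a * (norm (Y - X))\<^sup>2"
proof -
  define E where "E = Y - X"
  define \<epsilon> where "\<epsilon> = norm E"
  obtain U' V' where sv': "svd Y U' V' (sing_val Y)" by (rule svd_exists)
  have V: "orthonormal_frame V" "orthonormal_frame V'" using sv sv' by (auto simp: svd_def)
  let ?S = "insert p {1..r}"
  have S: "?S \<subseteq> {1..CARD('n)}" using p by auto
  obtain z where z: "z \<in> span (V ` ?S)" "z \<in> span (V' ` {r<..CARD('n)})" "z \<noteq> 0"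
    using subspaces_common_vector[of "span (V ` ?S)" "span (V' ` {r<..CARD('n)})"]
      dim_span_orthonormal_frame[OF V(1) S] dim_span_orthonormal_frame[OF V(2), of "{r<..CARD('n)}"] p
    by (auto simp: subset_eq)
  have "norm (Y *v z) \<le> 0 * norm z"
    by (intro svd_tail_norm_le[OF sv' _ z(2)]) (auto simp: rank)
  then have Yz: "Y *v z = 0" by simp
  obtain c where c: "z = (\<Sum>i\<in>?S. c i *\<^sub>R V i)"
    using span_frame_comb[OF z(1)] by blast
  define y where "y = (\<Sum>i\<in>{1..r}. c i *\<^sub>R V i)"
  have zy: "z = c p *\<^sub>R V p + y" using p by (simp add: c y_def)
  have nz: "(norm z)\<^sup>2 = (c p)\<^sup>2 + (norm y)\<^sup>2"
    using norm_sum_orthonormal_frame[OF V(1) S, of c] norm_sum_orthonormal_frame[OF V(1), of "{1..r}" c] p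
    by (simp add: c y_def)
  have "(norm (X *v y))\<^sup>2 \<le> (norm (X *v z))\<^sup>2"
  proof -
    have r: "{1..r} \<subseteq> {1..CARD('n)}" using p by auto
    show ?thesis
      unfolding c y_def svd_apply_frame_sum(2)[OF sv S] svd_apply_frame_sum(2)[OF sv r] using p by simp
  qed
  then have "norm (X *v y) \<le> norm (X *v z)" by (rule power2_le_imp_le) simp
  also have "X *v z = - (E *v z)"
    using Yz by (simp add: E_def matrix_vector_mult_diff_rdistrib)
  also have "norm (- (E *v z)) \<le> \<epsilon> * norm z"
    using norm_matrix_vector_le[of E z] by (simp add: \<epsilon>_def)
  finally have "norm (X *v y) \<le> \<epsilon> * norm z" .
  moreover have "y \<in> span (V ` {1..r})"
    unfolding y_def by (intro span_sum span_scale span_base) auto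
  then have "a * norm y \<le> norm (X *v y)"
    using a p by (intro svd_head_norm_ge[OF sv, of "{1..r}"]) auto
  ultimately have y: "a * norm y \<le> \<epsilon> * norm z" by linarith
  have eps: "\<epsilon> \<le> a / 2" "0 \<le> \<epsilon>" using close by (auto simp: \<epsilon>_def E_def)
  have "a * norm y \<le> (a / 2) * norm z"
    using y mult_right_mono[OF eps(1), of "norm z"] by simp
  then have "norm y \<le> norm z / 2" using a by simp
  then have "(norm y)\<^sup>2 \<le> (norm z / 2)\<^sup>2" by (intro power_mono) auto
  moreover have "(norm z / 2)\<^sup>2 = (norm z)\<^sup>2 / 4" by (simp add: power_divide)
  ultimately have "(norm z / 2)\<^sup>2 \<le> (c p)\<^sup>2" using nz zero_le_power2[of "c p"] by linarith
  then have cp: "norm z / 2 \<le> \<bar>c p\<bar>"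
    by (simp add: abs_le_square_iff[symmetric])
  have UX: "U p \<bullet> (X *v y) = 0"
  proof -
    have r: "{1..r} \<subseteq> {1..CARD('n)}" using p by auto
    have "U p \<bullet> U i = 0" if "i \<in> {1..r}" for i
      using sv that p unfolding svd_def by auto
    then show ?thesis
      unfolding y_def svd_apply_frame_sum(1)[OF sv r] by (simp add: inner_sum_right)
  qed
  have "0 = U p \<bullet> (Y *v z)" by (simp add: Yz)
  also have "\<dots> = c p * (U p \<bullet> (Y *v V p)) + U p \<bullet> (Y *v y)"
    by (simp add: zy matrix_vector_right_distrib matrix_vector_mult_scaleR inner_add_right)
  also have "Y *v y = X *v y + E *v y"
    by (simp add: E_def matrix_vector_mult_diff_rdistrib)
  finally have "c p * (U p \<bullet> (Y *v V p)) = - (U p \<bullet> (E *v y))"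
    by (simp add: inner_add_right UX)
  then have "\<bar>c p\<bar> * \<bar>U p \<bullet> (Y *v V p)\<bar> = \<bar>U p \<bullet> (E *v y)\<bar>"
    by (simp flip: abs_mult)
  also have "\<dots> \<le> norm (U p) * norm (E *v y)" by (rule Cauchy_Schwarz_ineq2)
  also have "norm (U p) = 1"
    using sv p unfolding svd_def by (simp add: norm_eq_1)
  also have "norm (E *v y) \<le> \<epsilon> * norm y"
    using norm_matrix_vector_le[of E y] by (simp add: \<epsilon>_def)
  finally have "\<bar>c p\<bar> * \<bar>U p \<bullet> (Y *v V p)\<bar> \<le> \<epsilon> * norm y" by simp
  moreover have "(norm z / 2) * \<bar>U p \<bullet> (Y *v V p)\<bar> \<le> \<bar>c p\<bar> * \<bar>U p \<bullet> (Y *v V p)\<bar>"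
    by (intro mult_right_mono cp) auto
  ultimately have "(norm z / 2) * \<bar>U p \<bullet> (Y *v V p)\<bar> \<le> \<epsilon> * norm y" by linarith
  then have "a * ((norm z / 2) * \<bar>U p \<bullet> (Y *v V p)\<bar>) \<le> \<epsilon> * (a * norm y)"
    using a by (simp add: mult.left_commute)
  also have "\<dots> \<le> \<epsilon> * (\<epsilon> * norm z)"
    using y eps by (intro mult_left_mono) auto
  finally have "norm z * (a / 2 * \<bar>U p \<bullet> (Y *v V p)\<bar>) \<le> norm z * \<epsilon>\<^sup>2"
    by (simp add: power2_eq_square mult_ac)
  then have "a / 2 * \<bar>U p \<bullet> (Y *v V p)\<bar> \<le> \<epsilon>\<^sup>2" using z(3) by simp
  then show ?thesis using a by (simp add: \<epsilon>_def E_def field_simps)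
qed

section \<open>A smooth count of the large singular values\<close>

text \<open>Singular vectors are not unique; a fixed choice makes \<open>sv_map\<close> a function of the matrix.\<close>

definition lsv :: "real^'n^'m \<Rightarrow> nat \<Rightarrow> real^'m" where
  "lsv X = fst (SOME (U, V). svd X U V (sing_val X))"

definition rsv :: "real^'n^'m \<Rightarrow> nat \<Rightarrow> real^'n" where
  "rsv X = snd (SOME (U, V). svd X U V (sing_val X))"

definition sv_map :: "(real \<Rightarrow> real) \<Rightarrow> real^'n^'m \<Rightarrow> real^'n^'m" where
  "sv_map \<phi> X = dyad_sum (lsv X) (rsv X) (\<lambda>i. \<phi> (sing_val X i))"

lemma svd_sv: "svd X (lsv X) (rsv X) (sing_val X)"
proof -
  obtain U V where "svd X U V (sing_val X)" by (rule svd_exists)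
  then have "case (U, V) of (U, V) \<Rightarrow> svd X U V (sing_val X)" by simp
  from someI[of "\<lambda>(U, V). svd X U V (sing_val X)", OF this] show ?thesis
    unfolding lsv_def rsv_def by (simp add: case_prod_beta)
qed

lemma svd_norms:
  assumes "svd X U (V :: nat \<Rightarrow> real^'n) s" "i \<in> {1..CARD('n)}"
  shows "norm (V i) = 1" "norm (U i) \<le> 1" "s i \<noteq> 0 \<Longrightarrow> norm (U i) = 1"
proof -
  have "V i \<bullet> V i = 1"
    using assms unfolding svd_def orthonormal_frame_def by auto
  then show "norm (V i) = 1" by (simp add: norm_eq_1)
  have "U i \<bullet> U i = (if s i \<noteq> 0 then 1 else 0)"
    using assms unfolding svd_def by simp
  then show "norm (U i) \<le> 1" "s i \<noteq> 0 \<Longrightarrow> norm (U i) = 1"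
    by (auto simp: norm_eq_sqrt_inner)
qed

lemma abs_inner_dyad_sum_le:
  fixes V :: "nat \<Rightarrow> real^'n"
  assumes sv: "svd X U V s" and e: "\<And>i. i \<in> {1..CARD('n)} \<Longrightarrow> 0 \<le> e i"
    and M: "\<And>w. norm (M *v w) \<le> b * norm w"
  shows "\<bar>dyad_sum U V e \<bullet> M\<bar> \<le> b * (\<Sum>i = 1..CARD('n). e i)"
proof -
  have "\<bar>dyad_sum U V e \<bullet> M\<bar> \<le> (\<Sum>i = 1..CARD('n). \<bar>e i * (U i \<bullet> (M *v V i))\<bar>)"
    unfolding inner_dyad_sum by (rule sum_abs)
  also have "\<dots> \<le> (\<Sum>i = 1..CARD('n). e i * b)"
  proof (rule sum_mono)
    fix i assume i: "i \<in> {1..CARD('n)}"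
    have "\<bar>U i \<bullet> (M *v V i)\<bar> \<le> norm (U i) * norm (M *v V i)" by (rule Cauchy_Schwarz_ineq2)
    also have "\<dots> \<le> 1 * (b * norm (V i))"
      using svd_norms[OF sv i] by (intro mult_mono M) auto
    also have "\<dots> = b" by (simp add: svd_norms(1)[OF sv i])
    finally show "\<bar>e i * (U i \<bullet> (M *v V i))\<bar> \<le> e i * b"
      using e[OF i] by (simp add: abs_mult mult_left_mono)
  qed
  finally show ?thesis by (simp add: sum_distrib_left mult.commute)
qed

text \<open>Applied to the singular values, \<open>excess c\<close> gives the difference between \<open>X\<close> and its projection onto the
  operator-norm ball of radius \<open>c\<close>.  The next lemmas are the facts on projections onto a convex set in
  this case: the variational inequality, nonexpansiveness, and the smoothness of half the squared
  distance.  They make it possible to differentiate functions of singular values without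
  perturbation theory for singular vectors.\<close>

definition excess :: "real \<Rightarrow> real \<Rightarrow> real" where
  "excess c t = max 0 (t - c)"

lemma sv_map_excess_variational:
  fixes X Z :: "real^'n^'m"
  assumes c: "0 \<le> c" and Z: "\<And>w. norm (Z *v w) \<le> c * norm w"
  shows "sv_map (excess c) X \<bullet> (Z - (X - sv_map (excess c) X)) \<le> 0"
proof -
  define s where "s = sing_val X"
  define e where "e = (\<lambda>i. excess c (s i))"
  define U V where "U = lsv X" and "V = rsv X"
  have sv: "svd X U V s" unfolding s_def U_def V_def by (rule svd_sv)
  have s0: "i \<in> {1..CARD('n)} \<Longrightarrow> 0 \<le> s i" for i by (simp add: s_def sing_val_nonneg)
  have R: "sv_map (excess c) X = dyad_sum U V e" by (simp add: sv_map_def U_def V_def e_def s_def)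
  have X: "X = dyad_sum U V s" using sv by (simp add: svd_def)
  have z: "i \<in> {1..CARD('n)} \<Longrightarrow> s i = 0 \<Longrightarrow> e i = 0" for i
    using c by (simp add: e_def excess_def)
  have "dyad_sum U V e \<bullet> Z \<le> c * (\<Sum>i = 1..CARD('n). e i)"
    using abs_inner_dyad_sum_le[OF sv _ Z, of e] by (simp add: e_def excess_def)
  moreover have "dyad_sum U V e \<bullet> (X - dyad_sum U V e) = (\<Sum>i = 1..CARD('n). e i * (s i - e i))"
    unfolding X dyad_sum_diff using inner_dyad_sums[OF sv z] by simp
  moreover have "(\<Sum>i = 1..CARD('n). e i * (s i - e i)) = (\<Sum>i = 1..CARD('n). c * e i)"
    by (intro sum.cong) (auto simp: e_def excess_def)
  ultimately show ?thesis unfolding R by (simp add: inner_diff_right sum_distrib_left)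
qed

lemma sv_clip_op_norm:
  fixes X :: "real^'n^'m"
  assumes c: "0 < c"
  shows "norm ((X - sv_map (excess c) X) *v w) \<le> c * norm w"
proof -
  define s where "s = sing_val X"
  define U V where "U = lsv X" and "V = rsv X"
  have sv: "svd X U V s" unfolding s_def U_def V_def by (rule svd_sv)
  have s0: "i \<in> {1..CARD('n)} \<Longrightarrow> 0 \<le> s i" for i by (simp add: s_def sing_val_nonneg)
  define m where "m = (\<lambda>i. s i - excess c (s i))"
  have m: "m i = min (s i) c" for i by (auto simp: m_def excess_def)
  have X: "X = dyad_sum U V s" using sv by (simp add: svd_def)
  have P: "X - sv_map (excess c) X = dyad_sum U V m"
    unfolding sv_map_def U_def[symmetric] V_def[symmetric] s_def[symmetric] m_def
    by (subst X) (simp add: dyad_sum_diff)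
  have "svd (dyad_sum U V m) U V m"
    unfolding svd_def
  proof (intro conjI)
    show "orthonormal_frame V" using sv by (simp add: svd_def)
    have "m i \<noteq> 0 \<longleftrightarrow> s i \<noteq> 0" if "i \<in> {1..CARD('n)}" for i
      using c s0[OF that] by (auto simp: m min_def)
    then show "\<forall>i\<in>{1..CARD('n)}. \<forall>j\<in>{1..CARD('n)}. U i \<bullet> U j = (if i = j \<and> m i \<noteq> 0 then 1 else 0)"
      using sv unfolding svd_def by simp
    show "antimono_on {1..CARD('n)} m"
      using sv unfolding svd_def monotone_on_def m by (meson min.mono order_refl)
    show "\<forall>i\<in>{1..CARD('n)}. 0 \<le> m i" using s0 c by (simp add: m)
  qed simp
  moreover have "w \<in> span (V ` {1..CARD('n)})"
    using orthonormal_frame_span[of V] sv by (simp add: svd_def)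
  ultimately show ?thesis
    unfolding P using c by (intro svd_tail_norm_le[of _ U V m "{1..CARD('n)}"]) (auto simp: m)
qed

lemma sv_excess_norm:
  fixes X :: "real^'n^'m"
  assumes "0 \<le> c"
  shows "(norm (sv_map (excess c) X))\<^sup>2 = (\<Sum>i = 1..CARD('n). (excess c (sing_val X i))\<^sup>2)"
  unfolding power2_norm_eq_inner sv_map_def using assms
  by (subst inner_dyad_sums[OF svd_sv]) (auto simp: excess_def power2_eq_square)

lemma sv_excess_monotone:
  fixes X Y :: "real^'n^'m"
  assumes c: "0 < c"
  defines "R \<equiv> sv_map (excess c)"
  shows "0 \<le> R Y \<bullet> ((Y - R Y) - (X - R X))"
  using sv_map_excess_variational[of c "X - R X" Y] sv_clip_op_norm[OF c, of X] c
  by (simp add: R_def inner_diff_right)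

lemma sv_excess_nonexpansive:
  fixes X Y :: "real^'n^'m"
  assumes c: "0 < c"
  shows "norm (sv_map (excess c) X - sv_map (excess c) Y) \<le> norm (X - Y)"
proof -
  define R where "R = (sv_map (excess c) :: real^'n^'m \<Rightarrow> _)"
  define A where "A = R X - R Y"
  define B where "B = (X - R X) - (Y - R Y)"
  have "0 \<le> A \<bullet> B"
    using sv_excess_monotone[OF c, of X Y] sv_excess_monotone[OF c, of Y X]
    unfolding A_def B_def R_def[symmetric] by (simp add: inner_diff_left inner_diff_right)
  then have "(norm A)\<^sup>2 \<le> (norm (A + B))\<^sup>2"
    by (simp add: power2_norm_eq_inner inner_simps inner_commute)
  then have "norm A \<le> norm (A + B)" by (rule power2_le_imp_le) simp
  then show ?thesis by (simp add: A_def B_def R_def)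
qed

text \<open>Half the squared distance to the ball is convex with gradient \<open>R\<close>, and its gradient is
  nonexpansive: hence the tangent from below and the parabola from above.\<close>

lemma sv_excess_energy:
  fixes X Y :: "real^'n^'m"
  assumes c: "0 < c"
  defines "R \<equiv> sv_map (excess c)"
  shows "(norm (R Y))\<^sup>2 / 2 + R Y \<bullet> (X - Y) \<le> (norm (R X))\<^sup>2 / 2"
    and "(norm (R X))\<^sup>2 / 2 \<le> (norm (R Y))\<^sup>2 / 2 + R Y \<bullet> (X - Y) + (norm (X - Y))\<^sup>2 / 2"
proof -
  have m: "0 \<le> R Y \<bullet> ((Y - R Y) - (X - R X))" "0 \<le> R X \<bullet> ((X - R X) - (Y - R Y))"
    unfolding R_def by (rule sv_excess_monotone[OF c])+
  have "0 \<le> (norm (R X - R Y))\<^sup>2" by simp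
  with m(1) show "(norm (R Y))\<^sup>2 / 2 + R Y \<bullet> (X - Y) \<le> (norm (R X))\<^sup>2 / 2"
    by (simp add: power2_norm_eq_inner inner_simps inner_commute)
  have "0 \<le> (norm ((X - R X) - (Y - R Y)))\<^sup>2" by simp
  with m(2) have "(norm (R X))\<^sup>2 \<le> (norm (R Y))\<^sup>2 + 2 * (R Y \<bullet> (X - Y)) + (norm (X - Y))\<^sup>2"
    by (simp add: power2_norm_eq_inner inner_simps inner_commute)
  then show "(norm (R X))\<^sup>2 / 2 \<le> (norm (R Y))\<^sup>2 / 2 + R Y \<bullet> (X - Y) + (norm (X - Y))\<^sup>2 / 2"
    by linarith
qed

text \<open>The second difference of the functions \<open>excess\<close> at \<open>\<delta>, 2\<delta>, 3\<delta>\<close> is a tent over \<open>[\<delta>, 3\<delta>]\<close>, and \<open>ramp \<delta>\<close> is its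
  primitive, which is \<open>0\<close> up to \<open>\<delta>\<close> and \<open>\<delta>\<^sup>2\<close> from \<open>3\<delta>\<close> on.\<close>

definition tent :: "real \<Rightarrow> real \<Rightarrow> real" where
  "tent \<delta> t = excess \<delta> t - 2 * excess (2 * \<delta>) t + excess (3 * \<delta>) t"

definition ramp :: "real \<Rightarrow> real \<Rightarrow> real" where
  "ramp \<delta> t = ((excess \<delta> t)\<^sup>2 - 2 * (excess (2 * \<delta>) t)\<^sup>2 + (excess (3 * \<delta>) t)\<^sup>2) / 2"

definition soft_count :: "real \<Rightarrow> real^'n^'m \<Rightarrow> real" where
  "soft_count \<delta> X = (\<Sum>i = 1..CARD('n). ramp \<delta> (sing_val X i))"

lemma sv_map_tent:
  "sv_map (tent \<delta>) X = sv_map (excess \<delta>) X - 2 *\<^sub>R sv_map (excess (2 * \<delta>)) X + sv_map (excess (3 * \<delta>)) X"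
  by (simp add: sv_map_def dyad_sum_diff dyad_sum_add dyad_sum_scale tent_def)

lemma soft_count_energy:
  assumes "0 < \<delta>"
  shows "soft_count \<delta> X = (norm (sv_map (excess \<delta>) X))\<^sup>2 / 2
    - 2 * ((norm (sv_map (excess (2 * \<delta>)) X))\<^sup>2 / 2) + (norm (sv_map (excess (3 * \<delta>)) X))\<^sup>2 / 2"
  using assms by (simp add: sv_excess_norm soft_count_def ramp_def sum_subtractf sum.distrib
      sum_distrib_left sum_divide_distrib add_divide_distrib diff_divide_distrib)

text \<open>\<open>soft_count\<close> is a combination of three squared distances and \<open>sv_map (tent \<delta>)\<close> is its gradient; only the
  middle distance enters with a negative sign, so it alone costs a quadratic term.\<close>

lemma soft_count_lower:
  assumes d: "0 < \<delta>"
  shows "soft_count \<delta> Y + sv_map (tent \<delta>) Y \<bullet> (X - Y) - (norm (X - Y))\<^sup>2 \<le> soft_count \<delta> X"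
proof -
  have "0 < 2 * \<delta>" "0 < 3 * \<delta>" using d by auto
  note e = sv_excess_energy(1)[OF d, of Y X] sv_excess_energy(2)[OF this(1), of X Y]
    sv_excess_energy(1)[OF this(2), of Y X]
  show ?thesis
    unfolding soft_count_energy[OF d] sv_map_tent inner_add_left inner_diff_left inner_scaleR_left
    using e by linarith
qed

lemma sv_map_tent_lipschitz:
  assumes d: "0 < \<delta>"
  shows "norm (sv_map (tent \<delta>) X - sv_map (tent \<delta>) Y) \<le> 4 * norm (X - Y)"
proof -
  let ?D = "\<lambda>c. sv_map (excess c) X - sv_map (excess c) Y"
  have "sv_map (tent \<delta>) X - sv_map (tent \<delta>) Y = ?D \<delta> - 2 *\<^sub>R ?D (2 * \<delta>) + ?D (3 * \<delta>)"
    by (simp add: sv_map_tent algebra_simps)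
  then have "norm (sv_map (tent \<delta>) X - sv_map (tent \<delta>) Y)
      = norm (?D \<delta> - 2 *\<^sub>R ?D (2 * \<delta>) + ?D (3 * \<delta>))" by simp
  also have "\<dots> \<le> norm (?D \<delta>) + 2 * norm (?D (2 * \<delta>)) + norm (?D (3 * \<delta>))"
    using norm_triangle_ineq[of "?D \<delta> - 2 *\<^sub>R ?D (2 * \<delta>)" "?D (3 * \<delta>)"]
      norm_triangle_ineq4[of "?D \<delta>" "2 *\<^sub>R ?D (2 * \<delta>)"] by simp
  also have "\<dots> \<le> 4 * norm (X - Y)"
    using sv_excess_nonexpansive[of \<delta> X Y] sv_excess_nonexpansive[of "2 * \<delta>" X Y]
      sv_excess_nonexpansive[of "3 * \<delta>" X Y] d by simp
  finally show ?thesis .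
qed

lemma tent_bounds:
  assumes "0 < \<delta>"
  shows "0 \<le> tent \<delta> t" "t \<le> \<delta> \<Longrightarrow> tent \<delta> t = 0" "3 * \<delta> \<le> t \<Longrightarrow> tent \<delta> t = 0"
    "0 \<le> t \<Longrightarrow> tent \<delta> t \<le> t" "x \<le> y \<Longrightarrow> tent \<delta> y - tent \<delta> x \<le> y - x"
  using assms by (auto simp: tent_def excess_def max_def)

lemma ramp_low: "0 < \<delta> \<Longrightarrow> t \<le> \<delta> \<Longrightarrow> ramp \<delta> t = 0"
  by (simp add: ramp_def excess_def)

lemma ramp_high: "0 < \<delta> \<Longrightarrow> 3 * \<delta> \<le> t \<Longrightarrow> ramp \<delta> t = \<delta>\<^sup>2"
  by (simp add: ramp_def excess_def power2_eq_square field_simps)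

lemma ramp_range:
  assumes d: "0 < \<delta>"
  shows "0 \<le> ramp \<delta> t" "ramp \<delta> t \<le> \<delta>\<^sup>2"
proof -
  consider "t \<le> \<delta>" | "\<delta> \<le> t" "t \<le> 2 * \<delta>" | "2 * \<delta> \<le> t" "t \<le> 3 * \<delta>" | "3 * \<delta> \<le> t" by linarith
  then have "0 \<le> ramp \<delta> t \<and> ramp \<delta> t \<le> \<delta>\<^sup>2"
  proof cases
    case 2
    then have "ramp \<delta> t = (t - \<delta>)\<^sup>2 / 2" using d by (simp add: ramp_def excess_def)
    moreover have "(t - \<delta>)\<^sup>2 \<le> \<delta>\<^sup>2" using 2 by (intro power_mono) auto
    ultimately show ?thesis
      using zero_le_power2[of "t - \<delta>"] zero_le_power2[of \<delta>] by (intro conjI) linarith+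
  next
    case 3
    then have "ramp \<delta> t = \<delta>\<^sup>2 - (3 * \<delta> - t)\<^sup>2 / 2"
      using d by (simp add: ramp_def excess_def power2_eq_square field_simps)
    moreover have "(3 * \<delta> - t)\<^sup>2 \<le> \<delta>\<^sup>2" using 3 by (intro power_mono) auto
    ultimately show ?thesis
      using zero_le_power2[of "3 * \<delta> - t"] zero_le_power2[of \<delta>] by (intro conjI) linarith+
  qed (use d in \<open>auto simp: ramp_low ramp_high\<close>)
  then show "0 \<le> ramp \<delta> t" "ramp \<delta> t \<le> \<delta>\<^sup>2" by auto
qed

lemma soft_count_nonneg: "0 < \<delta> \<Longrightarrow> 0 \<le> soft_count \<delta> X"
  unfolding soft_count_def by (intro sum_nonneg ramp_range)

lemma abs_inner_matrix_vector_le: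
  "\<bar>U \<bullet> (M *v V)\<bar> \<le> norm U * (norm M * norm V)" for M :: "real^'n^'m"
  using Cauchy_Schwarz_ineq2[of U "M *v V"] norm_matrix_vector_le[of M V]
  by (meson mult_left_mono norm_ge_zero order_trans)

lemma dyad_sum_unit:
  fixes V :: "nat \<Rightarrow> real^'n"
  assumes "p \<in> {1..CARD('n)}"
  shows "dyad_sum U V (\<lambda>i. if i = p then 1 else 0) = outer (U p) (V p)"
proof -
  have "dyad_sum U V (\<lambda>i. if i = p then 1 else 0) = (\<Sum>i = 1..CARD('n). if i = p then outer (U i) (V i) else 0)"
    unfolding dyad_sum_def by (intro sum.cong) auto
  then show ?thesis using assms by simp
qed

lemma antimono_superlevel:
  fixes s :: "nat \<Rightarrow> real"
  assumes "antimono_on {1..n} s"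
  shows "{i \<in> {1..n}. c \<le> s i} = {1..card {i \<in> {1..n}. c \<le> s i}}"
proof -
  define S where "S = {i \<in> {1..n}. c \<le> s i}"
  define m where "m = Max (insert 0 S)"
  have fin: "finite S" by (simp add: S_def)
  have "S = {1..m}"
  proof
    show "S \<subseteq> {1..m}" using fin by (auto simp: m_def S_def)
    show "{1..m} \<subseteq> S"
    proof
      fix i assume i: "i \<in> {1..m}"
      have "m \<in> insert 0 S" unfolding m_def using fin by (intro Max_in) auto
      then have "m \<in> S" using i by auto
      then show "i \<in> S" using i monotone_onD[OF assms, of i m] by (auto simp: S_def)
    qed
  qed
  then show ?thesis unfolding S_def[symmetric] by simp
qed

section \<open>The inner minimisation problem\<close>

text \<open>One-sided optimality of a minimiser \<open>X\<close> of the model, tested along \<open>X - t E\<close> where \<open>E\<close> shares the singular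
  vectors of \<open>X\<close>.  The hypotheses on \<open>t0\<close> keep the perturbed singular values sorted, so that the
  sorted weights of \<open>Phi_d\<close> act on the same indices and \<open>Phi_d\<close> is affine along the path although it is
  not convex.\<close>

lemma prox_step_stationarity:
  fixes V :: "nat \<Rightarrow> real^'n" and X :: "real^'n^'m"
  assumes min: "\<And>W. (X - Y) \<bullet> G + 1/2 * k * (norm (X - Y))\<^sup>2 + lam * Phi_d v d X
      \<le> (W - Y) \<bullet> G + 1/2 * k * (norm (W - Y))\<^sup>2 + lam * Phi_d v d W"
    and sv: "svd X U V (sing_val X)" and v: "0 < v" and k: "0 \<le> k"
    and z: "\<And>i. i \<in> {1..CARD('n)} \<Longrightarrow> sing_val X i = 0 \<Longrightarrow> e i = 0"
    and t0: "0 < t0"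
    and anti: "\<And>t. 0 < t \<Longrightarrow> t \<le> t0 \<Longrightarrow> antimono_on {1..CARD('n)} (\<lambda>i. sing_val X i - t * e i)"
    and pos: "\<And>t i. 0 < t \<Longrightarrow> t \<le> t0 \<Longrightarrow> i \<in> {1..CARD('n)} \<Longrightarrow> 0 \<le> sing_val X i - t * e i"
    and d: "\<And>i. i \<in> {1..CARD('n)} \<Longrightarrow> e i \<noteq> 0 \<Longrightarrow> d i = 1"
  shows "(G + k *\<^sub>R (X - Y)) \<bullet> dyad_sum U V e \<le> - (lam / v) * (\<Sum>i = 1..CARD('n). e i)"
proof -
  define E where "E = dyad_sum U V e"
  define A where "A = (G + k *\<^sub>R (X - Y)) \<bullet> E + (lam / v) * (\<Sum>i = 1..CARD('n). e i)"
  define B where "B = 1/2 * k * (norm E)\<^sup>2"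
  have X: "X = dyad_sum U V (sing_val X)" using sv by (simp add: svd_def)
  have key: "A \<le> B * t" if t: "0 < t" "t \<le> t0" for t
  proof -
    define W where "W = X - t *\<^sub>R E"
    have W: "W = dyad_sum U V (\<lambda>i. sing_val X i - t * e i)"
      unfolding W_def E_def by (subst X) (simp add: dyad_sum_diff dyad_sum_scale)
    have sW: "sing_val W i = sing_val X i - t * e i" if "i \<in> {1..CARD('n)}" for i
      unfolding W using z by (intro sing_val_dyad_sum[OF sv _ anti[OF t] pos[OF t] that]) auto
    have "Phi_d v d W = (\<Sum>i = 1..CARD('n).
        (sing_val X i / v - theta v (d i) (sing_val X i)) - t * e i / v)"
      unfolding Phi_d_def
    proof (intro sum.cong refl)
      fix i assume i: "i \<in> {1..CARD('n)}"
      show "sing_val W i / v - theta v (d i) (sing_val W i) =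
          sing_val X i / v - theta v (d i) (sing_val X i) - t * e i / v"
        using d[OF i] v unfolding sW[OF i]
        by (cases "e i = 0") (auto simp: theta_def field_simps)
    qed
    then have Phi: "Phi_d v d W = Phi_d v d X - t / v * (\<Sum>i = 1..CARD('n). e i)"
      by (simp add: Phi_d_def sum_subtractf sum_distrib_left)
    have inn: "(W - Y) \<bullet> G = (X - Y) \<bullet> G - t * (G \<bullet> E)"
      by (simp add: W_def inner_simps inner_commute)
    have nrm: "(norm (W - Y))\<^sup>2 = (norm (X - Y))\<^sup>2 - 2 * t * ((X - Y) \<bullet> E) + t\<^sup>2 * (norm E)\<^sup>2"
    proof -
      have expand: "(norm (D - t *\<^sub>R E))\<^sup>2 = (norm D)\<^sup>2 - 2 * t * (D \<bullet> E) + t\<^sup>2 * (norm E)\<^sup>2" for D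
        unfolding power2_norm_eq_inner
        by (simp add: inner_diff_left inner_diff_right inner_commute power2_eq_square)
      show ?thesis using expand[of "X - Y"] by (simp add: W_def algebra_simps)
    qed
    have "0 \<le> - t * (G \<bullet> E) + 1/2 * k * (- 2 * t * ((X - Y) \<bullet> E) + t\<^sup>2 * (norm E)\<^sup>2)
        - lam * (t / v * (\<Sum>i = 1..CARD('n). e i))"
      using min[of W] unfolding Phi inn nrm by (simp add: algebra_simps)
    also have "\<dots> = t * (B * t - A)"
      by (simp add: A_def B_def inner_add_left power2_eq_square algebra_simps)
    finally show ?thesis using t(1) by (simp add: zero_le_mult_iff)
  qed
  have B: "0 \<le> B" using k by (simp add: B_def)
  have "A \<le> 0"
  proof (rule ccontr)
    assume "\<not> A \<le> 0"
    then have A: "0 < A" by simp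
    define t where "t = min t0 (A / (2 * (B + 1)))"
    have t: "0 < t" "t \<le> t0" using A B t0 by (auto simp: t_def)
    have "A \<le> B * t" by (rule key[OF t])
    also have "\<dots> \<le> (B + 1) * (A / (2 * (B + 1)))"
      using B t by (intro mult_mono) (auto simp: t_def)
    also have "\<dots> = A / 2" using B by (simp add: field_simps)
    finally show False using A by simp
  qed
  then show ?thesis by (simp add: A_def E_def)
qed

text \<open>The shrinkage \<open>lam / v\<close> exceeds the bound \<open>Lf\<close> on the gradient, so the minimiser has moved away from the
  extrapolated point by a definite amount along every admissible direction.\<close>

lemma prox_step_decrease:
  fixes V :: "nat \<Rightarrow> real^'n" and X :: "real^'n^'m"
  assumes min: "\<And>W. (X - Y) \<bullet> G + 1/2 * k * (norm (X - Y))\<^sup>2 + lam * Phi_d v d X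
      \<le> (W - Y) \<bullet> G + 1/2 * k * (norm (W - Y))\<^sup>2 + lam * Phi_d v d W"
    and sv: "svd X U V (sing_val X)" and v: "0 < v" and k: "0 < k"
    and G: "norm G \<le> Lf"
    and z: "\<And>i. i \<in> {1..CARD('n)} \<Longrightarrow> sing_val X i = 0 \<Longrightarrow> e i = 0"
    and e: "\<And>i. i \<in> {1..CARD('n)} \<Longrightarrow> 0 \<le> e i"
    and t0: "0 < t0"
    and anti: "\<And>t. 0 < t \<Longrightarrow> t \<le> t0 \<Longrightarrow> antimono_on {1..CARD('n)} (\<lambda>i. sing_val X i - t * e i)"
    and pos: "\<And>t i. 0 < t \<Longrightarrow> t \<le> t0 \<Longrightarrow> i \<in> {1..CARD('n)} \<Longrightarrow> 0 \<le> sing_val X i - t * e i"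
    and d: "\<And>i. i \<in> {1..CARD('n)} \<Longrightarrow> e i \<noteq> 0 \<Longrightarrow> d i = 1"
  shows "(X - Y) \<bullet> dyad_sum U V e \<le> - ((lam / v - Lf) / k) * (\<Sum>i = 1..CARD('n). e i)"
proof -
  have "(G + k *\<^sub>R (X - Y)) \<bullet> dyad_sum U V e \<le> - (lam / v) * (\<Sum>i = 1..CARD('n). e i)"
    using k by (intro prox_step_stationarity[OF min sv v _ z t0 anti pos d]) auto
  moreover have "norm (G *v w) \<le> Lf * norm w" for w
    using norm_matrix_vector_le[of G w] mult_right_mono[OF G, of "norm w"] by simp
  from abs_inner_dyad_sum_le[OF sv e this]
  have "\<bar>G \<bullet> dyad_sum U V e\<bar> \<le> Lf * (\<Sum>i = 1..CARD('n). e i)" by (simp add: inner_commute)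
  ultimately have "k * ((X - Y) \<bullet> dyad_sum U V e) \<le> - (lam / v - Lf) * (\<Sum>i = 1..CARD('n). e i)"
    by (simp add: inner_add_left algebra_simps)
  then show ?thesis using k by (simp add: field_simps)
qed

section \<open>Gradients of smooth convex functions\<close>

lemma GDERIV_grad:
  fixes F :: "'a::euclidean_space \<Rightarrow> real"
  assumes "F differentiable (at x)"
  shows "GDERIV F x :> grad F x"
proof -
  obtain F' where F': "(F has_derivative F') (at x)" using assms by (auto simp: differentiable_def)
  then have lin: "linear F'" by (rule has_derivative_linear)
  define g where "g = (\<Sum>b\<in>Basis. F' b *\<^sub>R b)"
  have "F' y = y \<bullet> g" for y
  proof -
    have "F' y = F' (\<Sum>b\<in>Basis. (y \<bullet> b) *\<^sub>R b)" by (simp add: euclidean_representation)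
    also have "\<dots> = (\<Sum>b\<in>Basis. (y \<bullet> b) * F' b)"
      by (simp add: linear_sum[OF lin] linear_scale[OF lin])
    finally show ?thesis by (simp add: g_def inner_sum_right mult.commute)
  qed
  then have g: "GDERIV F x :> g" using F' by (metis (no_types, lifting) ext gderiv_def)
  have "y = g" if "GDERIV F x :> y" for y
  proof -
    have "(\<lambda>w. w \<bullet> y) = (\<lambda>w. w \<bullet> g)"
      using that g unfolding gderiv_def by (rule has_derivative_unique)
    then show ?thesis by (metis inner_eq_zero_iff inner_diff_right right_minus_eq)
  qed
  then have "grad F x = g" unfolding grad_def using g by (intro the_equality)
  with g show ?thesis by simp
qed

lemma DERIV_along_line:
  fixes F :: "'a::euclidean_space \<Rightarrow> real"
  assumes "\<And>x. F differentiable (at x)"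
  shows "((\<lambda>t. F (x + t *\<^sub>R w)) has_real_derivative (grad F (x + t *\<^sub>R w) \<bullet> w)) (at t)"
proof -
  have "(F has_derivative (\<lambda>y. y \<bullet> grad F (x + t *\<^sub>R w))) (at (x + t *\<^sub>R w))"
    using GDERIV_grad[OF assms] by (simp add: gderiv_def)
  moreover have "((\<lambda>t. x + t *\<^sub>R w) has_derivative (\<lambda>u. u *\<^sub>R w)) (at t)"
    by (auto intro!: derivative_eq_intros)
  ultimately have "((\<lambda>t. F (x + t *\<^sub>R w)) has_derivative (\<lambda>u. (u *\<^sub>R w) \<bullet> grad F (x + t *\<^sub>R w))) (at t)"
    using has_derivative_compose by blast
  then show ?thesis
    by (simp add: has_field_derivative_def mult_commute_abs inner_commute)
qed

lemma convex_above_tangent: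
  fixes F :: "'a::euclidean_space \<Rightarrow> real"
  assumes diff: "\<And>x. F differentiable (at x)" and conv: "convex_on UNIV F"
  shows "F x + grad F x \<bullet> (y - x) \<le> F y"
proof -
  have "convex_on UNIV (\<lambda>t. F (x + t *\<^sub>R (y - x)))"
  proof (rule convex_onI)
    fix t u w :: real assume t: "0 < t" "t < 1"
    have "x + ((1 - t) *\<^sub>R u + t *\<^sub>R w) *\<^sub>R (y - x) =
        (1 - t) *\<^sub>R (x + u *\<^sub>R (y - x)) + t *\<^sub>R (x + w *\<^sub>R (y - x))"
      by (simp add: algebra_simps)
    then show "F (x + ((1 - t) *\<^sub>R u + t *\<^sub>R w) *\<^sub>R (y - x)) \<le>
        (1 - t) * F (x + u *\<^sub>R (y - x)) + t * F (x + w *\<^sub>R (y - x))"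
      using convex_onD[OF conv, of t] t by simp
  qed simp
  moreover have "((\<lambda>t. F (x + t *\<^sub>R (y - x))) has_real_derivative (grad F x \<bullet> (y - x))) (at 0)"
    using DERIV_along_line[OF diff, of x "y - x" 0] by simp
  ultimately have "F (x + 1 *\<^sub>R (y - x)) - F (x + 0 *\<^sub>R (y - x)) \<ge> (grad F x \<bullet> (y - x)) * (1 - 0)"
    by (intro convex_on_imp_above_tangent[of UNIV "\<lambda>t. F (x + t *\<^sub>R (y - x))" 0 1]) auto
  then show ?thesis by simp
qed

text \<open>If the gradient \<open>w\<close> were longer than \<open>L\<close>, then along the ray \<open>x + t w\<close> the tangent would grow by
  \<open>t (norm w - L) norm w\<close> more than \<open>f\<close> does; for large \<open>t\<close> this exceeds any bounded distance.\<close>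

lemma grad_norm_le_lipschitz:
  fixes F f :: "'a::euclidean_space \<Rightarrow> real"
  assumes diff: "\<And>x. F differentiable (at x)" and conv: "convex_on UNIV F"
    and lip: "L-lipschitz_on UNIV f" and near: "\<And>x. \<bar>F x - f x\<bar> \<le> C"
  shows "norm (grad F x) \<le> L"
proof (rule ccontr)
  define w where "w = grad F x"
  define \<eta> where "\<eta> = norm w * (norm w - L)"
  assume "\<not> norm (grad F x) \<le> L"
  then have \<eta>: "0 < \<eta>"
    using lipschitz_on_nonneg[OF lip] by (auto simp: \<eta>_def w_def intro!: mult_pos_pos)
  have C: "0 \<le> C" using near[of x] by linarith
  \<comment> \<open>long enough for the surplus growth \<open>t \<eta>\<close> to exceed the total tolerance \<open>2 C\<close>\<close>
  define t where "t = (2 * C + 1) / \<eta>"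
  have t: "0 < t" using C \<eta> by (simp add: t_def)
  have "t * (norm w)\<^sup>2 \<le> F (x + t *\<^sub>R w) - F x"
    using convex_above_tangent[OF diff conv, of x "x + t *\<^sub>R w"]
    by (simp add: w_def power2_norm_eq_inner)
  also have "\<dots> \<le> f (x + t *\<^sub>R w) - f x + 2 * C"
    using near[of x] near[of "x + t *\<^sub>R w"] by linarith
  also have "f (x + t *\<^sub>R w) - f x \<le> L * (t * norm w)"
    using lipschitz_onD[OF lip, of "x + t *\<^sub>R w" x] t by (simp add: dist_norm)
  finally have "t * \<eta> \<le> 2 * C" by (simp add: \<eta>_def power2_eq_square algebra_simps)
  moreover have "t * \<eta> = 2 * C + 1" using \<eta> by (simp add: t_def)
  ultimately show False by simp
qed

lemma lipschitz_grad_descent: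
  fixes F :: "'a::euclidean_space \<Rightarrow> real"
  assumes diff: "\<And>x. F differentiable (at x)" and lip: "L-lipschitz_on UNIV (grad F)"
  shows "F y \<le> F x + grad F x \<bullet> (y - x) + L / 2 * (norm (y - x))\<^sup>2"
proof -
  define w where "w = y - x"
  define \<psi> where "\<psi> = (\<lambda>t. F (x + t *\<^sub>R w) - t * (grad F x \<bullet> w) - L / 2 * t\<^sup>2 * (norm w)\<^sup>2)"
  have "\<psi> 1 \<le> \<psi> 0"
  proof (rule DERIV_nonpos_imp_nonincreasing[of 0 1 \<psi>])
    fix t :: real assume t: "0 \<le> t" "t \<le> 1"
    let ?D = "grad F (x + t *\<^sub>R w) \<bullet> w - grad F x \<bullet> w - L * t * (norm w)\<^sup>2"
    have "DERIV \<psi> t :> ?D"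
      unfolding \<psi>_def by (auto intro!: derivative_eq_intros DERIV_along_line[OF diff])
    moreover have "?D \<le> 0"
    proof -
      have "grad F (x + t *\<^sub>R w) \<bullet> w - grad F x \<bullet> w = (grad F (x + t *\<^sub>R w) - grad F x) \<bullet> w"
        by (simp add: inner_diff_left)
      also have "\<dots> \<le> norm (grad F (x + t *\<^sub>R w) - grad F x) * norm w" by (rule norm_cauchy_schwarz)
      also have "\<dots> \<le> (L * (t * norm w)) * norm w"
        using lipschitz_onD[OF lip, of "x + t *\<^sub>R w" x] t
        by (intro mult_right_mono) (auto simp: dist_norm)
      finally show ?thesis by (simp add: power2_eq_square mult_ac)
    qed
    ultimately show "\<exists>D. DERIV \<psi> t :> D \<and> D \<le> 0" by blast
  qed simp
  then show ?thesis by (simp add: \<psi>_def w_def)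
qed

text \<open>The first bound compares both points with the tangent at \<open>x + b\<close>; the second expands at \<open>x\<close> and pays for the
  change of gradient.  The second one has no term in \<open>(norm b)\<^sup>2\<close>, which is what makes it useful
  when \<open>p\<close> is already known to be short.\<close>

lemma extrapolated_descent:
  fixes F :: "'a::euclidean_space \<Rightarrow> real"
  assumes diff: "\<And>x. F differentiable (at x)" and conv: "convex_on UNIV F"
    and lip: "L-lipschitz_on UNIV (grad F)"
  shows "F (x + p) \<le> F x + grad F (x + b) \<bullet> p + L / 2 * (norm (p - b))\<^sup>2"
    and "F (x + p) \<le> F x + grad F (x + b) \<bullet> p + L * norm b * norm p + L / 2 * (norm p)\<^sup>2"
proof -
  show "F (x + p) \<le> F x + grad F (x + b) \<bullet> p + L / 2 * (norm (p - b))\<^sup>2"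
    using lipschitz_grad_descent[OF diff lip, of "x + p" "x + b"]
      convex_above_tangent[OF diff conv, of "x + b" x]
    by (simp add: inner_diff_right)
  have "(grad F x - grad F (x + b)) \<bullet> p \<le> norm (grad F x - grad F (x + b)) * norm p"
    by (rule norm_cauchy_schwarz)
  also have "\<dots> \<le> (L * norm b) * norm p"
    using lipschitz_onD[OF lip, of x "x + b"] by (intro mult_right_mono) (auto simp: dist_norm)
  finally show "F (x + p) \<le> F x + grad F (x + b) \<bullet> p + L * norm b * norm p + L / 2 * (norm p)\<^sup>2"
    using lipschitz_grad_descent[OF diff lip, of "x + p" x]
    by (simp add: inner_diff_left)
qed

text \<open>The potential \<open>u + c max 0 p\<close>, corrected by the partial sums of \<open>w\<close>, is decreasing as soon as
  \<open>(1 + c) q \<le> c\<close>.  This holds for \<open>c = q / (1 - q)\<close> and for every larger \<open>c\<close>; two such potentials converge, and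
  their difference isolates \<open>max 0 p\<close> and then \<open>u\<close>.\<close>

lemma convergent_of_damped_increments:
  fixes u p w :: "nat \<Rightarrow> real"
  assumes w: "summable w" "\<And>k. 0 \<le> w k" and q: "0 \<le> q" "q < 1"
    and u0: "\<And>k. 0 \<le> u k"
    and p: "\<And>k. p (Suc k) \<le> q * max 0 (p k) + w k"
    and u: "\<And>k. u (Suc k) \<le> u k + p (Suc k) + w k"
  shows "convergent u"
proof -
  define P where "P = (\<lambda>k. max 0 (p k))"
  define W where "W = (\<lambda>k. sum w {..<k})"
  define \<Psi> where "\<Psi> = (\<lambda>c k. u k + c * P k - (2 + c) * W k)"
  have P: "P (Suc k) \<le> q * P k + w k" "0 \<le> P k" "p k \<le> P k" for k
    using p[of k] w(2)[of k] q by (auto simp: P_def)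
  have W: "convergent W" using w(1) by (simp add: W_def summable_iff_convergent)
  have conv: "convergent (\<Psi> c)" if c: "0 \<le> c" "(1 + c) * q \<le> c" for c
  proof (rule decseq_convergent)
    show "decseq (\<Psi> c)"
    proof (rule decseq_SucI)
      fix k
      have "(1 + c) * P (Suc k) \<le> (1 + c) * (q * P k + w k)"
        using P c by (intro mult_left_mono) auto
      also have "\<dots> \<le> c * P k + (1 + c) * w k"
        using mult_right_mono[OF c(2) P(2)[of k]] by (simp add: algebra_simps)
      finally show "\<Psi> c (Suc k) \<le> \<Psi> c k"
        using u[of k] P(3)[of "Suc k"] by (simp add: \<Psi>_def W_def algebra_simps)
    qed
    show "\<forall>k. - ((2 + c) * suminf w) \<le> \<Psi> c k"
    proof
      fix k
      have "(2 + c) * W k \<le> (2 + c) * suminf w"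
        unfolding W_def using w c by (intro mult_left_mono sum_le_suminf) auto
      moreover have "0 \<le> u k + c * P k" using u0 P c by simp
      ultimately show "- ((2 + c) * suminf w) \<le> \<Psi> c k" by (simp add: \<Psi>_def)
    qed
  qed (auto simp: convergent_def)
  define c where "c = q / (1 - q)"
  have c: "0 \<le> c" "(1 + c) * q \<le> c" using q by (simp_all add: c_def field_simps)
  have c1: "convergent (\<Psi> (c + 1))"
    using c q by (intro conv) (auto simp: algebra_simps)
  have "convergent (\<lambda>k. (\<Psi> (c + 1) k - \<Psi> c k) + W k)"
    by (intro convergent_add convergent_diff c1 conv[OF c] W)
  then have "convergent P" by (simp add: \<Psi>_def algebra_simps)
  then have "convergent (\<lambda>k. \<Psi> c k - c * P k + (2 + c) * W k)"
    by (intro convergent_add convergent_diff convergent_mult convergent_const conv[OF c] W)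
  then show ?thesis by (simp add: \<Psi>_def)
qed

lemma Phi_le_Phi_d:
  fixes X :: "real^'n^'m"
  assumes "0 < v"
  shows "Phi v X \<le> Phi_d v d X"
  unfolding Phi_def Phi_d_def by (intro sum_mono) (auto simp: phi_def theta_def)

lemma Phi_d_self:
  fixes X :: "real^'n^'m"
  assumes "0 < v"
  shows "Phi_d v (d_of v X) X = Phi v X"
  unfolding Phi_def Phi_d_def using assms
  by (intro sum.cong) (auto simp: phi_def theta_def d_of_def min_def field_simps)

section \<open>Descent along a run of the algorithm\<close>

locale gimspg_run =
  fixes f :: "real^'n^'m \<Rightarrow> real"
    and ft :: "real^'n^'m \<Rightarrow> real \<Rightarrow> real"
    and X :: "nat \<Rightarrow> real^'n^'m"
    and \<mu> \<alpha> \<beta> h :: "nat \<Rightarrow> real"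
    and lam v Lf mubar \<kappa> Lt \<sigma> a \<epsilon> :: real
  assumes f_nonneg: "\<And>W. 0 \<le> f W"
    and f_lip: "Lf-lipschitz_on UNIV f"
    and lam: "0 < lam" and v: "0 < v" and v_less: "v < lam / Lf"
    and smooth: "smoothing_function f ft mubar \<kappa> Lt"
    and alg: "GIMSPG ft lam v mubar \<kappa> \<sigma> a \<alpha> \<beta> h X \<mu>"
    and params: "parameter_constraints \<epsilon> \<sigma> Lt \<alpha> \<beta> h \<mu>"
begin

text \<open>\<open>D k\<close> is the increment \<open>X k - X (k - 1)\<close> with \<open>D 0 = 0\<close>, and \<open>G k\<close> is the gradient used in step \<open>k\<close>.  \<open>H k\<close> and
  \<open>Htest k\<close> are the two values compared in the test of step \<open>k\<close>; \<open>H (Suc k)\<close> differs from \<open>Htest k\<close> when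
  the smoothing parameter changes.\<close>

definition D :: "nat \<Rightarrow> real^'n^'m" where "D k = X k - X (k - 1)"
definition G :: "nat \<Rightarrow> real^'n^'m" where "G k = grad (\<lambda>W. ft W (\<mu> k)) (X k + \<beta> k *\<^sub>R D k)"
definition H :: "nat \<Rightarrow> real" where
  "H k = H_fun ft lam v \<kappa> (h k * \<alpha> k / 2) (X k) (X (k - 1)) (\<mu> k) (\<mu> (k - 1))"
definition Htest :: "nat \<Rightarrow> real" where
  "Htest k = H_fun ft lam v \<kappa> (h (Suc k) * \<alpha> (Suc k) / 2) (X (Suc k)) (X k) (\<mu> k) (\<mu> k)"
definition gap :: real where "gap = lam / v - Lf"

lemma gap_pos: "0 < gap"
proof -
  have "0 \<le> Lf" using f_lip by (rule lipschitz_on_nonneg)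
  moreover have "Lf \<noteq> 0" using v v_less by auto
  ultimately show ?thesis using v v_less by (simp add: gap_def field_simps)
qed

lemma const_pos: "0 < mubar" "0 < \<kappa>" "0 < Lt" "0 < \<mu> 0" "\<mu> 0 \<le> mubar" "0 < \<sigma>" "0 < a" "0 < \<epsilon>"
  using smooth alg params
  unfolding smoothing_function_def GIMSPG_def parameter_constraints_def by auto

lemma mu_Suc:
  "\<mu> (Suc k) = (if Htest k - H k \<le> - a * (\<mu> k)\<^sup>2 then \<mu> k else \<mu> 0 / (real (k + 1) powr \<sigma>))"
  using alg unfolding GIMSPG_def Htest_def H_def Let_def by blast

lemma step_min:
  defines "Y \<equiv> \<lambda>k. X k + \<alpha> k *\<^sub>R D k"
  shows "(X (Suc k) - Y k) \<bullet> G k + 1/2 * (h k / \<mu> k) * (norm (X (Suc k) - Y k))\<^sup>2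
        + lam * Phi_d v (d_of v (X k)) (X (Suc k))
      \<le> (W - Y k) \<bullet> G k + 1/2 * (h k / \<mu> k) * (norm (W - Y k))\<^sup>2 + lam * Phi_d v (d_of v (X k)) W"
proof -
  have "is_arg_min (\<lambda>W. Q_fun ft lam v (h k) (d_of v (X k)) W (Y k) (X k + \<beta> k *\<^sub>R D k) (\<mu> k))
      (\<lambda>_. True) (X (Suc k))"
    using alg unfolding GIMSPG_def Let_def Y_def D_def
    by (elim conjE) (drule spec[of _ k], elim conjE, assumption)
  then have "Q_fun ft lam v (h k) (d_of v (X k)) (X (Suc k)) (Y k) (X k + \<beta> k *\<^sub>R D k) (\<mu> k)
      \<le> Q_fun ft lam v (h k) (d_of v (X k)) W (Y k) (X k + \<beta> k *\<^sub>R D k) (\<mu> k)"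
    unfolding is_arg_min_def by (simp add: not_less)
  then show ?thesis unfolding Q_fun_def G_def divide_inverse mult.assoc .
qed

text \<open>A value kept over many steps was set at an earlier index, where the denominator was not larger.  This is
  what makes \<open>\<mu>\<close> nonincreasing.\<close>

lemma mu_lower: "\<mu> 0 / (real (k + 1) powr \<sigma>) \<le> \<mu> (Suc k)"
proof (induction k)
  case 0
  then show ?case by (simp add: mu_Suc)
next
  case (Suc k)
  have "\<mu> 0 / (real (Suc k + 1) powr \<sigma>) \<le> \<mu> 0 / (real (k + 1) powr \<sigma>)"
    using const_pos by (intro divide_left_mono powr_mono2 mult_pos_pos) auto
  then show ?case using Suc mu_Suc[of "Suc k"] by (simp split: if_splits)
qed

lemma mu_pos: "0 < \<mu> k"
  using mu_lower[of "k - 1"] const_pos by (cases k) (auto intro: less_le_trans[rotated])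

lemma mu_Suc_le: "\<mu> (Suc k) \<le> \<mu> k"
proof (cases "\<mu> (Suc k) = \<mu> k")
  case False
  then have e: "\<mu> (Suc k) = \<mu> 0 / (real (k + 1) powr \<sigma>)" by (metis mu_Suc)
  show ?thesis
  proof (cases k)
    case (Suc j)
    have "\<mu> 0 / (real (Suc j + 1) powr \<sigma>) \<le> \<mu> 0 / (real (j + 1) powr \<sigma>)"
      using const_pos by (intro divide_left_mono powr_mono2 mult_pos_pos) auto
    then show ?thesis using e mu_lower[of j] Suc by simp
  qed (use e in simp)
qed simp

lemma mu_decseq: "decseq \<mu>" by (rule decseq_SucI) (rule mu_Suc_le)

lemma mu_mem: "\<mu> k \<in> {0<..mubar}"
  using mu_pos[of k] decseqD[OF mu_decseq, of 0 k] const_pos by auto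

lemma smooth_at:
  assumes "m \<in> {0<..mubar}"
  shows "(\<lambda>W. ft W m) differentiable (at x)" "convex_on UNIV (\<lambda>W. ft W m)"
    "(Lt / m)-lipschitz_on UNIV (grad (\<lambda>W. ft W m))"
  using smooth assms unfolding smoothing_function_def by blast+

lemma ft_mu_le: "ft W (\<mu> k) + \<kappa> * \<mu> k \<le> ft W (\<mu> (k - 1)) + \<kappa> * \<mu> (k - 1)"
proof -
  have "\<mu> j \<in> {0..mubar}" for j using mu_mem[of j] by auto
  then have "\<bar>ft W (\<mu> k) - ft W (\<mu> (k - 1))\<bar> \<le> \<kappa> * \<bar>\<mu> (k - 1) - \<mu> k\<bar>"
    using smooth unfolding smoothing_function_def by blast
  moreover have "\<mu> k \<le> \<mu> (k - 1)" using decseqD[OF mu_decseq, of "k - 1" k] by simp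
  ultimately show ?thesis by (simp add: algebra_simps)
qed

lemma ft_near_f:
  assumes m: "m \<in> {0<..mubar}"
  shows "\<bar>ft W m - f W\<bar> \<le> \<kappa> * m"
proof -
  have "((\<lambda>(Z, \<mu>). ft Z \<mu>) \<longlongrightarrow> f W) (nhds W \<times>\<^sub>F at_right 0)"
    using smooth unfolding smoothing_function_def by blast
  moreover have "filterlim (\<lambda>t. (W, t)) (nhds W \<times>\<^sub>F at_right 0) (at_right (0::real))"
    by (intro filterlim_Pair tendsto_const filterlim_ident)
  ultimately have "((\<lambda>t. ft W t) \<longlongrightarrow> f W) (at_right 0)"
    using filterlim_compose by fastforce
  then have "((\<lambda>t. \<bar>ft W m - ft W t\<bar>) \<longlongrightarrow> \<bar>ft W m - f W\<bar>) (at_right 0)"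
    by (intro tendsto_intros)
  moreover have "\<forall>\<^sub>F t in at_right 0. \<bar>ft W m - ft W t\<bar> \<le> \<kappa> * m"
    unfolding eventually_at_right_field
  proof (intro exI conjI allI impI)
    show "0 < m" using m by simp
    fix t assume t: "0 < t" "t < m"
    then have "t \<in> {0..mubar}" "m \<in> {0..mubar}" using m by auto
    then have "\<bar>ft W m - ft W t\<bar> \<le> \<kappa> * \<bar>t - m\<bar>"
      using smooth unfolding smoothing_function_def by blast
    also have "\<dots> \<le> \<kappa> * m" using t const_pos by (intro mult_left_mono) auto
    finally show "\<bar>ft W m - ft W t\<bar> \<le> \<kappa> * m" .
  qed
  ultimately show ?thesis by (intro tendsto_upperbound[of _ _ "at_right 0"]) auto
qed

lemma G_bound: "norm (G k) \<le> Lf"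
  unfolding G_def
  by (rule grad_norm_le_lipschitz[OF smooth_at(1,2)[OF mu_mem] f_lip ft_near_f[OF mu_mem]])

text \<open>The two step-size conditions are used after multiplication by \<open>h k\<close>.\<close>

lemma param_bounds:
  shows "0 \<le> \<alpha> k" "\<alpha> (Suc k) \<le> \<alpha> k" "0 \<le> \<beta> k" "\<beta> k \<le> 1" "0 < h k" "h (Suc k) \<le> h k" "h k \<le> h 0"
    and "Lt * \<beta> k \<le> h k * \<alpha> k"
    and "h k * (\<alpha> k + \<epsilon>) * (\<mu> k / \<mu> (Suc k)) \<le> h k * (1 - \<alpha> k) - Lt * (1 - \<beta> k)"
proof -
  have c: "(1 - \<beta> k) * Lt * inverse (h k) \<le> 1 - \<alpha> k - (\<alpha> k + \<epsilon>) * (\<mu> k / \<mu> (Suc k))"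
    "\<beta> k * Lt * inverse (h k) \<le> \<alpha> k" "0 < h k" "decseq \<alpha>" "decseq h"
    "0 \<le> \<alpha> k" "0 \<le> \<beta> k" "\<beta> k \<le> 1"
    using params unfolding parameter_constraints_def by blast+
  then show "0 \<le> \<alpha> k" "\<alpha> (Suc k) \<le> \<alpha> k" "0 \<le> \<beta> k" "\<beta> k \<le> 1" "0 < h k" "h (Suc k) \<le> h k" "h k \<le> h 0"
    by (auto simp: decseq_def)
  have "h k * (\<beta> k * Lt * inverse (h k)) \<le> h k * \<alpha> k"
    using c by (intro mult_left_mono) auto
  then show "Lt * \<beta> k \<le> h k * \<alpha> k" using c(3) by (simp add: field_simps)
  have "h k * ((1 - \<beta> k) * Lt * inverse (h k)) \<le> h k * (1 - \<alpha> k - (\<alpha> k + \<epsilon>) * (\<mu> k / \<mu> (Suc k)))"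
    using c by (intro mult_left_mono) auto
  moreover have "h k * ((1 - \<beta> k) * Lt * inverse (h k)) = Lt * (1 - \<beta> k)"
    using c(3) by (simp add: field_simps)
  ultimately show "h k * (\<alpha> k + \<epsilon>) * (\<mu> k / \<mu> (Suc k)) \<le> h k * (1 - \<alpha> k) - Lt * (1 - \<beta> k)"
    by (simp add: right_diff_distrib mult.assoc)
qed

lemma mu_ratio: "1 \<le> \<mu> k / \<mu> (Suc k)" "\<epsilon> * \<mu> k \<le> \<mu> (Suc k)"
proof -
  show r: "1 \<le> \<mu> k / \<mu> (Suc k)" using mu_Suc_le[of k] mu_pos[of "Suc k"] by simp
  have "h k * (\<epsilon> * (\<mu> k / \<mu> (Suc k))) \<le> h k * (\<alpha> k + \<epsilon>) * (\<mu> k / \<mu> (Suc k))"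
    unfolding mult.assoc using param_bounds(1,5)[of k] r by (intro mult_left_mono mult_right_mono) auto
  also have "\<dots> \<le> h k * (1 - \<alpha> k) - Lt * (1 - \<beta> k)" by (rule param_bounds)
  also have "\<dots> \<le> h k * 1"
  proof -
    have "0 \<le> h k * \<alpha> k" "0 \<le> Lt * (1 - \<beta> k)" using param_bounds(1,4,5)[of k] const_pos by auto
    then show ?thesis by (simp add: right_diff_distrib)
  qed
  finally have "\<epsilon> * (\<mu> k / \<mu> (Suc k)) \<le> 1" using param_bounds(5)[of k] by (simp only: mult_le_cancel_left_pos)
  then show "\<epsilon> * \<mu> k \<le> \<mu> (Suc k)" using mu_pos[of "Suc k"] by (simp add: field_simps)
qed

lemma h_lower: "Lt \<le> h k"
proof -
  have "0 \<le> h k * (\<alpha> k + \<epsilon>) * (\<mu> k / \<mu> (Suc k))"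
    using param_bounds[of k] const_pos mu_ratio(1)[of k] by (intro mult_nonneg_nonneg) auto
  then show ?thesis using param_bounds(8,9)[of k] by (simp add: algebra_simps)
qed

lemma alpha_lt_1: "\<alpha> k < 1"
proof -
  have "0 < h k * (\<alpha> k + \<epsilon>) * (\<mu> k / \<mu> (Suc k))"
    using param_bounds[of k] const_pos mu_ratio(1)[of k] by (intro mult_pos_pos add_nonneg_pos) auto
  moreover have "0 \<le> Lt * (1 - \<beta> k)" using param_bounds[of k] const_pos by simp
  ultimately have "0 < h k * (1 - \<alpha> k)" using param_bounds(9)[of k] by linarith
  then show ?thesis using param_bounds(5)[of k] by (simp add: zero_less_mult_iff)
qed

lemma step_prox_ineq:
  "D (Suc k) \<bullet> G k + h k / (2 * \<mu> k) * ((norm (D (Suc k)))\<^sup>2 - 2 * \<alpha> k * (D (Suc k) \<bullet> D k))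
    + lam * Phi v (X (Suc k)) \<le> lam * Phi v (X k)"
proof -
  let ?p = "D (Suc k)" and ?d = "D k"
  have a: "X (Suc k) - (X k + \<alpha> k *\<^sub>R D k) = ?p - \<alpha> k *\<^sub>R ?d"
    and b: "X k - (X k + \<alpha> k *\<^sub>R D k) = - (\<alpha> k *\<^sub>R ?d)" by (simp_all add: D_def)
  have sq: "(norm (?p - \<alpha> k *\<^sub>R ?d))\<^sup>2 = (norm ?p)\<^sup>2 - 2 * \<alpha> k * (?p \<bullet> ?d) + (norm (- (\<alpha> k *\<^sub>R ?d)))\<^sup>2"
    unfolding power2_norm_eq_inner
    by (simp add: inner_diff_left inner_diff_right inner_commute)
  have inn: "(?p - \<alpha> k *\<^sub>R ?d) \<bullet> G k = ?p \<bullet> G k + (- (\<alpha> k *\<^sub>R ?d)) \<bullet> G k"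
    by (simp add: inner_diff_left)
  have "lam * Phi v (X (Suc k)) \<le> lam * Phi_d v (d_of v (X k)) (X (Suc k))"
    using lam Phi_le_Phi_d[OF v] by simp
  moreover have "1/2 * (h k / \<mu> k) = h k / (2 * \<mu> k)" by simp
  ultimately show ?thesis
    using step_min[of k "X k"] unfolding a b sq inn Phi_d_self[OF v]
    by (simp only: distrib_left)
qed

text \<open>Two estimates of the same quantity.  The first gives the decrease of the merit function in
  every step.  The second has no term in \<open>s\<^sup>2\<close>, so the term \<open>- h \<alpha> s\<^sup>2\<close> of the merit function survives and
  bounds the previous increment at the change indices.\<close>

lemma smoothed_value_step:
  fixes k
  defines "S \<equiv> \<lambda>W. smoothed_objective ft lam v W (\<mu> k)"
    and "t \<equiv> norm (D (Suc k))" and "s \<equiv> norm (D k)" and "w \<equiv> D (Suc k) \<bullet> D k"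
  shows "2 * \<mu> k * (S (X (Suc k)) - S (X k))
      \<le> - h k * t\<^sup>2 + 2 * (h k * \<alpha> k) * w + Lt * (t\<^sup>2 - 2 * \<beta> k * w + (\<beta> k)\<^sup>2 * s\<^sup>2)"
    and "2 * \<mu> k * (S (X (Suc k)) - S (X k))
      \<le> - h k * t\<^sup>2 + 2 * (h k * \<alpha> k) * w + 2 * Lt * \<beta> k * s * t + Lt * t\<^sup>2"
proof -
  let ?F = "\<lambda>W. ft W (\<mu> k)"
  have X': "X (Suc k) = X k + D (Suc k)" by (simp add: D_def)
  have m: "0 < \<mu> k" by (rule mu_pos)
  have prox: "D (Suc k) \<bullet> G k + h k / (2 * \<mu> k) * (t\<^sup>2 - 2 * \<alpha> k * w)
      \<le> lam * Phi v (X k) - lam * Phi v (X (Suc k))"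
    using step_prox_ineq[of k] by (simp add: t_def w_def)
  have n: "(norm (D (Suc k) - \<beta> k *\<^sub>R D k))\<^sup>2 = t\<^sup>2 - 2 * \<beta> k * w + (\<beta> k)\<^sup>2 * s\<^sup>2"
    unfolding t_def s_def w_def power2_norm_eq_inner
    by (simp add: inner_diff_left inner_diff_right inner_commute power2_eq_square)
  have "S (X (Suc k)) - S (X k) \<le> - h k / (2 * \<mu> k) * (t\<^sup>2 - 2 * \<alpha> k * w)
      + Lt / \<mu> k / 2 * (t\<^sup>2 - 2 * \<beta> k * w + (\<beta> k)\<^sup>2 * s\<^sup>2)"
    using extrapolated_descent(1)[OF smooth_at[OF mu_mem], of "X k" "D (Suc k)" k "\<beta> k *\<^sub>R D k"] prox
    unfolding X'[symmetric] G_def[symmetric] n S_def smoothed_objective_def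
    by (simp add: inner_commute)
  from mult_left_mono[OF this, of "2 * \<mu> k"] m
  show "2 * \<mu> k * (S (X (Suc k)) - S (X k))
      \<le> - h k * t\<^sup>2 + 2 * (h k * \<alpha> k) * w + Lt * (t\<^sup>2 - 2 * \<beta> k * w + (\<beta> k)\<^sup>2 * s\<^sup>2)"
    by (simp add: distrib_left algebra_simps)
  have "S (X (Suc k)) - S (X k) \<le> - h k / (2 * \<mu> k) * (t\<^sup>2 - 2 * \<alpha> k * w)
      + (Lt / \<mu> k * (\<beta> k * s) * t + Lt / \<mu> k / 2 * t\<^sup>2)"
    using extrapolated_descent(2)[OF smooth_at[OF mu_mem], of "X k" "D (Suc k)" k "\<beta> k *\<^sub>R D k"] prox param_bounds(3)[of k]
    unfolding X'[symmetric] G_def[symmetric] S_def smoothed_objective_def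
    by (simp add: inner_commute t_def s_def)
  from mult_left_mono[OF this, of "2 * \<mu> k"] m
  show "2 * \<mu> k * (S (X (Suc k)) - S (X k))
      \<le> - h k * t\<^sup>2 + 2 * (h k * \<alpha> k) * w + 2 * Lt * \<beta> k * s * t + Lt * t\<^sup>2"
    by (simp add: distrib_left algebra_simps)
qed

lemma merit_increment:
  assumes m: "\<mu> (Suc k) \<le> m" "m \<le> \<mu> k"
    and Hm: "Hm = H_fun ft lam v \<kappa> (h (Suc k) * \<alpha> (Suc k) / 2) (X (Suc k)) (X k) m (\<mu> k)"
  defines "S \<equiv> \<lambda>W. smoothed_objective ft lam v W (\<mu> k)"
    and "t \<equiv> norm (D (Suc k))" and "s \<equiv> norm (D k)"
  shows "2 * \<mu> k * (Hm - H k) \<le> 2 * \<mu> k * (S (X (Suc k)) - S (X k))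
    + h k * \<alpha> k * (\<mu> k / m) * t\<^sup>2 - h k * \<alpha> k * s\<^sup>2"
proof -
  have m0: "0 < m" "0 < \<mu> k" using m mu_pos[of "Suc k"] mu_pos[of k] by auto
  have "h (Suc k) * \<alpha> (Suc k) \<le> h k * \<alpha> k"
    using param_bounds[of k] param_bounds[of "Suc k"] by (intro mult_mono) auto
  then have "h (Suc k) * \<alpha> (Suc k) / 2 * inverse m * t\<^sup>2 \<le> h k * \<alpha> k / 2 * inverse m * t\<^sup>2"
    using m0 by (intro mult_right_mono) auto
  then have "Hm - H k \<le> S (X (Suc k)) - S (X k)
      + h k * \<alpha> k / 2 * inverse m * t\<^sup>2 - h k * \<alpha> k / 2 * inverse (\<mu> k) * s\<^sup>2"
    using ft_mu_le[of "X k" k]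
    unfolding Hm H_def H_fun_def S_def smoothed_objective_def t_def s_def D_def by simp
  then have "2 * \<mu> k * (Hm - H k) \<le> 2 * \<mu> k * ((S (X (Suc k)) - S (X k))
      + h k * \<alpha> k / 2 * inverse m * t\<^sup>2 - h k * \<alpha> k / 2 * inverse (\<mu> k) * s\<^sup>2)"
    using m0 by (intro mult_left_mono) auto
  also have "\<dots> = 2 * \<mu> k * (S (X (Suc k)) - S (X k)) + h k * \<alpha> k * (\<mu> k / m) * t\<^sup>2 - h k * \<alpha> k * s\<^sup>2"
  proof -
    have "2 * u * (A + c / 2 * inverse m * T - c / 2 * inverse u * Q) = 2 * u * A + c * (u / m) * T - c * Q"
      if "0 < u" for A T Q c u :: real
      using that m0(1) by (simp add: field_simps)
    from this[OF m0(2)] show ?thesis .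
  qed
  finally show ?thesis .
qed

text \<open>The cross term \<open>2 w\<close> is split by \<open>2 w \<le> T + Q\<close>, with the nonnegative weight \<open>h \<alpha> - Lt \<beta>\<close>.  The step-size
  conditions are exactly what makes the remaining coefficient of \<open>T\<close> at most \<open>- h \<epsilon> \<rho>\<close> and that of \<open>Q\<close>
  nonpositive.  The value \<open>m\<close> is either \<open>\<mu> k\<close> (the test) or \<open>\<mu> (Suc k)\<close> (the actual step).\<close>

lemma merit_decrease:
  assumes m: "\<mu> (Suc k) \<le> m" "m \<le> \<mu> k"
    and Hm: "Hm = H_fun ft lam v \<kappa> (h (Suc k) * \<alpha> (Suc k) / 2) (X (Suc k)) (X k) m (\<mu> k)"
  shows "Hm - H k \<le> - (h k * \<epsilon> / (2 * m)) * (norm (D (Suc k)))\<^sup>2"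
proof -
  define T where "T = (norm (D (Suc k)))\<^sup>2"
  define Q where "Q = (norm (D k))\<^sup>2"
  define w where "w = D (Suc k) \<bullet> D k"
  define \<rho> where "\<rho> = \<mu> k / m"
  have m0: "0 < m" "0 < \<mu> k" "0 < \<mu> (Suc k)" using m mu_pos[of "Suc k"] mu_pos[of k] by auto
  have TQ: "0 \<le> T" "0 \<le> Q" by (auto simp: T_def Q_def)
  have "0 \<le> (norm (D (Suc k) - D k))\<^sup>2" by simp
  then have w: "2 * w \<le> T + Q"
    by (simp add: T_def Q_def w_def power2_norm_eq_inner inner_diff_left inner_diff_right inner_commute)
  have "2 * \<mu> k * (Hm - H k) \<le> - h k * T + 2 * (h k * \<alpha> k) * w
      + Lt * (T - 2 * \<beta> k * w + (\<beta> k)\<^sup>2 * Q) + h k * \<alpha> k * \<rho> * T - h k * \<alpha> k * Q"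
    using merit_increment[OF m Hm] smoothed_value_step(1)[of k]
    unfolding T_def Q_def w_def \<rho>_def by linarith
  moreover have "(h k * \<alpha> k - Lt * \<beta> k) * (2 * w) \<le> (h k * \<alpha> k - Lt * \<beta> k) * (T + Q)"
    using param_bounds(8)[of k] by (intro mult_left_mono w) auto
  moreover have "h k * (\<alpha> k + \<epsilon>) * \<rho> * T \<le> (h k * (1 - \<alpha> k) - Lt * (1 - \<beta> k)) * T"
  proof (intro mult_right_mono TQ)
    have "\<rho> \<le> \<mu> k / \<mu> (Suc k)" using m m0 by (simp add: \<rho>_def frac_le)
    then have "h k * (\<alpha> k + \<epsilon>) * \<rho> \<le> h k * (\<alpha> k + \<epsilon>) * (\<mu> k / \<mu> (Suc k))"
      using param_bounds[of k] const_pos by (intro mult_left_mono) auto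
    then show "h k * (\<alpha> k + \<epsilon>) * \<rho> \<le> h k * (1 - \<alpha> k) - Lt * (1 - \<beta> k)"
      using param_bounds(9)[of k] by linarith
  qed
  moreover have "Lt * (\<beta> k)\<^sup>2 * Q \<le> Lt * \<beta> k * Q"
    using param_bounds(3,4)[of k] const_pos TQ by (intro mult_right_mono mult_left_mono)
      (auto simp: power2_eq_square mult_left_le)
  ultimately have "2 * \<mu> k * (Hm - H k) \<le> - h k * \<epsilon> * \<rho> * T"
    by (simp add: algebra_simps)
  also have "\<dots> = 2 * \<mu> k * (- (h k * \<epsilon> / (2 * m)) * T)"
    using m0 by (simp add: \<rho>_def field_simps)
  finally have le: "2 * \<mu> k * (Hm - H k) \<le> 2 * \<mu> k * (- (h k * \<epsilon> / (2 * m)) * T)" .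
  have pos: "0 < 2 * \<mu> k" using m0 by simp
  from le show ?thesis unfolding T_def mult_le_cancel_left_pos[OF pos] .
qed

lemma H_Suc_le: "H (Suc k) \<le> H k - h k * \<epsilon> / (2 * \<mu> (Suc k)) * (norm (D (Suc k)))\<^sup>2"
  using merit_decrease[of k "\<mu> (Suc k)" "H (Suc k)"] mu_Suc_le[of k] by (simp add: H_def)

lemma H_nonneg: "0 \<le> H k"
proof -
  have "0 \<le> phi v (sing_val (X k) i)" if "i \<in> {1..CARD('n)}" for i
    using sing_val_nonneg[OF that, of "X k"] v by (simp add: phi_def)
  then have "0 \<le> lam * Phi v (X k)"
    unfolding Phi_def using lam by (intro mult_nonneg_nonneg sum_nonneg) auto
  moreover have "0 \<le> ft (X k) (\<mu> (k - 1)) + \<kappa> * \<mu> (k - 1)"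
    using ft_near_f[OF mu_mem, of "X k" "k - 1"] f_nonneg[of "X k"] by linarith
  moreover have "0 \<le> h k * \<alpha> k / 2 * inverse (\<mu> k) * (norm (X k - X (k - 1)))\<^sup>2"
    using param_bounds[of k] mu_pos[of k] by (intro mult_nonneg_nonneg) auto
  ultimately show ?thesis unfolding H_def H_fun_def smoothed_objective_def by linarith
qed

lemma summable_steps: "summable (\<lambda>k. (norm (D (Suc k)))\<^sup>2 / \<mu> (Suc k))"
proof (rule bounded_imp_summable)
  show "0 \<le> (norm (D (Suc k)))\<^sup>2 / \<mu> (Suc k)" for k using mu_pos[of "Suc k"] by simp
  have step: "(norm (D (Suc k)))\<^sup>2 / \<mu> (Suc k) \<le> 2 / (Lt * \<epsilon>) * (H k - H (Suc k))" for k
  proof -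
    have p: "0 < Lt * \<epsilon>" "0 < \<mu> (Suc k)" using const_pos mu_pos by auto
    have "Lt * \<epsilon> / 2 * ((norm (D (Suc k)))\<^sup>2 / \<mu> (Suc k)) \<le> h k * \<epsilon> / 2 * ((norm (D (Suc k)))\<^sup>2 / \<mu> (Suc k))"
      using h_lower[of k] const_pos p by (intro mult_right_mono) auto
    also have "\<dots> \<le> H k - H (Suc k)" using H_Suc_le[of k] by simp
    finally show ?thesis using p by (simp add: field_simps)
  qed
  show "(\<Sum>i\<le>k. (norm (D (Suc i)))\<^sup>2 / \<mu> (Suc i)) \<le> 2 / (Lt * \<epsilon>) * H 0" for k
  proof -
    have "(\<Sum>i\<le>k. (norm (D (Suc i)))\<^sup>2 / \<mu> (Suc i)) \<le> (\<Sum>i\<le>k. 2 / (Lt * \<epsilon>) * (H i - H (Suc i)))"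
      by (intro sum_mono step)
    also have "\<dots> = 2 / (Lt * \<epsilon>) * (H 0 - H (Suc k))"
      by (simp only: sum_distrib_left[symmetric] sum_telescope)
    also have "\<dots> \<le> 2 / (Lt * \<epsilon>) * H 0"
      using H_nonneg[of "Suc k"] const_pos by (intro mult_left_mono) auto
    finally show ?thesis .
  qed
qed

definition N :: "nat set" where "N = mu_change_indices \<mu>"
definition CN :: real where "CN = (4 * a + 40 * a / \<epsilon>) / Lt"

lemma CN_pos: "0 < CN" using const_pos by (simp add: CN_def add_pos_pos)

text \<open>When the test fails, the merit function falls by less than \<open>a (\<mu> k)\<^sup>2\<close>.  The decrease estimate then bounds the
  new increment.  Inserting this in the second estimate of \<open>smoothed_value_step\<close> bounds the inertial
  part of the old one; nothing is claimed about \<open>D k\<close> itself, since \<open>\<alpha> k\<close> may be zero.\<close>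

lemma small_steps_at_change:
  assumes k: "k \<in> N"
  shows "(norm (D (Suc k)))\<^sup>2 \<le> CN * (\<mu> k)^3"
    and "(\<alpha> k * norm (D k))\<^sup>2 \<le> CN * (\<mu> k)^3"
proof -
  define t where "t = norm (D (Suc k))"
  define s where "s = norm (D k)"
  define M where "M = a * (\<mu> k)^3"
  have m: "0 < \<mu> k" by (rule mu_pos)
  then have M: "0 \<le> M" using const_pos by (simp add: M_def)
  have L: "0 < Lt" "Lt \<le> h k" "0 < \<epsilon>" "0 < h k" using const_pos h_lower[of k] by auto
  have "\<not> Htest k - H k \<le> - a * (\<mu> k)\<^sup>2"
    using k mu_Suc[of k] by (auto simp: N_def mu_change_indices_def)
  then have fail: "- (a * (\<mu> k)\<^sup>2) < Htest k - H k" by simp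
  have "- (a * (\<mu> k)\<^sup>2) \<le> - (h k * \<epsilon> / (2 * \<mu> k)) * t\<^sup>2"
    using fail merit_decrease[of k "\<mu> k" "Htest k"] mu_Suc_le[of k] by (simp add: Htest_def t_def)
  then have ht: "\<epsilon> * (h k * t\<^sup>2) \<le> 2 * M"
    using m by (simp add: M_def field_simps power2_eq_square power3_eq_cube)
  have "Lt * t\<^sup>2 \<le> h k * t\<^sup>2" using L by (intro mult_right_mono) auto
  moreover have ht': "h k * t\<^sup>2 \<le> 2 * M / \<epsilon>" using ht L by (simp add: field_simps)
  ultimately have Lt: "Lt * t\<^sup>2 \<le> 2 * M / \<epsilon>" by linarith
  have CN: "Lt * (CN * (\<mu> k)^3) = 4 * M + 40 * M / \<epsilon>"
    using L by (simp add: CN_def M_def field_simps)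
  have "Lt * t\<^sup>2 \<le> Lt * (CN * (\<mu> k)^3)"
    unfolding CN using Lt M L by (smt (verit) divide_nonneg_pos divide_right_mono)
  then show "(norm (D (Suc k)))\<^sup>2 \<le> CN * (\<mu> k)^3" using L by (simp add: t_def)
  have "2 * \<mu> k * (- (a * (\<mu> k)\<^sup>2)) \<le> 2 * \<mu> k * (Htest k - H k)"
    using fail m by (intro mult_left_mono) auto
  moreover have "2 * \<mu> k * (Htest k - H k) \<le> - h k * t\<^sup>2 + 2 * (h k * \<alpha> k) * (D (Suc k) \<bullet> D k)
      + 2 * Lt * \<beta> k * s * t + Lt * t\<^sup>2 + h k * \<alpha> k * t\<^sup>2 - h k * \<alpha> k * s\<^sup>2"
    using merit_increment[of k "\<mu> k" "Htest k"] mu_Suc_le[of k] smoothed_value_step(2)[of k] m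
    by (simp add: Htest_def t_def s_def)
  moreover have "2 * (h k * \<alpha> k) * (D (Suc k) \<bullet> D k) \<le> 2 * (h k * \<alpha> k) * (t * s)"
    unfolding t_def s_def using param_bounds[of k] by (intro mult_left_mono norm_cauchy_schwarz) auto
  moreover have "2 * Lt * \<beta> k * s * t \<le> 2 * (h k * \<alpha> k) * (t * s)"
    using mult_right_mono[OF param_bounds(8)[of k], of "2 * (t * s)"] by (simp add: t_def s_def mult_ac)
  moreover have "(h k * \<alpha> k) * (4 * (t * s)) \<le> (h k * \<alpha> k) * (s\<^sup>2 / 2 + 8 * t\<^sup>2)"
  proof (rule mult_left_mono)
    have "0 \<le> (s - 4 * t)\<^sup>2" by simp
    then show "4 * (t * s) \<le> s\<^sup>2 / 2 + 8 * t\<^sup>2" by (simp add: power2_eq_square algebra_simps)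
  qed (use param_bounds[of k] in auto)
  moreover have "h k * \<alpha> k * t\<^sup>2 \<le> h k * t\<^sup>2"
    using param_bounds[of k] alpha_lt_1[of k] by (intro mult_right_mono) (auto simp: mult_left_le)
  moreover have "Lt * t\<^sup>2 \<le> h k * t\<^sup>2" by fact
  moreover have "2 * \<mu> k * (- (a * (\<mu> k)\<^sup>2)) = - 2 * M"
    by (simp add: M_def power2_eq_square power3_eq_cube)
  moreover have "0 \<le> h k * t\<^sup>2" using L by simp
  ultimately have "(h k * \<alpha> k) * s\<^sup>2 \<le> 4 * M + 20 * (h k * t\<^sup>2)"
    by (simp add: algebra_simps)
  then have "(h k * \<alpha> k) * s\<^sup>2 \<le> 4 * M + 40 * M / \<epsilon>" using ht' by simp
  moreover have "Lt * (\<alpha> k * s)\<^sup>2 \<le> (h k * \<alpha> k) * s\<^sup>2"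
  proof -
    have "Lt * (\<alpha> k)\<^sup>2 \<le> h k * \<alpha> k"
      using param_bounds[of k] alpha_lt_1[of k] L by (intro mult_mono) (auto simp: power2_eq_square mult_left_le)
    from mult_right_mono[OF this, of "s\<^sup>2"] show ?thesis by (simp add: power_mult_distrib mult.assoc)
  qed
  ultimately have "Lt * (\<alpha> k * s)\<^sup>2 \<le> Lt * (CN * (\<mu> k)^3)" unfolding CN by linarith
  then show "(\<alpha> k * norm (D k))\<^sup>2 \<le> CN * (\<mu> k)^3" using L by (simp add: s_def)
qed

lemma d_of_one: "i \<in> {1..CARD('n)} \<Longrightarrow> sing_val (X k) i < v \<Longrightarrow> d_of v (X k) i = 1"
  by (simp add: d_of_def)

section \<open>Convergence of the smooth count\<close>

text \<open>Lowering the last nonzero singular value of the new iterate keeps the list sorted, so it is an admissible test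
  direction.  This is why the conclusion speaks of some \<open>p \<ge> q\<close> rather than of \<open>q\<close>: lowering \<open>q\<close> itself
  would break the order if it is tied with its successor.\<close>

lemma surviving_sing_val:
  assumes q: "q \<in> {1..CARD('n)}" "sing_val (X k) q < v" and nz: "sing_val (X (Suc k)) q \<noteq> 0"
  obtains p where "q \<le> p" "p \<in> {1..CARD('n)}" "sing_val (X (Suc k)) p \<noteq> 0"
    "lsv (X (Suc k)) p \<bullet> ((D (Suc k) - \<alpha> k *\<^sub>R D k) *v rsv (X (Suc k)) p) \<le> - gap * \<mu> k / h k"
proof -
  let ?s = "sing_val (X (Suc k))"
  define S where "S = {i \<in> {1..CARD('n)}. ?s i \<noteq> 0}"
  define p where "p = Max S"
  have S: "finite S" "q \<in> S" using q nz by (auto simp: S_def)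
  then have pS: "p \<in> S" and qp: "q \<le> p" by (auto simp: p_def intro: Max_in)
  have p: "p \<in> {1..CARD('n)}" "?s p \<noteq> 0" using pS by (auto simp: S_def)
  have sp: "0 < ?s p" using p sing_val_nonneg[OF p(1), of "X (Suc k)"] by simp
  have zero: "?s i = 0" if "i \<in> {1..CARD('n)}" "p < i" for i
  proof (rule ccontr)
    assume "?s i \<noteq> 0"
    then have "i \<in> S" using that by (simp add: S_def)
    then have "i \<le> p" unfolding p_def by (rule Max_ge[OF S(1)])
    then show False using that by simp
  qed
  define e where "e = (\<lambda>i. if i = p then 1 else 0 :: real)"
  have anti: "antimono_on {1..CARD('n)} (\<lambda>i. ?s i - t * e i)" if t: "0 < t" "t \<le> ?s p" for t
  proof (rule monotone_onI)
    fix i j assume ij: "i \<in> {1..CARD('n)}" "j \<in> {1..CARD('n)}" "i \<le> j"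
    have le: "?s j \<le> ?s i" using ij by (intro sing_val_antimono) auto
    show "?s i - t * e i \<ge> ?s j - t * e j"
    proof (cases "i = p \<and> j \<noteq> p")
      case True
      then show ?thesis using zero[OF ij(2)] ij(3) t by (simp add: e_def)
    next
      case False
      then show ?thesis using le t by (auto simp: e_def)
    qed
  qed
  have "sing_val (X k) p \<le> sing_val (X k) q"
    using qp q p by (intro sing_val_antimono) auto
  then have d: "d_of v (X k) p = 1" using q p by (intro d_of_one) auto
  have "(X (Suc k) - (X k + \<alpha> k *\<^sub>R D k)) \<bullet> dyad_sum (lsv (X (Suc k))) (rsv (X (Suc k))) e
      \<le> - (gap / (h k / \<mu> k)) * (\<Sum>i = 1..CARD('n). e i)"
    unfolding gap_def
  proof (rule prox_step_decrease[OF step_min svd_sv v _ G_bound _ _ sp anti])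
    show "0 < h k / \<mu> k" using param_bounds[of k] mu_pos by simp
    show "e i = 0" if "i \<in> {1..CARD('n)}" "?s i = 0" for i using that p by (auto simp: e_def)
    show "0 \<le> ?s i - t * e i" if "0 < t" "t \<le> ?s p" "i \<in> {1..CARD('n)}" for t i
      using that sing_val_nonneg[OF that(3), of "X (Suc k)"] by (auto simp: e_def)
    show "d_of v (X k) i = 1" if "i \<in> {1..CARD('n)}" "e i \<noteq> 0" for i
      using that d by (auto simp: e_def split: if_splits)
  qed (auto simp: e_def)
  moreover have "(\<Sum>i = 1..CARD('n). e i) = 1" using p by (simp add: e_def)
  moreover have "X (Suc k) - (X k + \<alpha> k *\<^sub>R D k) = D (Suc k) - \<alpha> k *\<^sub>R D k" by (simp add: D_def)
  ultimately have "outer (lsv (X (Suc k)) p) (rsv (X (Suc k)) p) \<bullet> (D (Suc k) - \<alpha> k *\<^sub>R D k)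
      \<le> - gap * \<mu> k / h k"
    unfolding e_def dyad_sum_unit[OF p(1)] by (simp add: inner_commute)
  then show ?thesis using that[OF qp p] by (simp add: inner_outer)
qed

text \<open>For a short step, every singular value of the new iterate in the support of the tent was below \<open>v\<close> before,
  hence is shrunk.  The tent has slope at most \<open>1\<close>, so moving along it with \<open>t \<le> 1\<close> keeps the order.\<close>

lemma tent_step:
  assumes small: "norm (D (Suc k)) < v / 4"
  shows "D (Suc k) \<bullet> sv_map (tent (v / 4)) (X (Suc k))
    \<le> \<alpha> k * (D k \<bullet> sv_map (tent (v / 4)) (X (Suc k)))"
proof -
  let ?s = "sing_val (X (Suc k))" and ?T = "tent (v / 4)"
  define e where "e = (\<lambda>i. ?T (?s i))"
  have d0: "0 < v / 4" using v by simp
  note T = tent_bounds[OF d0]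
  have s0: "0 \<le> ?s i" if "i \<in> {1..CARD('n)}" for i using that by (rule sing_val_nonneg)
  have "(X (Suc k) - (X k + \<alpha> k *\<^sub>R D k)) \<bullet> dyad_sum (lsv (X (Suc k))) (rsv (X (Suc k))) e
      \<le> - ((lam / v - Lf) / (h k / \<mu> k)) * (\<Sum>i = 1..CARD('n). e i)"
  proof (rule prox_step_decrease[OF step_min svd_sv v _ G_bound _ _ zero_less_one])
    show "0 < h k / \<mu> k" using param_bounds[of k] mu_pos by simp
    show "e i = 0" if "i \<in> {1..CARD('n)}" "?s i = 0" for i
      using that T(2)[of 0] v by (simp add: e_def)
    show "0 \<le> e i" for i unfolding e_def by (rule T(1))
    show "antimono_on {1..CARD('n)} (\<lambda>i. ?s i - t * e i)" if t: "0 < t" "t \<le> 1" for t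
    proof (rule monotone_onI)
      fix i j assume ij: "i \<in> {1..CARD('n)}" "j \<in> {1..CARD('n)}" "i \<le> j"
      have le: "?s j \<le> ?s i" using ij by (intro sing_val_antimono) auto
      have "t * (e i - e j) \<le> t * (?s i - ?s j)"
        unfolding e_def using T(5)[OF le] t by (intro mult_left_mono) auto
      also have "\<dots> \<le> 1 * (?s i - ?s j)" using t le by (intro mult_right_mono) auto
      finally show "?s i - t * e i \<ge> ?s j - t * e j" by (simp add: right_diff_distrib)
    qed
    show "0 \<le> ?s i - t * e i" if t: "0 < t" "t \<le> 1" and i: "i \<in> {1..CARD('n)}" for t i
    proof -
      have "t * e i \<le> 1 * ?s i"
        unfolding e_def using t T(1)[of "?s i"] T(4)[OF s0[OF i]] s0[OF i] by (intro mult_mono) auto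
      then show ?thesis by simp
    qed
    show "d_of v (X k) i = 1" if i: "i \<in> {1..CARD('n)}" and e: "e i \<noteq> 0" for i
    proof (rule d_of_one[OF i])
      have "?s i < 3 * (v / 4)" using e T(3)[of "?s i"] by (force simp: e_def)
      moreover have "sing_val (X k) i \<le> ?s i + norm (X k - X (Suc k))"
        by (rule sing_val_le_add_norm[OF i])
      moreover have "norm (X k - X (Suc k)) = norm (D (Suc k))"
        by (simp add: D_def norm_minus_commute)
      ultimately show "sing_val (X k) i < v" using small by linarith
    qed
  qed
  also have "\<dots> \<le> 0"
  proof -
    have "0 \<le> (lam / v - Lf) / (h k / \<mu> k) * (\<Sum>i = 1..CARD('n). e i)"
      using gap_pos param_bounds[of k] mu_pos[of k] T(1)
      by (intro mult_nonneg_nonneg sum_nonneg divide_nonneg_pos) (auto simp: gap_def e_def)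
    then show ?thesis by simp
  qed
  finally have "(X (Suc k) - (X k + \<alpha> k *\<^sub>R D k)) \<bullet> sv_map ?T (X (Suc k)) \<le> 0"
    by (simp add: sv_map_def e_def)
  moreover have "X (Suc k) - (X k + \<alpha> k *\<^sub>R D k) = D (Suc k) - \<alpha> k *\<^sub>R D k" by (simp add: D_def)
  ultimately show ?thesis by (simp add: inner_diff_left)
qed

lemma summable_sq_steps: "summable (\<lambda>k. (norm (D (Suc k)))\<^sup>2)"
proof (rule summable_comparison_test)
  show "summable (\<lambda>k. \<mu> 0 * ((norm (D (Suc k)))\<^sup>2 / \<mu> (Suc k)))"
    by (intro summable_mult summable_steps)
  have "(norm (D (Suc k)))\<^sup>2 \<le> \<mu> 0 * ((norm (D (Suc k)))\<^sup>2 / \<mu> (Suc k))" for k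
  proof -
    have "\<mu> (Suc k) * ((norm (D (Suc k)))\<^sup>2 / \<mu> (Suc k)) \<le> \<mu> 0 * ((norm (D (Suc k)))\<^sup>2 / \<mu> (Suc k))"
      using decseqD[OF mu_decseq, of 0 "Suc k"] mu_pos[of "Suc k"] by (intro mult_right_mono) auto
    then show ?thesis using mu_pos[of "Suc k"] by simp
  qed
  then show "\<exists>N. \<forall>n\<ge>N. norm ((norm (D (Suc n)))\<^sup>2) \<le> \<mu> 0 * ((norm (D (Suc n)))\<^sup>2 / \<mu> (Suc n))"
    by simp
qed

lemma steps_relative_tendsto_0: "(\<lambda>k. (norm (D (Suc k)))\<^sup>2 / \<mu> (Suc k)) \<longlonglongrightarrow> 0"
  by (rule summable_LIMSEQ_zero[OF summable_steps])

lemma steps_tendsto_0: "(\<lambda>k. norm (D (Suc k))) \<longlonglongrightarrow> 0"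
proof -
  have "(\<lambda>k. sqrt ((norm (D (Suc k)))\<^sup>2)) \<longlonglongrightarrow> sqrt 0"
    by (intro tendsto_real_sqrt summable_LIMSEQ_zero[OF summable_sq_steps])
  then show ?thesis by simp
qed

lemma eventually_small_step: "0 < e \<Longrightarrow> \<forall>\<^sub>F k in sequentially. norm (D (Suc k)) < e"
  using order_tendstoD(2)[OF steps_tendsto_0] .

text \<open>With \<open>p k\<close> the derivative of the count along \<open>D k\<close>, \<open>tent_step\<close> says that \<open>p\<close> is damped by \<open>\<alpha> 0\<close> up to the
  Lipschitz error of the gradient, which is quadratic in the increments.\<close>

lemma soft_count_convergent: "convergent (\<lambda>k. soft_count (v / 4) (X k))"
proof -
  have d0: "0 < v / 4" using v by simp
  let ?E = "\<lambda>k. sv_map (tent (v / 4)) (X k)"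
  obtain K where K: "\<And>k. k \<ge> K \<Longrightarrow> norm (D (Suc k)) < v / 4"
    using eventually_small_step[OF d0] by (auto simp: eventually_sequentially)
  define w where "w = (\<lambda>k. 2 * ((norm (D (Suc k)))\<^sup>2 + (norm (D (Suc (Suc k))))\<^sup>2))"
  define p where "p = (\<lambda>k. ?E k \<bullet> D k)"
  have w: "summable w"
    unfolding w_def using summable_sq_steps summable_Suc_iff[of "\<lambda>k. (norm (D (Suc k)))\<^sup>2"]
    by (intro summable_mult summable_add) auto
  have pstep: "p (Suc k) \<le> \<alpha> 0 * max 0 (p k) + 2 * ((norm (D k))\<^sup>2 + (norm (D (Suc k)))\<^sup>2)" if k: "k \<ge> K" for k
  proof -
    have a: "0 \<le> \<alpha> k" "\<alpha> k \<le> 1" "\<alpha> k \<le> \<alpha> 0"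
      using param_bounds(1)[of k] alpha_lt_1[of k] params
      by (auto simp: parameter_constraints_def decseq_def)
    have "(?E (Suc k) - ?E k) \<bullet> D k \<le> norm (?E (Suc k) - ?E k) * norm (D k)"
      by (rule norm_cauchy_schwarz)
    also have "\<dots> \<le> (4 * norm (D (Suc k))) * norm (D k)"
      using sv_map_tent_lipschitz[OF d0, of "X (Suc k)" "X k"] by (intro mult_right_mono) (auto simp: D_def)
    also have "\<dots> \<le> 2 * ((norm (D k))\<^sup>2 + (norm (D (Suc k)))\<^sup>2)"
      using sum_squares_bound[of "norm (D k)" "norm (D (Suc k))"] by (simp add: mult_ac)
    finally have lip: "(?E (Suc k) - ?E k) \<bullet> D k \<le> 2 * ((norm (D k))\<^sup>2 + (norm (D (Suc k)))\<^sup>2)" (is "_ \<le> ?w") .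
    have "p (Suc k) \<le> \<alpha> k * (D k \<bullet> ?E (Suc k))"
      using tent_step[OF K[OF k]] by (simp add: p_def inner_commute)
    also have "D k \<bullet> ?E (Suc k) = p k + (?E (Suc k) - ?E k) \<bullet> D k"
      by (simp add: p_def inner_diff_left inner_diff_right inner_commute)
    also have "\<alpha> k * (p k + (?E (Suc k) - ?E k) \<bullet> D k) \<le> \<alpha> k * (max 0 (p k) + ?w)"
      using lip a by (intro mult_left_mono add_mono) auto
    also have "\<dots> = \<alpha> k * max 0 (p k) + \<alpha> k * ?w" by (rule distrib_left)
    also have "\<dots> \<le> \<alpha> 0 * max 0 (p k) + 1 * ?w"
      using a by (intro add_mono mult_right_mono) auto
    finally show ?thesis by simp
  qed
  have ustep: "soft_count (v / 4) (X (Suc k)) \<le> soft_count (v / 4) (X k) + p (Suc k) + (norm (D (Suc k)))\<^sup>2" for k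
    using soft_count_lower[OF d0, of "X (Suc k)" "X k"]
    by (simp add: p_def D_def norm_minus_commute inner_diff_right)
  \<comment> \<open>the shift by \<open>Suc K\<close> rather than \<open>K\<close> turns \<open>D k\<close> into \<open>D (Suc _)\<close>, as in the summable series\<close>
  have "convergent (\<lambda>k. soft_count (v / 4) (X (k + Suc K)))"
  proof (rule convergent_of_damped_increments[where q = "\<alpha> 0"])
    show "summable (\<lambda>k. w (k + K))" using w by (simp only: summable_iff_shift)
    show "p (Suc k + Suc K) \<le> \<alpha> 0 * max 0 (p (k + Suc K)) + w (k + K)" for k
      using pstep[of "k + Suc K"] by (simp add: w_def)
    show "soft_count (v / 4) (X (Suc k + Suc K)) \<le> soft_count (v / 4) (X (k + Suc K))
        + p (Suc k + Suc K) + w (k + K)" for k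
    proof -
      have "(norm (D (Suc (Suc (k + K)))))\<^sup>2 \<le> w (k + K)" by (simp add: w_def)
      with ustep[of "k + Suc K"] show ?thesis by simp
    qed
  qed (use param_bounds[of 0] alpha_lt_1[of 0] soft_count_nonneg[OF d0] in \<open>auto simp: w_def\<close>)
  then show ?thesis using convergent_ignore_initial_segment by blast
qed

lemma mu_tendsto_0:
  assumes "infinite N"
  shows "\<mu> \<longlonglongrightarrow> 0"
proof (rule order_tendstoI)
  fix e :: real assume e: "0 < e"
  have "filterlim (\<lambda>k. real (k + 1)) at_top sequentially"
    by (rule filterlim_compose[OF filterlim_real_sequentially filterlim_add_const_nat_at_top])
  then have "(\<lambda>k. \<mu> 0 * real (k + 1) powr (- \<sigma>)) \<longlonglongrightarrow> \<mu> 0 * 0"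
    using const_pos(6) by (intro tendsto_mult_left tendsto_neg_powr) auto
  then have "\<forall>\<^sub>F k in sequentially. \<mu> 0 * real (k + 1) powr (- \<sigma>) < e"
    using e by (intro order_tendstoD(2)) auto
  then obtain K where K: "\<And>k. k \<ge> K \<Longrightarrow> \<mu> 0 * real (k + 1) powr (- \<sigma>) < e"
    by (auto simp: eventually_sequentially)
  obtain k where k: "k \<in> N" "k \<ge> K" using assms by (metis infinite_nat_iff_unbounded_le)
  then have "\<mu> (Suc k) = \<mu> 0 / (real (k + 1) powr \<sigma>)"
    using mu_Suc[of k] by (auto simp: N_def mu_change_indices_def)
  also have "\<dots> < e"
    using K[OF k(2)] by (simp add: powr_minus_divide)
  finally have "\<mu> j < e" if "j \<ge> Suc k" for j
    using decseqD[OF mu_decseq that] by simp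
  then show "\<forall>\<^sub>F k in sequentially. \<mu> k < e" by (auto simp: eventually_sequentially)
next
  fix e :: real assume "e < 0"
  then show "\<forall>\<^sub>F k in sequentially. e < \<mu> k" using mu_pos by (intro always_eventually) (meson less_trans)
qed

lemma eventually_mu_less: "infinite N \<Longrightarrow> 0 < e \<Longrightarrow> \<forall>\<^sub>F k in sequentially. \<mu> k < e"
  using order_tendstoD(2)[OF mu_tendsto_0] .

lemma sv_product_bound:
  assumes p: "p \<in> {1..CARD('n)}"
  shows "\<bar>lsv W p \<bullet> (M *v rsv W p)\<bar> \<le> norm (M :: real^'n^'m)"
proof -
  have "\<bar>lsv W p \<bullet> (M *v rsv W p)\<bar> \<le> norm (lsv W p) * (norm M * norm (rsv W p))"
    by (rule abs_inner_matrix_vector_le)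
  also have "\<dots> \<le> 1 * (norm M * 1)"
    using svd_norms[OF svd_sv p, of W] by (intro mult_mono) auto
  finally show ?thesis by simp
qed

section \<open>Identification at the change indices\<close>

text \<open>Survival of a small singular value needs a step of order \<open>\<mu> k\<close>, but at a change index the step is only
  of order \<open>\<mu> k powr (3/2)\<close>.\<close>

lemma eventually_small_sing_vals_vanish:
  assumes inf: "infinite N"
  shows "\<forall>\<^sub>F k in sequentially. k \<in> N \<longrightarrow>
    (\<forall>q\<in>{1..CARD('n)}. sing_val (X k) q < v \<longrightarrow> sing_val (X (Suc k)) q = 0)"
proof -
  \<comment> \<open>below \<open>b\<close>, the bound \<open>4 CN (\<mu> k)^3\<close> on the squared step is smaller than \<open>(gap \<mu> k / h 0)\<^sup>2\<close>\<close>
  define b where "b = (gap / h 0)\<^sup>2 / (4 * CN)"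
  have b: "0 < b" using gap_pos CN_pos param_bounds(5)[of 0] by (simp add: b_def)
  show ?thesis
    using eventually_mu_less[OF inf b]
  proof (rule eventually_mono, intro impI ballI)
    fix k q assume mu: "\<mu> k < b" and k: "k \<in> N" and q: "q \<in> {1..CARD('n)}" "sing_val (X k) q < v"
    show "sing_val (X (Suc k)) q = 0"
    proof (rule ccontr)
      assume nz: "sing_val (X (Suc k)) q \<noteq> 0"
      let ?M = "D (Suc k) - \<alpha> k *\<^sub>R D k"
      obtain p where p: "p \<in> {1..CARD('n)}"
        and le: "lsv (X (Suc k)) p \<bullet> (?M *v rsv (X (Suc k)) p) \<le> - gap * \<mu> k / h k"
        using surviving_sing_val[OF q nz] by metis
      have m: "0 < \<mu> k" by (rule mu_pos)
      have "gap / h 0 * \<mu> k \<le> gap * \<mu> k / h k"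
        using param_bounds(5,7)[of k] gap_pos m by (simp add: frac_le)
      also have "\<dots> \<le> norm ?M" using le sv_product_bound[OF p, of "X (Suc k)" ?M] by linarith
      also have "\<dots> \<le> norm (D (Suc k)) + \<alpha> k * norm (D k)"
        using norm_triangle_ineq4[of "D (Suc k)" "\<alpha> k *\<^sub>R D k"] param_bounds(1)[of k] by simp
      finally have "(gap / h 0 * \<mu> k)\<^sup>2 \<le> (norm (D (Suc k)) + \<alpha> k * norm (D k))\<^sup>2"
        using gap_pos param_bounds(5)[of 0] m by (intro power_mono) auto
      also have "\<dots> \<le> 2 * (norm (D (Suc k)))\<^sup>2 + 2 * (\<alpha> k * norm (D k))\<^sup>2"
        using sum_squares_bound[of "norm (D (Suc k))" "\<alpha> k * norm (D k)"] by (simp add: power2_sum)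
      also have "\<dots> \<le> 4 * (CN * (\<mu> k)^3)" using small_steps_at_change[OF k] by linarith
      finally have "(\<mu> k)\<^sup>2 * (gap / h 0)\<^sup>2 \<le> (\<mu> k)\<^sup>2 * (4 * CN * \<mu> k)"
        by (simp add: power_mult_distrib power2_eq_square power3_eq_cube mult_ac)
      then have "(gap / h 0)\<^sup>2 \<le> 4 * CN * \<mu> k" using m by (simp only: mult_le_cancel_left_pos zero_less_power)
      moreover have "4 * CN * \<mu> k < 4 * CN * b" using mu CN_pos by simp
      moreover have "4 * CN * b = (gap / h 0)\<^sup>2" using CN_pos by (simp add: b_def)
      ultimately show False by simp
    qed
  qed
qed

definition large :: "nat \<Rightarrow> nat" where
  "large k = card {i \<in> {1..CARD('n)}. v \<le> sing_val (X k) i}"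

lemma large_iff: "i \<in> {1..CARD('n)} \<Longrightarrow> v \<le> sing_val (X k) i \<longleftrightarrow> i \<le> large k"
proof -
  have "antimono_on {1..CARD('n)} (sing_val (X k))"
    using svd_sv[of "X k"] unfolding svd_def by blast
  from antimono_superlevel[OF this, of v]
  have eq: "{i \<in> {1..CARD('n)}. v \<le> sing_val (X k) i} = {1..large k}" unfolding large_def .
  assume i: "i \<in> {1..CARD('n)}"
  then have "v \<le> sing_val (X k) i \<longleftrightarrow> i \<in> {i \<in> {1..CARD('n)}. v \<le> sing_val (X k) i}" by simp
  also have "\<dots> \<longleftrightarrow> i \<le> large k" unfolding eq using i by simp
  finally show "v \<le> sing_val (X k) i \<longleftrightarrow> i \<le> large k" .
qed

lemma large_le: "large k \<le> CARD('n)"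
proof -
  have "large k \<le> card {1..CARD('n)}" unfolding large_def by (intro card_mono) auto
  then show ?thesis by simp
qed

lemma d_of_large: "large k = large l \<Longrightarrow> d_of v (X k) = d_of v (X l)"
  unfolding d_of_def by (intro restrict_ext) (metis large_iff not_le)

lemma eventually_soft_count_eq_large:
  assumes inf: "infinite N"
  shows "\<forall>\<^sub>F k in sequentially. k \<in> N \<longrightarrow> soft_count (v / 4) (X k) = (v / 4)\<^sup>2 * large k"
proof -
  have d0: "0 < v / 4" using v by simp
  show ?thesis
    using eventually_small_sing_vals_vanish[OF inf] eventually_small_step[OF d0]
  proof (eventually_elim, intro impI)
    fix k
    assume van: "k \<in> N \<longrightarrow> (\<forall>q\<in>{1..CARD('n)}. sing_val (X k) q < v \<longrightarrow> sing_val (X (Suc k)) q = 0)"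
      and small: "norm (D (Suc k)) < v / 4" and k: "k \<in> N"
    have "ramp (v / 4) (sing_val (X k) i) = (if v \<le> sing_val (X k) i then (v / 4)\<^sup>2 else 0)"
      if i: "i \<in> {1..CARD('n)}" for i
    proof (cases "v \<le> sing_val (X k) i")
      case True
      then show ?thesis using ramp_high[OF d0, of "sing_val (X k) i"] v by simp
    next
      case False
      then have "sing_val (X (Suc k)) i = 0" using van k i by auto
      then have "sing_val (X k) i \<le> norm (X k - X (Suc k))"
        using sing_val_le_add_norm[OF i, of "X k" "X (Suc k)"] by simp
      also have "\<dots> = norm (D (Suc k))" by (simp add: D_def norm_minus_commute)
      finally show ?thesis using small False ramp_low[OF d0] by simp
    qed
    then have "soft_count (v / 4) (X k)
        = (\<Sum>i\<in>{1..CARD('n)}. if v \<le> sing_val (X k) i then (v / 4)\<^sup>2 else 0)"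
      unfolding soft_count_def by (intro sum.cong) auto
    also have "\<dots> = (\<Sum>i\<in>{i \<in> {1..CARD('n)}. v \<le> sing_val (X k) i}. (v / 4)\<^sup>2)"
      by (rule sum.inter_filter[symmetric]) simp
    finally show "soft_count (v / 4) (X k) = (v / 4)\<^sup>2 * large k"
      by (simp add: large_def)
  qed
qed

text \<open>Along \<open>N\<close> the convergent count takes its values in the multiples of \<open>(v / 4)\<^sup>2\<close>, so it is eventually constant
  there.\<close>

lemma large_eventually_constant:
  assumes inf: "infinite N"
  obtains r K where "r \<le> CARD('n)" "\<And>k. k \<in> N \<Longrightarrow> k \<ge> K \<Longrightarrow> large k = r"
    "(\<lambda>k. soft_count (v / 4) (X k)) \<longlonglongrightarrow> (v / 4)\<^sup>2 * r"
proof -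
  let ?u = "\<lambda>k. soft_count (v / 4) (X k)"
  define c where "c = (v / 4)\<^sup>2"
  have c: "0 < c" using v by (simp add: c_def)
  obtain L where L: "?u \<longlonglongrightarrow> L" using soft_count_convergent by (auto simp: convergent_def)
  have "\<forall>\<^sub>F k in sequentially. \<bar>?u k - L\<bar> < c / 2"
    using tendstoD[OF L, of "c / 2"] c by (simp add: dist_real_def)
  with eventually_soft_count_eq_large[OF inf]
  have "\<forall>\<^sub>F k in sequentially. k \<in> N \<longrightarrow> ?u k = c * large k \<and> \<bar>c * large k - L\<bar> < c / 2"
    by eventually_elim (auto simp: c_def)
  then obtain K where K: "\<And>k. k \<ge> K \<Longrightarrow> k \<in> N \<Longrightarrow> ?u k = c * large k \<and> \<bar>c * large k - L\<bar> < c / 2"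
    by (auto simp: eventually_sequentially)
  obtain k0 where k0: "k0 \<in> N" "k0 \<ge> K" using inf by (metis infinite_nat_iff_unbounded_le)
  define r where "r = large k0"
  have eq: "large k = r" if k: "k \<in> N" "k \<ge> K" for k
  proof -
    have "\<bar>c * large k - c * r\<bar> < c" using K[OF k(2,1)] K[OF k0(2,1)] unfolding r_def by linarith
    also have "\<bar>c * large k - c * r\<bar> = c * \<bar>real (large k) - real r\<bar>"
      using c by (simp add: right_diff_distrib[symmetric] abs_mult)
    finally have "\<bar>real (large k) - real r\<bar> < 1" using c by simp
    then show ?thesis by linarith
  qed
  have "L = c * r"
  proof (rule ccontr)
    assume "L \<noteq> c * r"
    then obtain K' where K': "\<And>k. k \<ge> K' \<Longrightarrow> ?u k \<noteq> c * r"
      using tendsto_imp_eventually_ne[OF L] by (auto simp: eventually_sequentially)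
    obtain k where "k \<in> N" "k \<ge> max K K'" using inf by (metis infinite_nat_iff_unbounded_le)
    then show False using K[of k] K'[of k] eq[of k] by simp
  qed
  then show ?thesis using that[of r K] eq L large_le[of k0] by (simp add: c_def r_def)
qed

text \<open>Each singular value contributes at most \<open>(v / 4)\<^sup>2\<close> to the count, and nothing below \<open>v / 4\<close>; a limit of
  \<open>r\<close> units needs \<open>r\<close> contributors.\<close>

lemma eventually_top_sing_vals:
  assumes lim: "(\<lambda>k. soft_count (v / 4) (X k)) \<longlonglongrightarrow> (v / 4)\<^sup>2 * r" and r: "r \<le> CARD('n)"
  shows "\<forall>\<^sub>F k in sequentially. \<forall>i\<in>{1..r}. v / 4 \<le> sing_val (X k) i"
proof -
  define c where "c = (v / 4)\<^sup>2"
  have d0: "0 < v / 4" and c: "0 < c" using v by (simp_all add: c_def)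
  have "c * (real r - 1) < c * r" using c by simp
  then have ev: "\<forall>\<^sub>F k in sequentially. c * (real r - 1) < soft_count (v / 4) (X k)"
    using order_tendstoD(1)[OF lim] by (simp add: c_def)
  show ?thesis
  proof (rule eventually_mono[OF ev], intro ballI, rule ccontr)
    fix k i assume gt: "c * (real r - 1) < soft_count (v / 4) (X k)" and i: "i \<in> {1..r}"
      and "\<not> v / 4 \<le> sing_val (X k) i"
    then have low: "sing_val (X k) i \<le> v / 4" by simp
    have "soft_count (v / 4) (X k) \<le> (\<Sum>j = 1..CARD('n). if j < i then c else 0)"
      unfolding soft_count_def
    proof (rule sum_mono)
      fix j assume j: "j \<in> {1..CARD('n)}"
      show "ramp (v / 4) (sing_val (X k) j) \<le> (if j < i then c else 0)"
      proof (cases "j < i")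
        case False
        then have "sing_val (X k) j \<le> sing_val (X k) i" using i j by (intro sing_val_antimono) auto
        then show ?thesis using False low ramp_low[OF d0] by simp
      qed (use ramp_range[OF d0] in \<open>simp add: c_def\<close>)
    qed
    also have "\<dots> = (\<Sum>j\<in>{j \<in> {1..CARD('n)}. j < i}. c)"
      by (rule sum.inter_filter[symmetric]) simp
    also have "{j \<in> {1..CARD('n)}. j < i} = {1..<i}" using i r by auto
    also have "(\<Sum>j\<in>{1..<i}. c) = c * (real i - 1)" using i by (simp add: of_nat_diff mult.commute)
    also have "\<dots> \<le> c * (real r - 1)" using i c by simp
    finally show False using gt by simp
  qed
qed

text \<open>Test the step against the singular vectors \<open>U\<^sub>p, V\<^sub>p\<close> of a surviving \<open>p > r\<close>.  The displacement from the extrapolated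
  point is \<open>X (Suc k) - (1 + \<alpha>) X k + \<alpha> X (k - 1)\<close>; the first term contributes a nonnegative amount, the
  others only the amounts bounded by \<open>quad\<close> and \<open>mom\<close>, so the required negative displacement of order
  \<open>\<mu> k\<close> is impossible.\<close>

lemma low_rank_step:
  assumes r: "\<And>i. i \<in> {1..r} \<Longrightarrow> v / 4 \<le> sing_val (X (Suc k)) i"
    and low: "\<And>i. i \<in> {r<..CARD('n)} \<Longrightarrow> sing_val (X k) i = 0"
    and close: "norm (D (Suc k)) \<le> v / 8"
    and quad: "16 / v * (norm (D (Suc k)))\<^sup>2 < gap / h 0 * \<mu> k / 2"
    and mom: "\<And>p. p \<in> {r<..CARD('n)} \<Longrightarrow> sing_val (X (Suc k)) p \<noteq> 0 \<Longrightarrow>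
      \<bar>lsv (X (Suc k)) p \<bullet> (X (k - 1) *v rsv (X (Suc k)) p)\<bar> \<le> gap / h 0 * \<mu> k / 2"
    and q: "q \<in> {r<..CARD('n)}"
  shows "sing_val (X (Suc k)) q = 0"
proof (rule ccontr)
  assume nz: "sing_val (X (Suc k)) q \<noteq> 0"
  have q': "q \<in> {1..CARD('n)}" "sing_val (X k) q < v" using q low v by auto
  let ?M = "D (Suc k) - \<alpha> k *\<^sub>R D k"
  obtain p where p: "q \<le> p" "p \<in> {1..CARD('n)}" "sing_val (X (Suc k)) p \<noteq> 0"
    and le: "lsv (X (Suc k)) p \<bullet> (?M *v rsv (X (Suc k)) p) \<le> - gap * \<mu> k / h k"
    using surviving_sing_val[OF q' nz] by metis
  define B where "B = (\<lambda>M. lsv (X (Suc k)) p \<bullet> (M *v rsv (X (Suc k)) p))"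
  have v4: "0 < v / 4" using v by simp
  have pr: "r < p" "p \<le> CARD('n)" using p q by auto
  have 1: "\<bar>B (X k)\<bar> \<le> 8 / v * (norm (D (Suc k)))\<^sup>2"
    using low_rank_second_order[OF svd_sv v4 r low _ pr p(3)] close
    by (simp add: B_def D_def norm_minus_commute)
  have 2: "\<bar>B (X (k - 1))\<bar> \<le> gap / h 0 * \<mu> k / 2"
    unfolding B_def using pr p(3) by (intro mom) auto
  have 3: "B (X (Suc k)) = sing_val (X (Suc k)) p"
  proof -
    have "X (Suc k) *v rsv (X (Suc k)) p = sing_val (X (Suc k)) p *\<^sub>R lsv (X (Suc k)) p"
      using dyad_sum_mult_right_vector[OF svd_sv p(2), of "X (Suc k)" "sing_val (X (Suc k))"] svd_sv[of "X (Suc k)"]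
      unfolding svd_def by metis
    then show ?thesis
      using svd_norms(3)[OF svd_sv p(2) p(3)] by (simp add: B_def norm_eq_1)
  qed
  have s0: "0 \<le> sing_val (X (Suc k)) p" using p(2) by (rule sing_val_nonneg)
  have a: "0 \<le> \<alpha> k" "\<alpha> k < 1" using param_bounds(1) alpha_lt_1 by auto
  have "?M = X (Suc k) - (1 + \<alpha> k) *\<^sub>R X k + \<alpha> k *\<^sub>R X (k - 1)"
    by (simp add: D_def algebra_simps)
  then have "B ?M = B (X (Suc k)) - (1 + \<alpha> k) * B (X k) + \<alpha> k * B (X (k - 1))"
    by (simp only: B_def matrix_vector_mult_add_rdistrib matrix_vector_mult_diff_rdistrib
        scaleR_matrix_vector_assoc[symmetric] inner_add_right inner_diff_right inner_scaleR_right)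
  moreover have "(1 + \<alpha> k) * B (X k) \<le> 2 * (8 / v * (norm (D (Suc k)))\<^sup>2)"
  proof -
    have "(1 + \<alpha> k) * B (X k) \<le> (1 + \<alpha> k) * \<bar>B (X k)\<bar>" using a by (intro mult_left_mono) auto
    also have "\<dots> \<le> 2 * (8 / v * (norm (D (Suc k)))\<^sup>2)" using 1 a by (intro mult_mono) auto
    finally show ?thesis .
  qed
  moreover have "- (\<alpha> k * B (X (k - 1))) \<le> 1 * (gap / h 0 * \<mu> k / 2)"
  proof -
    have "- (\<alpha> k * B (X (k - 1))) \<le> \<alpha> k * \<bar>B (X (k - 1))\<bar>"
      using mult_left_mono[OF _ a(1), of "- B (X (k - 1))" "\<bar>B (X (k - 1))\<bar>"] by simp
    also have "\<dots> \<le> 1 * (gap / h 0 * \<mu> k / 2)" using 2 a by (intro mult_mono) auto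
    finally show ?thesis .
  qed
  ultimately have "- (gap / h 0 * \<mu> k) < B ?M" using 3 s0 quad by (simp add: field_simps)
  moreover have "gap / h 0 * \<mu> k \<le> gap * \<mu> k / h k"
    using param_bounds(5,7)[of k] gap_pos mu_pos[of k] by (simp add: frac_le)
  ultimately show False using le by (simp add: B_def)
qed

text \<open>At a large change index \<open>k0\<close> the iterate \<open>k0 + 1\<close> has rank at most \<open>r\<close>.  The next one has too, since there the
  previous increment is \<open>o(\<mu>)\<close> (\<open>start\<close>).  From two consecutive iterates of rank at most \<open>r\<close> the property
  propagates (\<open>persist\<close>), since both are within \<open>o(\<mu> powr (1/2))\<close> of the new iterate and the deviation
  is quadratic.\<close>

lemma eventually_low_rank:
  assumes inf: "infinite N" and r: "r \<le> CARD('n)"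
    and const: "\<And>k. k \<in> N \<Longrightarrow> k \<ge> K \<Longrightarrow> large k = r"
    and lim: "(\<lambda>k. soft_count (v / 4) (X k)) \<longlonglongrightarrow> (v / 4)\<^sup>2 * r"
  shows "\<forall>\<^sub>F k in sequentially. \<forall>i\<in>{r<..CARD('n)}. sing_val (X k) i = 0"
proof -
  define c where "c = gap / h 0"
  have c: "0 < c" using gap_pos param_bounds(5)[of 0] by (simp add: c_def)
  \<comment> \<open>\<open>e\<close>: the quadratic error \<open>8/v (t + s)\<^sup>2 \<le> 8/v * 4 e \<mu>\<close> of the older iterate is then \<open>c \<mu> / 2\<close>;
    \<open>b\<close>: the increment at a change index is then at most \<open>c/4\<close> times the next, smaller \<open>\<mu>\<close>\<close>
  define e where "e = c * v / 64"
  have e: "0 < e" using c v by (simp add: e_def)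
  define b where "b = (c * \<epsilon> / 4)\<^sup>2 / CN"
  have b: "0 < b" using c const_pos CN_pos by (simp add: b_def)
  have v16: "0 < v / 16" using v by simp
  have ev: "\<forall>\<^sub>F k in sequentially. (\<forall>i\<in>{1..r}. v / 4 \<le> sing_val (X k) i)
      \<and> norm (D (Suc k)) < v / 16 \<and> (norm (D (Suc k)))\<^sup>2 / \<mu> (Suc k) < e \<and> \<mu> k < b
      \<and> (k \<in> N \<longrightarrow> (\<forall>q\<in>{1..CARD('n)}. sing_val (X k) q < v \<longrightarrow> sing_val (X (Suc k)) q = 0))"
    using eventually_top_sing_vals[OF lim r] eventually_small_step[OF v16]
      order_tendstoD(2)[OF steps_relative_tendsto_0 e] eventually_mu_less[OF inf b]
      eventually_small_sing_vals_vanish[OF inf]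
    by eventually_elim blast
  then obtain J where J: "\<And>k. k \<ge> J \<Longrightarrow> (\<forall>i\<in>{1..r}. v / 4 \<le> sing_val (X k) i)
      \<and> norm (D (Suc k)) < v / 16 \<and> (norm (D (Suc k)))\<^sup>2 / \<mu> (Suc k) < e \<and> \<mu> k < b
      \<and> (k \<in> N \<longrightarrow> (\<forall>q\<in>{1..CARD('n)}. sing_val (X k) q < v \<longrightarrow> sing_val (X (Suc k)) q = 0))"
    by (auto simp: eventually_sequentially)
  have sq: "(norm (D (Suc k)))\<^sup>2 < e * \<mu> (Suc k)" if "k \<ge> J" for k
    using J[OF that] mu_pos[of "Suc k"] by (simp add: divide_less_eq)
  have sq': "(norm (D (Suc k)))\<^sup>2 < e * \<mu> k" if "k \<ge> J" for k
    using sq[OF that] mult_left_mono[OF mu_Suc_le[of k], of e] e by linarith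
  have quad: "16 / v * (norm (D (Suc k)))\<^sup>2 < c * \<mu> k / 2" if "k \<ge> J" for k
  proof -
    have "16 / v * (norm (D (Suc k)))\<^sup>2 < 16 / v * (e * \<mu> k)"
      using sq'[OF that] v by (intro mult_strict_left_mono) auto
    also have "\<dots> = c * \<mu> k / 4" using v by (simp add: e_def)
    finally show ?thesis using mult_pos_pos[OF c mu_pos[of k]] by linarith
  qed
  have v4: "0 < v / 4" using v by simp
  have second: "\<bar>lsv (X k) p \<bullet> (Y *v rsv (X k) p)\<bar> \<le> 8 / v * (norm (Y - X k))\<^sup>2"
    if "k \<ge> J" "\<And>i. i \<in> {r<..CARD('n)} \<Longrightarrow> sing_val Y i = 0" "norm (Y - X k) \<le> v / 8"
      "p \<in> {r<..CARD('n)}" "sing_val (X k) p \<noteq> 0" for k p Y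
    using low_rank_second_order[OF svd_sv v4, of r "X k" Y p] J[OF that(1)] that by simp
  have start: "sing_val (X (Suc (Suc k))) i = 0" if k: "k \<in> N" "k \<ge> J" "k \<ge> K"
    and low: "\<And>i. i \<in> {r<..CARD('n)} \<Longrightarrow> sing_val (X (Suc k)) i = 0"
    and i: "i \<in> {r<..CARD('n)}" for k i
  proof (rule low_rank_step[OF _ low _ _ _ i])
    have k1: "Suc k \<ge> J" "Suc (Suc k) \<ge> J" using k by auto
    show "v / 4 \<le> sing_val (X (Suc (Suc k))) i" if "i \<in> {1..r}" for i using J[OF k1(2)] that by blast
    show close: "norm (D (Suc (Suc k))) \<le> v / 8" using J[OF k1(1)] v by simp
    show "16 / v * (norm (D (Suc (Suc k))))\<^sup>2 < gap / h 0 * \<mu> (Suc k) / 2"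
      using quad[OF k1(1)] by (simp add: c_def)
    fix p assume p: "p \<in> {r<..CARD('n)}" "sing_val (X (Suc (Suc k))) p \<noteq> 0"
    let ?B = "\<lambda>M. lsv (X (Suc (Suc k))) p \<bullet> (M *v rsv (X (Suc (Suc k))) p)"
    have D: "X (Suc k) - X (Suc (Suc k)) = - D (Suc (Suc k))" "X k = X (Suc k) - D (Suc k)"
      by (simp_all add: D_def)
    have "\<bar>?B (X (Suc k))\<bar> \<le> 8 / v * (norm (D (Suc (Suc k))))\<^sup>2"
      using second[OF k1(2) low _ p] close unfolding D by simp
    also have "\<dots> \<le> c * \<mu> (Suc k) / 4" using quad[OF k1(1)] by (simp add: field_simps)
    finally have 1: "\<bar>?B (X (Suc k))\<bar> \<le> c * \<mu> (Suc k) / 4" .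
    have "(norm (D (Suc k)))\<^sup>2 \<le> CN * (\<mu> k)^3" by (rule small_steps_at_change(1)[OF k(1)])
    also have "\<dots> = (CN * \<mu> k) * (\<mu> k)\<^sup>2" by (simp add: power2_eq_square power3_eq_cube)
    also have "\<dots> \<le> (c * \<epsilon> / 4)\<^sup>2 * (\<mu> k)\<^sup>2"
    proof (rule mult_right_mono)
      show "CN * \<mu> k \<le> (c * \<epsilon> / 4)\<^sup>2" using J[OF k(2)] CN_pos by (simp add: b_def field_simps)
    qed simp
    also have "\<dots> = (c / 4 * (\<epsilon> * \<mu> k))\<^sup>2" by (simp add: power_mult_distrib power_divide)
    finally have "norm (D (Suc k)) \<le> c / 4 * (\<epsilon> * \<mu> k)"
      by (rule power2_le_imp_le) (use c const_pos mu_pos[of k] in simp)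
    also have "\<dots> \<le> c / 4 * \<mu> (Suc k)" using mu_ratio(2)[of k] c by (intro mult_left_mono) auto
    finally have 2: "norm (D (Suc k)) \<le> c * \<mu> (Suc k) / 4" by simp
    have "?B (X k) = ?B (X (Suc k)) - ?B (D (Suc k))"
      unfolding D(2) by (simp add: matrix_vector_mult_diff_rdistrib inner_diff_right)
    moreover have "\<bar>?B (D (Suc k))\<bar> \<le> norm (D (Suc k))"
      using p by (intro sv_product_bound) auto
    ultimately show "\<bar>lsv (X (Suc (Suc k))) p \<bullet> (X (Suc k - 1) *v rsv (X (Suc (Suc k))) p)\<bar>
        \<le> gap / h 0 * \<mu> (Suc k) / 2"
      unfolding c_def[symmetric] diff_Suc_1 using 1 2 by linarith
  qed
  have persist: "sing_val (X (Suc (Suc k))) i = 0" if k: "k \<ge> J"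
    and low: "\<And>i. i \<in> {r<..CARD('n)} \<Longrightarrow> sing_val (X k) i = 0"
      "\<And>i. i \<in> {r<..CARD('n)} \<Longrightarrow> sing_val (X (Suc k)) i = 0"
    and i: "i \<in> {r<..CARD('n)}" for k i
  proof (rule low_rank_step[OF _ low(2) _ _ _ i])
    have k1: "Suc k \<ge> J" "Suc (Suc k) \<ge> J" using k by auto
    show "v / 4 \<le> sing_val (X (Suc (Suc k))) i" if "i \<in> {1..r}" for i using J[OF k1(2)] that by blast
    show "norm (D (Suc (Suc k))) \<le> v / 8" using J[OF k1(1)] v by simp
    show "16 / v * (norm (D (Suc (Suc k))))\<^sup>2 < gap / h 0 * \<mu> (Suc k) / 2"
      using quad[OF k1(1)] by (simp add: c_def)
    fix p assume p: "p \<in> {r<..CARD('n)}" "sing_val (X (Suc (Suc k))) p \<noteq> 0"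
    define t s where "t = norm (D (Suc (Suc k)))" and "s = norm (D (Suc k))"
    have D: "X k - X (Suc (Suc k)) = - (D (Suc (Suc k)) + D (Suc k))"
      by (simp add: D_def)
    have tri: "norm (X k - X (Suc (Suc k))) \<le> t + s"
      unfolding D norm_minus_cancel t_def s_def by (rule norm_triangle_ineq)
    have "t < v / 16" "s < v / 16" using J[OF k1(1)] J[OF k] by (auto simp: t_def s_def)
    then have close: "norm (X k - X (Suc (Suc k))) \<le> v / 8" using tri by linarith
    have "\<bar>lsv (X (Suc (Suc k))) p \<bullet> (X k *v rsv (X (Suc (Suc k))) p)\<bar>
        \<le> 8 / v * (norm (X k - X (Suc (Suc k))))\<^sup>2"
      using second[OF k1(2) low(1) close p] .
    also have "\<dots> \<le> 8 / v * (t + s)\<^sup>2"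
      using v tri by (intro mult_left_mono power_mono) auto
    also have "\<dots> \<le> 8 / v * (2 * t\<^sup>2 + 2 * s\<^sup>2)"
      using v sum_squares_bound[of t s] by (intro mult_left_mono) (auto simp: power2_sum)
    also have "\<dots> \<le> 8 / v * (4 * (e * \<mu> (Suc k)))"
      using v sq[OF k] sq'[OF k1(1)] by (intro mult_left_mono) (auto simp: t_def s_def)
    also have "\<dots> = c * \<mu> (Suc k) / 2" using v by (simp add: e_def)
    finally show "\<bar>lsv (X (Suc (Suc k))) p \<bullet> (X (Suc k - 1) *v rsv (X (Suc (Suc k))) p)\<bar>
        \<le> gap / h 0 * \<mu> (Suc k) / 2" by (simp add: c_def)
  qed
  obtain k0 where k0: "k0 \<in> N" "k0 \<ge> max J K" using inf by (metis infinite_nat_iff_unbounded_le)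
  have low1: "sing_val (X (Suc k0)) i = 0" if "i \<in> {r<..CARD('n)}" for i
  proof -
    have i: "i \<in> {1..CARD('n)}" using that by auto
    have "\<not> v \<le> sing_val (X k0) i" using large_iff[OF i, of k0] const[of k0] k0 that by auto
    then show ?thesis using J[of k0] k0 i by auto
  qed
  have low2: "sing_val (X (Suc (Suc k0))) i = 0" if "i \<in> {r<..CARD('n)}" for i
    using start[OF k0(1) _ _ low1 that] k0(2) by simp
  have "(\<forall>i\<in>{r<..CARD('n)}. sing_val (X (Suc k0 + j)) i = 0) \<and>
      (\<forall>i\<in>{r<..CARD('n)}. sing_val (X (Suc (Suc k0 + j))) i = 0)" for j
  proof (induction j)
    case 0
    then show ?case using low1 low2 by simp
  next
    case (Suc j)
    then show ?case using persist[of "Suc k0 + j"] k0(2) by simp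
  qed
  then have "\<forall>i\<in>{r<..CARD('n)}. sing_val (X k) i = 0" if "k \<ge> Suc k0" for k
    using that by (metis le_add_diff_inverse)
  then show ?thesis by (auto simp: eventually_sequentially)
qed

lemma eventual_sing_vals_at_changes:
  assumes inf: "infinite N"
  shows "\<exists>r K. r \<le> CARD('n) \<and> (\<forall>k\<in>N. K \<le> k \<longrightarrow> large k = r \<and>
    (\<forall>i\<in>{1..r}. v \<le> sing_val (X k) i) \<and> (\<forall>i\<in>{r<..CARD('n)}. sing_val (X k) i = 0))"
proof -
  obtain r K where r: "r \<le> CARD('n)" "\<And>k. k \<in> N \<Longrightarrow> k \<ge> K \<Longrightarrow> large k = r"
    "(\<lambda>k. soft_count (v / 4) (X k)) \<longlonglongrightarrow> (v / 4)\<^sup>2 * r"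
    using large_eventually_constant[OF inf] by metis
  obtain K' where K': "\<And>k. k \<ge> K' \<Longrightarrow> \<forall>i\<in>{r<..CARD('n)}. sing_val (X k) i = 0"
    using eventually_low_rank[OF inf r] by (auto simp: eventually_sequentially)
  have "v \<le> sing_val (X k) i" if "k \<in> N" "k \<ge> K" "i \<in> {1..r}" for k i
    using large_iff[of i k] r(2)[of k] that r(1) by auto
  then show ?thesis
    using r(1,2) K' by (intro exI[of _ r] exI[of _ "max K K'"]) auto
qed

lemma limit_along_changes:
  assumes r: "r \<le> CARD('n)"
    and at: "\<forall>k\<in>N. K \<le> k \<longrightarrow> large k = r \<and>
      (\<forall>i\<in>{1..r}. v \<le> sing_val (X k) i) \<and> (\<forall>i\<in>{r<..CARD('n)}. sing_val (X k) i = 0)"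
    and s: "strict_mono s" "range s \<subseteq> N" and lim: "(\<lambda>i. X (s i)) \<longlonglongrightarrow> Xbar"
  shows "sv_cosupport Xbar = {r<..CARD('n)}" "\<And>j. j \<in> {r<..CARD('n)} \<Longrightarrow> sing_val Xbar j = 0"
proof -
  have big: "v \<le> sing_val (X k) i" if "k \<in> N" "k \<ge> K" "i \<in> {1..r}" for k i
    using at that by blast
  have zero: "sing_val (X k) i = 0" if "k \<in> N" "k \<ge> K" "i \<in> {r<..CARD('n)}" for k i
    using at that by blast
  have sK: "s i \<in> N" "i \<ge> K \<Longrightarrow> s i \<ge> K" for i
    using s seq_suble[OF s(1), of i] by auto
  have conv: "(\<lambda>i. sing_val (X (s i)) j) \<longlonglongrightarrow> sing_val Xbar j" if j: "j \<in> {1..CARD('n)}" for j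
  proof -
    have "(\<lambda>i. norm (X (s i) - Xbar)) \<longlonglongrightarrow> 0"
      using lim by (simp add: LIM_zero tendsto_norm_zero)
    then have "(\<lambda>i. sing_val (X (s i)) j - sing_val Xbar j) \<longlonglongrightarrow> 0"
      by (rule Lim_null_comparison[rotated]) (simp add: sing_val_lipschitz[OF j])
    then show ?thesis by (rule LIM_zero_cancel)
  qed
  have z: "sing_val Xbar j = 0" if j: "j \<in> {r<..CARD('n)}" for j
  proof (rule LIMSEQ_unique)
    show "(\<lambda>i. sing_val (X (s i)) j) \<longlonglongrightarrow> sing_val Xbar j" using j by (intro conv) auto
    have "\<forall>\<^sub>F i in sequentially. sing_val (X (s i)) j = 0"
      using sK zero[OF _ _ j] by (auto simp: eventually_sequentially)
    then show "(\<lambda>i. sing_val (X (s i)) j) \<longlonglongrightarrow> 0" by (rule tendsto_eventually)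
  qed
  have nz: "v \<le> sing_val Xbar j" if j: "j \<in> {1..r}" for j
  proof (rule tendsto_lowerbound)
    show "(\<lambda>i. sing_val (X (s i)) j) \<longlonglongrightarrow> sing_val Xbar j" using j r by (intro conv) auto
    show "\<forall>\<^sub>F i in sequentially. v \<le> sing_val (X (s i)) j"
      using sK big[OF _ _ j] by (auto simp: eventually_sequentially)
  qed simp
  show "sv_cosupport Xbar = {r<..CARD('n)}"
  proof (rule set_eqI)
    fix j
    have "j \<in> sv_cosupport Xbar \<longleftrightarrow> j \<in> {1..CARD('n)} \<and> sing_val Xbar j = 0"
      by (auto simp: sv_cosupport_def sv_support_def)
    also have "\<dots> \<longleftrightarrow> j \<in> {r<..CARD('n)}"
    proof (cases "j \<le> r")
      case True
      then have "j \<in> {1..CARD('n)} \<Longrightarrow> sing_val Xbar j \<noteq> 0" using nz[of j] v by auto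
      then show ?thesis using True by auto
    next
      case False
      then show ?thesis using z[of j] by auto
    qed
    finally show "j \<in> sv_cosupport Xbar \<longleftrightarrow> j \<in> {r<..CARD('n)}" .
  qed
  show "\<And>j. j \<in> {r<..CARD('n)} \<Longrightarrow> sing_val Xbar j = 0" by (rule z)
qed

lemma change_index_identification:
  "changes_finitely_often_along N (\<lambda>k. d_of v (X k)) \<and>
    (\<forall>Xbar Xstar. accumulation_point_along N X Xbar \<and> accumulation_point_along N X Xstar
                  \<longrightarrow> sv_cosupport Xbar = sv_cosupport Xstar) \<and>
    (\<forall>Xbar s. strict_mono s \<and> range s \<subseteq> N \<and> (\<lambda>i. X (s i)) \<longlonglongrightarrow> Xbar
                  \<longrightarrow> (\<exists>J. \<forall>i\<ge>J.
                        L2_set (\<lambda>j. sing_val (X (s i)) j - sing_val Xbar j) (sv_cosupport Xbar) = 0))"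
proof (cases "finite N")
  case True
  have no: False if "strict_mono s" "range s \<subseteq> N" for s :: "nat \<Rightarrow> nat"
  proof -
    have "finite (range s)" using that(2) True by (rule finite_subset)
    then show False using finite_imageD strict_mono_imp_inj_on[OF that(1)] infinite_UNIV_nat by blast
  qed
  have "changes_finitely_often_along N (\<lambda>k. d_of v (X k))"
    unfolding changes_finitely_often_along_def by (rule finite_subset[OF _ True]) auto
  then show ?thesis
    using no unfolding accumulation_point_along_def by blast
next
  case False
  obtain r K where r: "r \<le> CARD('n)"
    and at: "\<forall>k\<in>N. K \<le> k \<longrightarrow> large k = r \<and>
      (\<forall>i\<in>{1..r}. v \<le> sing_val (X k) i) \<and> (\<forall>i\<in>{r<..CARD('n)}. sing_val (X k) i = 0)"
    using eventual_sing_vals_at_changes[OF False] by blast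
  have zero: "sing_val (X k) i = 0" if "k \<in> N" "k \<ge> K" "i \<in> {r<..CARD('n)}" for k i
    using at that by blast
  have const: "large k = r" if "k \<in> N" "k \<ge> K" for k
    using at that by blast
  note lim = limit_along_changes[OF r at]
  show ?thesis
  proof (intro conjI allI impI)
    have "k < K" if "k \<in> N" "l \<in> N" "k < l" "d_of v (X l) \<noteq> d_of v (X k)" for k l
    proof (rule ccontr)
      assume "\<not> k < K"
      then have "large k = r" "large l = r" using that by (auto intro!: const)
      then show False using d_of_large[of l k] that by simp
    qed
    then have "{k \<in> N. \<exists>l\<in>N. k < l \<and> (\<forall>j\<in>N. \<not> (k < j \<and> j < l)) \<and>
        d_of v (X l) \<noteq> d_of v (X k)} \<subseteq> {..<K}" by blast
    then show "changes_finitely_often_along N (\<lambda>k. d_of v (X k))"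
      unfolding changes_finitely_often_along_def by (rule finite_subset) simp
  next
    fix Xbar Xstar
    assume "accumulation_point_along N X Xbar \<and> accumulation_point_along N X Xstar"
    then have "sv_cosupport Xbar = {r<..CARD('n)}" "sv_cosupport Xstar = {r<..CARD('n)}"
      unfolding accumulation_point_along_def using lim(1) by auto
    then show "sv_cosupport Xbar = sv_cosupport Xstar" by simp
  next
    fix Xbar s
    assume s: "strict_mono s \<and> range s \<subseteq> N \<and> (\<lambda>i. X (s i)) \<longlonglongrightarrow> Xbar"
    then have s': "strict_mono s" "range s \<subseteq> N" "(\<lambda>i. X (s i)) \<longlonglongrightarrow> Xbar" by auto
    have "L2_set (\<lambda>j. sing_val (X (s i)) j - sing_val Xbar j) (sv_cosupport Xbar) = 0" if i: "i \<ge> K" for i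
    proof -
      have "s i \<ge> K" using i seq_suble[of s] s by (meson order_trans)
      moreover have "s i \<in> N" using s by blast
      ultimately have "sing_val (X (s i)) j - sing_val Xbar j = 0" if "j \<in> {r<..CARD('n)}" for j
        using zero[of "s i" j] lim(2)[OF s' that] that by simp
      then show ?thesis
        using lim(1)[OF s'] by (simp add: L2_set_eq_0_iff)
    qed
    then show "\<exists>J. \<forall>i\<ge>J. L2_set (\<lambda>j. sing_val (X (s i)) j - sing_val Xbar j) (sv_cosupport Xbar) = 0"
      by blast
  qed
qed

end

theorem theorem1:
  fixes f :: "real^'n^'m \<Rightarrow> real"
    and ft :: "real^'n^'m \<Rightarrow> real \<Rightarrow> real"
    and X :: "nat \<Rightarrow> real^'n^'m"
    and \<mu> \<alpha> \<beta> h :: "nat \<Rightarrow> real"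
    and lam v Lf mubar \<kappa> Lt \<sigma> a \<epsilon> :: real
  assumes "CARD('n) \<le> CARD('m)"
    and "\<And>W. 0 \<le> f W"
    and "convex_on UNIV f"
    and "Lf-lipschitz_on UNIV f"
    and "0 < lam"
    and "0 < v" and "v < lam / Lf"
    and "level_bounded (objective f lam v) \<or> level_bounded (\<lambda>W. f W + lam * real (rank W))"
    and "smoothing_function f ft mubar \<kappa> Lt"
    and "GIMSPG ft lam v mubar \<kappa> \<sigma> a \<alpha> \<beta> h X \<mu>"
    and "parameter_constraints \<epsilon> \<sigma> Lt \<alpha> \<beta> h \<mu>"
  shows "changes_finitely_often_along (mu_change_indices \<mu>) (\<lambda>k. d_of v (X k)) \<and>
    (\<forall>Xbar Xstar. accumulation_point_along (mu_change_indices \<mu>) X Xbar \<and>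
                  accumulation_point_along (mu_change_indices \<mu>) X Xstar
                  \<longrightarrow> sv_cosupport Xbar = sv_cosupport Xstar) \<and>
    (\<forall>Xbar r. strict_mono r \<and> range r \<subseteq> mu_change_indices \<mu> \<and> (\<lambda>i. X (r i)) \<longlonglongrightarrow> Xbar
                  \<longrightarrow> (\<exists>J. \<forall>i\<ge>J.
                        L2_set (\<lambda>j. sing_val (X (r i)) j - sing_val Xbar j) (sv_cosupport Xbar) = 0))"
proof -
  interpret gimspg_run f ft X \<mu> \<alpha> \<beta> h lam v Lf mubar \<kappa> Lt \<sigma> a \<epsilon>
    using assms by unfold_locales auto
  show ?thesis using change_index_identification unfolding N_def .
qed

end
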